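(* Let $\varphi:\mathbb D\to\mathbb D$ be analytic. Let $\sigma:[0,1)\to(0,\infty)$ be continuous and integrable such that $\omega_\sigma(r)=\int_r^1(t-r)\sigma(t)\,dt$ is (I)-admissible. (i) If $C_\varphi$ is compact on the Hardy space $H^2$, then $C_\varphi$ is compact on $\mathcal A^2_\sigma(\mathbb D)$. (ii) If $C_\varphi$ is compact on $\mathcal A^2_\sigma(\mathbb D)$, then $C_\varphi$ is compact on the Bergman space $\mathcal A^2_0(\mathbb D)$; consequently $\displaystyle\lim_{|z|\to1^-}\frac{1-|\varphi(z)|}{1-|z|}=\infty$.
   Context: $\mathbb D$ is the open unit disc, $dA=dx\,dy/\pi$, $C_\varphi f=f\circ\varphi$. $\mathcal A^2_\sigma(\mathbb D)$ is the space of analytic $f$ on $\mathbb D$ with $\int_{\mathbb D}|f(z)|^2\sigma(|z|)\,dA(z)<\infty$; $\mathcal A^2_0(\mathbb D)$ is the case $\sigma\equiv1$. A positive integrable $\omega\in C^2[0,1)$ is (I)-admissible if: (W1) $\omega$ non-increasing; (W2) there is $\delta>0$ with $r\mapsto\omega(r)(1-r)^{-(1+\delta)}$ non-decreasing on $[0,1)$; (W3) $\lim_{r\to1^-}\omega(r)=0$; (W4(I)) $\omega$ convex and $\lim_{r\to1^-}\omega'(r)=0$. *)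

theory Defs
  imports "HOL-Analysis.Analysis"
begin

definition hardy_norm2 :: "(complex \<Rightarrow> complex) \<Rightarrow> ennreal" where
  "hardy_norm2 f = (SUP r \<in> {0..<1::real}.
      (\<integral>\<^sup>+ \<theta> \<in> {0..2*pi}. ennreal ((cmod (f (of_real r * exp (\<i> * of_real \<theta>))))\<^sup>2) \<partial>lborel)
        / ennreal (2*pi))"

definition H2 :: "(complex \<Rightarrow> complex) set" where
  "H2 = {f. f holomorphic_on ball 0 1 \<and> hardy_norm2 f < \<infinity>}"

definition H2_norm :: "(complex \<Rightarrow> complex) \<Rightarrow> real" where
  "H2_norm f = sqrt (enn2real (hardy_norm2 f))"

text \<open>Squared weighted Bergman norm, dA = dx dy / pi (lborel on complex is planar Lebesgue measure).\<close>
definition bergman_norm2 :: "(real \<Rightarrow> real) \<Rightarrow> (complex \<Rightarrow> complex) \<Rightarrow> ennreal" where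
  "bergman_norm2 \<sigma> f =
     (\<integral>\<^sup>+ z \<in> ball 0 1. ennreal ((cmod (f z))\<^sup>2 * \<sigma> (cmod z)) \<partial>lborel) / ennreal pi"

definition A2 :: "(real \<Rightarrow> real) \<Rightarrow> (complex \<Rightarrow> complex) set" where
  "A2 \<sigma> = {f. f holomorphic_on ball 0 1 \<and> bergman_norm2 \<sigma> f < \<infinity>}"

definition A2_norm :: "(real \<Rightarrow> real) \<Rightarrow> (complex \<Rightarrow> complex) \<Rightarrow> real" where
  "A2_norm \<sigma> f = sqrt (enn2real (bergman_norm2 \<sigma> f))"

definition compact_operator ::
  "(complex \<Rightarrow> complex) set \<Rightarrow> ((complex \<Rightarrow> complex) \<Rightarrow> real)
     \<Rightarrow> ((complex \<Rightarrow> complex) \<Rightarrow> (complex \<Rightarrow> complex)) \<Rightarrow> bool" where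
  "compact_operator X N T \<longleftrightarrow>
     (\<forall>f\<in>X. T f \<in> X) \<and>
     (\<forall>s :: nat \<Rightarrow> complex \<Rightarrow> complex. (\<forall>n. s n \<in> X) \<and> (\<exists>B. \<forall>n. N (s n) \<le> B) \<longrightarrow>
        (\<exists>r g. strict_mono r \<and> g \<in> X \<and> (\<lambda>k. N (T (s (r k)) - g)) \<longlonglongrightarrow> 0))"

definition comp_op :: "(complex \<Rightarrow> complex) \<Rightarrow> (complex \<Rightarrow> complex) \<Rightarrow> (complex \<Rightarrow> complex)" where
  "comp_op \<phi> f = f \<circ> \<phi>"

definition omega_sigma :: "(real \<Rightarrow> real) \<Rightarrow> real \<Rightarrow> real" where
  "omega_sigma \<sigma> r = integral {r..1} (\<lambda>t. (t - r) * \<sigma> t)"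

definition C2_on_01 :: "(real \<Rightarrow> real) \<Rightarrow> bool" where
  "C2_on_01 \<omega> \<longleftrightarrow> (\<exists>\<omega>1 \<omega>2.
     (\<forall>r\<in>{0..<1}. (\<omega> has_real_derivative \<omega>1 r) (at r within {0..<1})) \<and>
     (\<forall>r\<in>{0..<1}. (\<omega>1 has_real_derivative \<omega>2 r) (at r within {0..<1})) \<and>
     continuous_on {0..<1} \<omega>2)"

definition admissible_I :: "(real \<Rightarrow> real) \<Rightarrow> bool" where
  "admissible_I \<omega> \<longleftrightarrow>
     (\<forall>r\<in>{0..<1}. \<omega> r > 0) \<and> \<omega> integrable_on {0..<1} \<and> C2_on_01 \<omega> \<and>
     (\<forall>r s. 0 \<le> r \<and> r \<le> s \<and> s < 1 \<longrightarrow> \<omega> s \<le> \<omega> r) \<and>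
     (\<exists>\<delta>>0. \<forall>r s. 0 \<le> r \<and> r \<le> s \<and> s < 1 \<longrightarrow>
        \<omega> r / (1 - r) powr (1 + \<delta>) \<le> \<omega> s / (1 - s) powr (1 + \<delta>)) \<and>
     (\<omega> \<longlongrightarrow> 0) (at_left 1) \<and>
     convex_on {0..<1} \<omega> \<and> ((\<lambda>r. deriv \<omega> r) \<longlongrightarrow> 0) (at_left 1)"

end

theory Submission
  imports Defs "HOL-Complex_Analysis.Complex_Analysis"
begin

text \<open>
  Taylor coefficients give the Littlewood--Paley comparison of the norm of \<open>A2 \<sigma>\<close> with
  \<open>\<bar>f 0\<bar>\<^sup>2 + \<integral> \<bar>f'\<bar>\<^sup>2 \<omega>\<close>, where \<open>\<omega> = omega_sigma \<sigma>\<close>. Submean values over discs of radius comparable to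
  \<open>1 - \<bar>u\<bar>\<close> turn \<open>\<integral> \<bar>f' \<circ> \<phi>\<bar>\<^sup>2 \<bar>\<phi>'\<bar>\<^sup>2 \<omega>\<close> into an integral of \<open>\<bar>f'\<bar>\<^sup>2\<close> against the masses that the measure
  \<open>\<bar>\<phi>'\<bar>\<^sup>2 \<omega> dA\<close> gives to the sets \<open>\<phi>\<^sup>-\<^sup>1 (ball u ((1 - \<bar>u\<bar>) / 2))\<close>; the operator is compact as soon as these
  masses are \<open>o ((1 - \<bar>u\<bar>)\<^sup>2 \<omega> \<bar>u\<bar>)\<close>. For the weight \<open>1 - \<bar>z\<bar>\<close> of the Hardy space the masses are
  controlled by the norm of \<open>k \<circ> \<phi>\<close>, with \<open>k\<close> the normalised Szego kernel at \<open>u\<close>. This norm is always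
  bounded, and it tends to \<open>0\<close> if \<open>\<phi>\<close> induces a compact operator on the Hardy space. Part (i) follows since
  \<open>\<omega> r / (1 - r)\<close> is non-increasing and \<open>\<omega>\<close> is doubling. For part (ii), normalised powers of the kernels, tested against
  point evaluations, give the angular limit, and this limit provides the missing factor
  \<open>1 - \<bar>z\<bar> = o (1 - \<bar>\<phi> z\<bar>)\<close> for the unweighted Bergman space.
\<close>

section \<open>Integration over the disc\<close>

text \<open>Why \<open>\<omega>\<close> pairs with derivatives: the integral of
  \<open>r ^ (2*k+1) * (t - r)\<close> over \<open>0 \<le> r \<le> t\<close> is
  \<open>t ^ (2*k+3) / ((2*k+2) * (2*k+3))\<close>, so by Fubini a moment of \<open>\<omega>\<close>
  is a moment of \<open>\<sigma>\<close> divided by a quantity comparable to the factor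
  \<open>(k+1)^2\<close> that differentiation contributes to squared Taylor coefficients. Weights
  are compared through one geometric fact: if \<open>\<phi> z\<close> lies in the disc at
  \<open>u\<close>, then \<open>1 - |z|\<close> is at most a constant times \<open>1 - |u|\<close>.
  There \<open>\<omega> |z|\<close> is at most a constant times
  \<open>\<omega> |u| / (1 - |u|) * (1 - |z|)\<close>, a multiple of the Hardy weight. In part (ii)
  the power of the kernel is the doubling exponent \<open>m\<close>: the squared derivative of the
  test function, weighted by \<open>\<omega>\<close>, is then pointwise at most \<open>m^2\<close>
  times the Hardy integrand of the kernel, so the test functions are bounded in
  \<open>A2 \<sigma>\<close> without a new integral estimate.\<close>

lemma lborel_complex_eq_distr:
  "(lborel :: complex measure) = distr (lborel \<Otimes>\<^sub>M lborel) borel (\<lambda>(x, y). Complex x y)"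
proof (rule lborel_eqI)
  have m: "(\<lambda>p. case p of (x, y) \<Rightarrow> Complex x y) \<in> borel_measurable (lborel \<Otimes>\<^sub>M lborel)"
    unfolding Complex_eq by measurable
  fix l u :: complex
  assume le: "\<And>b. b \<in> Basis \<Longrightarrow> l \<bullet> b \<le> u \<bullet> b"
  have l: "Re l \<le> Re u" "Im l \<le> Im u" using le[of 1] le[of \<i>] by (auto simp: Basis_complex_def)
  have "(\<lambda>p. case p of (x, y) \<Rightarrow> Complex x y) -` box l u \<inter> space (lborel \<Otimes>\<^sub>M lborel)
     = box (Re l) (Re u) \<times> box (Im l) (Im u)"
    by (auto simp: space_pair_measure in_box_complex_iff)
  then show "emeasure (distr (lborel \<Otimes>\<^sub>M lborel) borel (\<lambda>(x, y). Complex x y)) (box l u) =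
       ennreal (\<Prod>b\<in>Basis. (u - l) \<bullet> b)"
    using l m by (simp add: emeasure_distr lborel.emeasure_pair_measure_Times Basis_complex_def
         ennreal_mult inner_diff_left)
qed simp

text \<open>Both orders of integration are recorded because a horizontal shear is treated on
  horizontal lines and a vertical one on vertical lines.\<close>

lemma nn_integral_lborel_complex:
  assumes [measurable]: "g \<in> borel_measurable borel"
  shows "(\<integral>\<^sup>+z. g z \<partial>(lborel :: complex measure)) = (\<integral>\<^sup>+y. \<integral>\<^sup>+x. g (Complex x y) \<partial>lborel \<partial>lborel)"
    and "(\<integral>\<^sup>+z. g z \<partial>(lborel :: complex measure)) = (\<integral>\<^sup>+x. \<integral>\<^sup>+y. g (Complex x y) \<partial>lborel \<partial>lborel)"
proof -
  have m[measurable]: "(\<lambda>p. case p of (x, y) \<Rightarrow> Complex x y) \<in> borel_measurable (lborel \<Otimes>\<^sub>M lborel)"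
    unfolding Complex_eq by measurable
  have *: "(\<integral>\<^sup>+z. g z \<partial>(lborel :: complex measure)) = (\<integral>\<^sup>+p. g (case p of (x, y) \<Rightarrow> Complex x y) \<partial>(lborel \<Otimes>\<^sub>M lborel))"
    by (subst lborel_complex_eq_distr, subst nn_integral_distr) auto
  have gm: "(\<lambda>p. g (case p of (x, y) \<Rightarrow> Complex x y)) \<in> borel_measurable (lborel \<Otimes>\<^sub>M lborel)"
    by measurable
  show "(\<integral>\<^sup>+z. g z \<partial>(lborel :: complex measure)) = (\<integral>\<^sup>+y. \<integral>\<^sup>+x. g (Complex x y) \<partial>lborel \<partial>lborel)"
    using lborel_pair.nn_integral_snd[OF gm] by (simp add: *)
  show "(\<integral>\<^sup>+z. g z \<partial>(lborel :: complex measure)) = (\<integral>\<^sup>+x. \<integral>\<^sup>+y. g (Complex x y) \<partial>lborel \<partial>lborel)"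
    using lborel.nn_integral_fst[OF gm] by (simp add: *)
qed

lemma nn_integral_lborel_translate_real:
  assumes [measurable]: "g \<in> borel_measurable borel"
  shows "(\<integral>\<^sup>+x. g (x + a) \<partial>(lborel :: real measure)) = (\<integral>\<^sup>+x. g x \<partial>lborel)"
  using nn_integral_real_affine[of g 1 a] by (simp add: add.commute)

text \<open>On each horizontal, respectively vertical, line the shear is a translation.\<close>

lemma nn_integral_lborel_shear:
  assumes [measurable]: "g \<in> borel_measurable (borel :: complex measure)"
  shows "(\<integral>\<^sup>+z. g (z + of_real (a * Im z)) \<partial>lborel) = (\<integral>\<^sup>+z. g z \<partial>lborel)"
    and "(\<integral>\<^sup>+z. g (z + \<i> * of_real (a * Re z)) \<partial>lborel) = (\<integral>\<^sup>+z. g z \<partial>lborel)"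
proof -
  have m: "(\<lambda>x. g (Complex x y)) \<in> borel_measurable borel" "(\<lambda>y. g (Complex x y)) \<in> borel_measurable borel" for x y
    unfolding Complex_eq by measurable
  have "(\<integral>\<^sup>+z. g (z + of_real (a * Im z)) \<partial>lborel) = (\<integral>\<^sup>+y. \<integral>\<^sup>+x. g (Complex (x + a * y) y) \<partial>lborel \<partial>lborel)"
    by (subst nn_integral_lborel_complex(1)) (auto simp: Complex_eq algebra_simps)
  also have "\<dots> = (\<integral>\<^sup>+y. \<integral>\<^sup>+x. g (Complex x y) \<partial>lborel \<partial>lborel)"
    by (intro nn_integral_cong nn_integral_lborel_translate_real[of "\<lambda>x. g (Complex x _)"] m)
  finally show "(\<integral>\<^sup>+z. g (z + of_real (a * Im z)) \<partial>lborel) = (\<integral>\<^sup>+z. g z \<partial>lborel)"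
    by (simp add: nn_integral_lborel_complex(1))
  have "(\<integral>\<^sup>+z. g (z + \<i> * of_real (a * Re z)) \<partial>lborel) = (\<integral>\<^sup>+x. \<integral>\<^sup>+y. g (Complex x (y + a * x)) \<partial>lborel \<partial>lborel)"
    by (subst nn_integral_lborel_complex(2)) (auto simp: Complex_eq algebra_simps)
  also have "\<dots> = (\<integral>\<^sup>+x. \<integral>\<^sup>+y. g (Complex x y) \<partial>lborel \<partial>lborel)"
    by (intro nn_integral_cong nn_integral_lborel_translate_real[of "\<lambda>y. g (Complex _ y)"] m)
  finally show "(\<integral>\<^sup>+z. g (z + \<i> * of_real (a * Re z)) \<partial>lborel) = (\<integral>\<^sup>+z. g z \<partial>lborel)"
    by (simp add: nn_integral_lborel_complex(2))
qed

text \<open>A rotation with non-real multiplier is a product of three shears.\<close>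

lemma nn_integral_lborel_rotate:
  assumes g: "g \<in> borel_measurable (borel :: complex measure)" and c: "cmod c = 1"
  shows "(\<integral>\<^sup>+z. g (c * z) \<partial>lborel) = (\<integral>\<^sup>+z. g z \<partial>lborel)"
proof -
  have non_real: "(\<integral>\<^sup>+z. g (c * z) \<partial>lborel) = (\<integral>\<^sup>+z. g z \<partial>lborel)"
    if [measurable]: "g \<in> borel_measurable borel" and c: "cmod c = 1" and s: "Im c \<noteq> 0"
    for c and g :: "complex \<Rightarrow> ennreal"
  proof -
    \<comment> \<open>For \<open>c = cos t + i sin t\<close> this is \<open>- tan (t/2)\<close>, the
      outer shear factor in the classical factorisation of a rotation.\<close>
    define p where "p = (Re c - 1) / Im c"
    have cc: "Re c * Re c + Im c * Im c = 1" using c by (simp add: cmod_def power2_eq_square)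
    have ps: "p * Im c = Re c - 1" using s by (simp add: p_def)
    have pp: "p + p * Re c = - Im c"
    proof -
      have "(p + p * Re c) * Im c = (p * Im c) * (1 + Re c)" by (simp add: algebra_simps)
      also have "\<dots> = Re c * Re c - 1" unfolding ps by (simp add: algebra_simps)
      also have "\<dots> = - Im c * Im c" using cc by linarith
      finally show ?thesis using s by (metis mult_cancel_right)
    qed
    define X where "X z = z + of_real (p * Im z)" for z :: complex
    define Y where "Y z = z + \<i> * of_real (Im c * Re z)" for z :: complex
    have eq: "c * z = X (Y (X z))" for z
    proof (rule complex_eqI)
      have "Re (X (Y (X z))) = Re z * (1 + p * Im c) + Im z * (p + p * (1 + p * Im c))"
        by (simp add: X_def Y_def algebra_simps)
      then show "Re (c * z) = Re (X (Y (X z)))" using pp by (simp add: ps algebra_simps)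
      have "Im (X (Y (X z))) = Im z * (1 + p * Im c) + Im c * Re z"
        by (simp add: X_def Y_def algebra_simps)
      then show "Im (c * z) = Im (X (Y (X z)))" by (simp add: ps algebra_simps)
    qed
    have [measurable]: "X \<in> borel_measurable borel" "Y \<in> borel_measurable borel"
      unfolding X_def[abs_def] Y_def[abs_def] by measurable
    have "(\<integral>\<^sup>+z. g (c * z) \<partial>lborel) = (\<integral>\<^sup>+z. (\<lambda>z. g (X (Y z))) (X z) \<partial>lborel)" by (simp add: eq)
    also have "\<dots> = (\<integral>\<^sup>+z. g (X (Y z)) \<partial>lborel)"
      unfolding X_def[of "_ :: complex"] by (rule nn_integral_lborel_shear(1)) measurable
    also have "\<dots> = (\<integral>\<^sup>+z. g (X z) \<partial>lborel)"
      unfolding Y_def by (rule nn_integral_lborel_shear(2)[where g = "\<lambda>z. g (X z)"]) measurable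
    also have "\<dots> = (\<integral>\<^sup>+z. g z \<partial>lborel)"
      unfolding X_def by (rule nn_integral_lborel_shear(1)) measurable
    finally show ?thesis .
  qed
  show ?thesis
  proof (cases "Im c = 0")
    case False
    then show ?thesis using non_real g c by blast
  next
    case True
    then have "c = 1 \<or> c = -1" using c by (auto simp: cmod_def complex_eq_iff)
    then show ?thesis
    proof
      \<comment> \<open>Division by \<open>Im c\<close> fails here; the half turn is performed as
        two quarter turns.\<close>
      assume "c = -1"
      then have "(\<integral>\<^sup>+z. g (c * z) \<partial>lborel) = (\<integral>\<^sup>+z. (\<lambda>z. g (\<i> * z)) (\<i> * z) \<partial>lborel)" by simp
      also have "\<dots> = (\<integral>\<^sup>+z. g (\<i> * z) \<partial>lborel)"
        by (rule non_real) (use g in \<open>auto intro: measurable_compose[rotated]\<close>)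
      also have "\<dots> = (\<integral>\<^sup>+z. g z \<partial>lborel)" by (rule non_real) (use g in auto)
      finally show ?thesis .
    qed simp
  qed
qed

text \<open>The law of the modulus on the disc and the measure with density
  \<open>2 * pi * r\<close> on \<open>[0, 1]\<close> agree on all half-lines, with value
  \<open>pi * (1 - x^2)\<close> for \<open>0 \<le> x < 1\<close>, and half-lines determine a finite
  measure.\<close>

lemma nn_integral_disc_radial:
  fixes G :: "real \<Rightarrow> ennreal"
  assumes [measurable]: "G \<in> borel_measurable borel"
  shows "(\<integral>\<^sup>+z\<in>ball (0::complex) 1. G (cmod z) \<partial>lborel)
       = (\<integral>\<^sup>+r. ennreal (2 * pi * r) * indicator {0..1} r * G r \<partial>lborel)"
proof -
  define M where "M = distr (density lborel (indicator (ball (0::complex) 1))) borel cmod"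
  define N where "N = density lborel (\<lambda>r::real. ennreal (2 * pi * r) * indicator {0..1} r)"
  have em: "emeasure M {x<..} = emeasure lborel (ball (0::complex) 1 \<inter> {z. x < cmod z})" for x
  proof -
    have S: "cmod -` {x<..} \<in> sets borel" by (rule measurable_sets_borel[OF borel_measurable_norm]) auto
    then have "emeasure M {x<..} = (\<integral>\<^sup>+z. indicator (ball 0 1) z * indicator (cmod -` {x<..}) z \<partial>lborel)"
      unfolding M_def by (subst emeasure_distr) (auto intro!: emeasure_density borel_measurable_indicator)
    also have "\<dots> = (\<integral>\<^sup>+z. indicator (ball 0 1 \<inter> cmod -` {x<..}) z \<partial>lborel)"
      by (simp add: indicator_inter_arith)
    also have "\<dots> = emeasure lborel (ball 0 1 \<inter> cmod -` {x<..})"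
      using S by simp
    finally show ?thesis by (simp add: vimage_def)
  qed
  have b: "emeasure lborel (ball (0::complex) 1) = ennreal pi"
    by (simp add: emeasure_ball eval_unit_ball_vol)
  have M_val: "emeasure M {x<..} = (if x < 0 then ennreal pi else if x < 1 then ennreal (pi * (1 - x\<^sup>2)) else 0)" for x
  proof (cases "x < 0")
    case True
    then have "ball (0::complex) 1 \<inter> {z. x < cmod z} = ball 0 1" by (auto intro: less_le_trans)
    then show ?thesis using True by (simp add: em b)
  next
    case False
    show ?thesis
    proof (cases "x < 1")
      case True
      have "ball (0::complex) 1 \<inter> {z. x < cmod z} = ball 0 1 - cball 0 x" by auto
      moreover have "emeasure lborel (ball (0::complex) 1 - cball 0 x) = ennreal pi - ennreal (pi * x\<^sup>2)"
        using True False
        by (subst emeasure_Diff) (auto simp: b emeasure_cball eval_unit_ball_vol ennreal_mult_eq_top_iff)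
      ultimately show ?thesis using True False
        by (simp add: em ennreal_minus right_diff_distrib)
    next
      case f: False
      then have "ball (0::complex) 1 \<inter> {z. x < cmod z} = {}" by auto
      then show ?thesis using f False by (simp add: em)
    qed
  qed
  have N_val: "emeasure N {x<..} = (if x < 0 then ennreal pi else if x < 1 then ennreal (pi * (1 - x\<^sup>2)) else 0)" for x
  proof -
    have F: "(\<integral>\<^sup>+r. ennreal (2 * pi * r) * indicator {a..1} r \<partial>lborel) = ennreal (pi * 1\<^sup>2 - pi * a\<^sup>2)"
      if "0 \<le> a" "a \<le> 1" for a :: real
      by (rule nn_integral_FTC_Icc[where F = "\<lambda>r. pi * r\<^sup>2"])
         (use that in \<open>auto intro!: derivative_eq_intros\<close>)
    have N_eq: "emeasure N {x<..} = (\<integral>\<^sup>+r. ennreal (2 * pi * r) * indicator {0..1} r * indicator {x<..} r \<partial>lborel)"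
      unfolding N_def by (subst emeasure_density) auto
    consider "x < 0" | "0 \<le> x" "x < 1" | "1 \<le> x" by linarith
    then show ?thesis
    proof cases
      case 1
      then have "emeasure N {x<..} = (\<integral>\<^sup>+r. ennreal (2 * pi * r) * indicator {0..1} r \<partial>lborel)"
        unfolding N_eq by (intro nn_integral_cong) (auto split: split_indicator)
      with 1 F[of 0] show ?thesis by simp
    next
      case 2
      have "AE r in lborel. r \<noteq> x" by (rule AE_lborel_singleton)
      then have "emeasure N {x<..} = (\<integral>\<^sup>+r. ennreal (2 * pi * r) * indicator {x..1} r \<partial>lborel)"
        unfolding N_eq by (intro nn_integral_cong_AE) (use 2 in \<open>auto elim!: eventually_mono split: split_indicator\<close>)
      with 2 F[of x] show ?thesis by (simp add: right_diff_distrib)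
    next
      case 3
      then have "emeasure N {x<..} = (\<integral>\<^sup>+r. 0 \<partial>(lborel :: real measure))"
        unfolding N_eq by (intro nn_integral_cong) (auto split: split_indicator)
      with 3 show ?thesis by simp
    qed
  qed
  have "M = N"
    by (rule measure_eqI_lessThan) (auto simp: M_val N_val, auto simp: M_def N_def)
  have "(\<integral>\<^sup>+z\<in>ball (0::complex) 1. G (cmod z) \<partial>lborel) = (\<integral>\<^sup>+r. G r \<partial>M)"
    unfolding M_def
    by (subst nn_integral_distr, simp, simp, subst nn_integral_density)
      (auto simp: mult.commute intro!: borel_measurable_indicator)
  also have "\<dots> = (\<integral>\<^sup>+r. ennreal (2 * pi * r) * indicator {0..1} r * G r \<partial>lborel)"
    unfolding \<open>M = N\<close> N_def by (subst nn_integral_density) auto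
  finally show ?thesis .
qed

section \<open>Parseval's identity\<close>

lemma has_integral_exp_circle:
  assumes "k \<noteq> 0"
  shows "((\<lambda>\<theta>. exp (\<i> * of_int k * of_real \<theta>)) has_integral 0) {0..2*pi}"
proof -
  let ?F = "\<lambda>\<theta>::real. exp (\<i> * of_int k * of_real \<theta>) / (\<i> * of_int k)"
  have "((\<lambda>\<theta>. exp (\<i> * of_int k * of_real \<theta>)) has_integral (?F (2*pi) - ?F 0)) {0..2*pi}"
    by (rule fundamental_theorem_of_calculus)
       (use assms in \<open>auto intro!: derivative_eq_intros has_vector_derivative_real_field\<close>)
  moreover have "exp (\<i> * of_int k * of_real (2*pi)) = 1"
    by (subst exp_eq_1) (auto intro!: exI[of _ k])
  ultimately show ?thesis by simp
qed

text \<open>Each new term is orthogonal to the partial sum before it, so the squares add up by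
  induction. All partial sums are bounded by the sum of the \<open>norm (b n)\<close>, and dominated
  convergence passes to the limit.\<close>

lemma fourier_series_has_integral:
  fixes b :: "nat \<Rightarrow> complex"
  assumes sm: "summable (\<lambda>n. norm (b n))"
  defines "G \<equiv> \<lambda>\<theta>::real. \<Sum>n. b n * exp (\<i> * of_real \<theta>) ^ n"
  shows "(G has_integral (2 * pi * b 0)) {0..2*pi}"
    and "((\<lambda>\<theta>. (cmod (G \<theta>))\<^sup>2) has_integral (2 * pi * (\<Sum>n. (cmod (b n))\<^sup>2))) {0..2*pi}"
    and "summable (\<lambda>n. (cmod (b n))\<^sup>2)"
proof -
  define E where "E n \<theta> = exp (\<i> * of_real \<theta>) ^ n" for n and \<theta> :: real
  define S where "S N \<theta> = (\<Sum>n<N. b n * E n \<theta>)" for N \<theta>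
  define B where "B = (\<Sum>n. norm (b n))"
  have nE: "cmod (E n \<theta>) = 1" for n \<theta> by (simp add: E_def norm_power)
  have sE: "summable (\<lambda>n. norm (b n * E n \<theta>))" for \<theta>
    using sm by (simp add: norm_mult nE)
  have lim: "(\<lambda>N. S N \<theta>) \<longlonglongrightarrow> G \<theta>" for \<theta>
    using summable_LIMSEQ[OF summable_norm_cancel[OF sE]] by (simp add: S_def G_def E_def)
  have bnd: "cmod (S N \<theta>) \<le> B" for N \<theta>
  proof -
    have "cmod (S N \<theta>) \<le> (\<Sum>n<N. norm (b n))"
      unfolding S_def by (rule order_trans[OF norm_sum]) (simp add: norm_mult nE)
    also have "\<dots> \<le> B" unfolding B_def by (rule sum_le_suminf[OF sm]) auto
    finally show ?thesis .
  qed
  have E0: "(E n has_integral (if n = 0 then 2*pi else 0)) {0..2*pi}" for n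
  proof (cases "n = 0")
    case True
    have E0: "E 0 = (\<lambda>\<theta>. 1)" by (simp add: E_def fun_eq_iff)
    show ?thesis using has_integral_const_real[of "1::complex" 0 "2*pi"] True
      by (simp add: E0 scaleR_conv_of_real)
  next
    case False
    have "E n = (\<lambda>\<theta>. exp (\<i> * of_int (int n) * of_real \<theta>))"
      by (auto simp: E_def fun_eq_iff exp_of_nat_mult[symmetric] mult_ac)
    then show ?thesis using has_integral_exp_circle[of "int n"] False by simp
  qed
  \<comment> \<open>The shift to \<open>Suc N\<close> keeps the constant term in every partial sum;
    \<open>S 0\<close> is zero.\<close>
  have S1: "(S (Suc N) has_integral (2 * pi * b 0)) {0..2*pi}" for N
  proof -
    have "(S (Suc N) has_integral (\<Sum>n<Suc N. b n * of_real (if n = 0 then 2*pi else 0))) {0..2*pi}"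
      unfolding S_def[abs_def] by (intro has_integral_sum has_integral_mult_right) (use E0 in auto)
    also have "(\<Sum>n<Suc N. b n * complex_of_real (if n = 0 then 2*pi else 0)) = (\<Sum>n<Suc N. if n = 0 then b 0 * (2*pi) else 0)"
      by (intro sum.cong) auto
    also have "\<dots> = 2 * pi * b 0" by simp
    finally show ?thesis .
  qed
  show "(G has_integral (2 * pi * b 0)) {0..2*pi}"
    by (rule has_integral_dominated_convergence[where f = "\<lambda>N. S (Suc N)" and h = "\<lambda>_. B", OF S1])
       (use bnd lim in \<open>auto intro: LIMSEQ_Suc\<close>)
  \<comment> \<open>For \<open>n < N\<close> the exponent \<open>n - N\<close> is a nonzero integer,
    so every term integrates to zero.\<close>
  have cross: "((\<lambda>\<theta>. S N \<theta> * cnj (b N * E N \<theta>)) has_integral 0) {0..2*pi}" for N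
  proof -
    have "((\<lambda>\<theta>. \<Sum>n<N. (b n * cnj (b N)) * exp (\<i> * of_int (int n - int N) * of_real \<theta>)) has_integral
        (\<Sum>n<N. (b n * cnj (b N)) * 0)) {0..2*pi}"
      by (intro has_integral_sum has_integral_mult_right has_integral_exp_circle) auto
    moreover have "E n \<theta> * cnj (E N \<theta>) = exp (\<i> * of_int (int n - int N) * of_real \<theta>)" for n \<theta>
      by (simp add: E_def exp_of_nat_mult[symmetric] exp_cnj exp_add[symmetric] algebra_simps)
    then have "S N \<theta> * cnj (b N * E N \<theta>) =
        (\<Sum>n<N. (b n * cnj (b N)) * exp (\<i> * of_int (int n - int N) * of_real \<theta>))" for \<theta>
      unfolding S_def sum_distrib_right
      by (intro sum.cong refl) (metis (no_types, opaque_lifting) complex_cnj_mult mult.assoc mult.left_commute)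
    ultimately show ?thesis by simp
  qed
  have S2: "((\<lambda>\<theta>. (cmod (S N \<theta>))\<^sup>2) has_integral (2 * pi * (\<Sum>n<N. (cmod (b n))\<^sup>2))) {0..2*pi}" for N
  proof (induction N)
    case 0
    then show ?case by (simp add: S_def)
  next
    case (Suc N)
    have eq: "(cmod (S (Suc N) \<theta>))\<^sup>2 = (cmod (S N \<theta>))\<^sup>2 + (cmod (b N))\<^sup>2 + 2 * Re (S N \<theta> * cnj (b N * E N \<theta>))" for \<theta>
    proof -
      have add: "(cmod (x + y))\<^sup>2 = (cmod x)\<^sup>2 + (cmod y)\<^sup>2 + 2 * Re (x * cnj y)" for x y
        unfolding cmod_power2 by (simp add: algebra_simps power2_eq_square)
      have "S (Suc N) \<theta> = S N \<theta> + b N * E N \<theta>" by (simp add: S_def)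
      then show ?thesis by (simp only: add) (simp add: norm_mult nE)
    qed
    have c: "((\<lambda>\<theta>. Re (S N \<theta> * cnj (b N * E N \<theta>))) has_integral 0) {0..2*pi}"
      using has_integral_Re[OF cross[of N]] by simp
    have "((\<lambda>\<theta>. (cmod (S N \<theta>))\<^sup>2 + (cmod (b N))\<^sup>2 + 2 * Re (S N \<theta> * cnj (b N * E N \<theta>))) has_integral
       (2 * pi * (\<Sum>n<N. (cmod (b n))\<^sup>2) + (2*pi - 0) *\<^sub>R (cmod (b N))\<^sup>2 + 2 * 0)) {0..2*pi}"
      by (intro has_integral_add has_integral_mult_right Suc.IH c)
         (use has_integral_const_real[of "(cmod (b N))\<^sup>2" 0 "2*pi"] in simp)
    then show ?case unfolding eq by (simp add: algebra_simps)
  qed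
  have sq: "summable (\<lambda>n. (cmod (b n))\<^sup>2)"
  proof (rule summable_comparison_test[OF _ summable_mult[OF sm, of B]], intro exI allI impI)
    fix n :: nat
    have "norm (b n) \<le> B" unfolding B_def using sum_le_suminf[OF sm, of "{n}"] by auto
    then show "norm ((cmod (b n))\<^sup>2) \<le> B * norm (b n)" by (simp add: power2_eq_square mult_right_mono)
  qed
  then show "summable (\<lambda>n. (cmod (b n))\<^sup>2)" .
  show "((\<lambda>\<theta>. (cmod (G \<theta>))\<^sup>2) has_integral (2 * pi * (\<Sum>n. (cmod (b n))\<^sup>2))) {0..2*pi}"
  proof (rule has_integral_dominated_convergence[where h = "\<lambda>_. B\<^sup>2", OF S2])
    show "(\<lambda>N. 2 * pi * (\<Sum>n<N. (cmod (b n))\<^sup>2)) \<longlonglongrightarrow> 2 * pi * (\<Sum>n. (cmod (b n))\<^sup>2)"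
      by (intro tendsto_mult tendsto_const summable_LIMSEQ sq)
  qed (use bnd lim in \<open>auto intro!: power_mono tendsto_intros\<close>)
qed

definition taylor_coeff :: "(complex \<Rightarrow> complex) \<Rightarrow> nat \<Rightarrow> complex" where
  "taylor_coeff F n = (deriv ^^ n) F 0 / fact n"

lemma taylor_coeff_0 [simp]: "taylor_coeff F 0 = F 0"
  by (simp add: taylor_coeff_def)

lemma taylor_coeff_deriv: "taylor_coeff (deriv F) n = of_nat (Suc n) * taylor_coeff F (Suc n)"
  by (simp add: taylor_coeff_def funpow_Suc_right del: funpow.simps of_nat_Suc)

lemma taylor_coeff_sums:
  assumes "F holomorphic_on ball 0 R" and "cmod z < R"
  shows "(\<lambda>n. taylor_coeff F n * z ^ n) sums F z"
  using holomorphic_power_series[OF assms(1), of z] assms(2) by (simp add: taylor_coeff_def)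

lemma taylor_coeff_summable_norm:
  assumes "F holomorphic_on ball 0 R" and "cmod z < R"
  shows "summable (\<lambda>n. norm (taylor_coeff F n * z ^ n))"
proof -
  obtain r where r: "cmod z < r" "r < R" using dense[OF assms(2)] by auto
  then have "cmod (of_real r) = r" using norm_ge_zero[of z] by (simp del: norm_ge_zero)
  then show ?thesis
    using powser_insidea[OF sums_summable[OF taylor_coeff_sums[OF assms(1), of "of_real r"]], of z] r by simp
qed

lemma circle_mean_value:
  fixes F :: "complex \<Rightarrow> complex"
  assumes F: "F holomorphic_on ball 0 R" and z: "cmod z < R"
  shows "((\<lambda>\<theta>. F (z * exp (\<i> * of_real \<theta>))) has_integral (2 * pi * F 0)) {0..2*pi}"
proof -
  have "(\<lambda>n. taylor_coeff F n * z ^ n * exp (\<i> * of_real \<theta>) ^ n) sums F (z * exp (\<i> * of_real \<theta>))" for \<theta>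
    using taylor_coeff_sums[OF F, of "z * exp (\<i> * of_real \<theta>)"] z
    by (simp add: norm_mult power_mult_distrib mult.assoc)
  then have "(\<Sum>n. taylor_coeff F n * z ^ n * exp (\<i> * of_real \<theta>) ^ n) = F (z * exp (\<i> * of_real \<theta>))" for \<theta>
    by (rule sums_unique[symmetric])
  then show ?thesis
    using fourier_series_has_integral(1)[OF taylor_coeff_summable_norm[OF F z]] by simp
qed

lemma circle_parseval:
  assumes F: "F holomorphic_on ball 0 R" and z: "cmod z < R"
  shows "(\<integral>\<^sup>+\<theta>\<in>{0..2*pi}. ennreal ((cmod (F (z * exp (\<i> * of_real \<theta>))))\<^sup>2) \<partial>lborel)
     = ennreal (2 * pi) * (\<Sum>n. ennreal ((cmod (taylor_coeff F n))\<^sup>2 * cmod z ^ (2*n)))"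
proof -
  note sm = taylor_coeff_summable_norm[OF F z]
  have "(\<lambda>n. taylor_coeff F n * z ^ n * exp (\<i> * of_real \<theta>) ^ n) sums F (z * exp (\<i> * of_real \<theta>))" for \<theta>
    using taylor_coeff_sums[OF F, of "z * exp (\<i> * of_real \<theta>)"] z
    by (simp add: norm_mult power_mult_distrib mult.assoc)
  then have eq: "(\<Sum>n. taylor_coeff F n * z ^ n * exp (\<i> * of_real \<theta>) ^ n) = F (z * exp (\<i> * of_real \<theta>))" for \<theta>
    by (rule sums_unique[symmetric])
  have sq: "(cmod (taylor_coeff F n * z ^ n))\<^sup>2 = (cmod (taylor_coeff F n))\<^sup>2 * cmod z ^ (2*n)" for n
    by (simp add: norm_mult power_mult_distrib norm_power power_mult[symmetric] mult.commute)
  note int = fourier_series_has_integral(2,3)[OF sm, unfolded eq sq]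
  have "(\<integral>\<^sup>+\<theta>\<in>{0..2*pi}. ennreal ((cmod (F (z * exp (\<i> * of_real \<theta>))))\<^sup>2) \<partial>lborel)
     = ennreal (2 * pi * (\<Sum>n. (cmod (taylor_coeff F n))\<^sup>2 * cmod z ^ (2*n)))"
    by (rule nn_integral_has_integral_lebesgue'[OF _ int(1)]) auto
  also have "\<dots> = ennreal (2 * pi) * (\<Sum>n. ennreal ((cmod (taylor_coeff F n))\<^sup>2 * cmod z ^ (2*n)))"
    using suminf_nonneg[OF int(2)] int(2)
    by (subst suminf_ennreal2) (auto simp: ennreal_mult)
  finally show ?thesis .
qed

text \<open>A function holomorphic on the disc is arbitrary outside it, so measurability is always
  claimed for its product with the indicator.\<close>

lemma borel_measurable_ennreal_continuous_indicator:
  fixes f :: "'a::topological_space \<Rightarrow> real"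
  assumes f: "continuous_on A f" and A: "A \<in> sets borel"
  shows "(\<lambda>x. ennreal (f x) * indicator A x) \<in> borel_measurable borel"
proof -
  have "(\<lambda>x. if x \<in> A then f x else 0) \<in> borel_measurable borel"
    by (rule borel_measurable_continuous_on_if) (use assms in auto)
  then have "(\<lambda>x. ennreal (if x \<in> A then f x else 0)) \<in> borel_measurable borel" by measurable
  moreover have "(\<lambda>x. ennreal (if x \<in> A then f x else 0)) = (\<lambda>x. ennreal (f x) * indicator A x)"
    by (auto simp: fun_eq_iff)
  ultimately show ?thesis by simp
qed

text \<open>The integral is invariant under rotation, hence equal to its average over all rotations.
  Fubini moves the average inside, and Parseval on each circle leaves only radial moments. This
  takes the place of polar coordinates.\<close>

lemma nn_integral_disc_parseval:
  fixes w :: "real \<Rightarrow> ennreal"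
  assumes F: "F holomorphic_on ball 0 R" and w [measurable]: "w \<in> borel_measurable borel"
  shows "(\<integral>\<^sup>+z\<in>ball 0 R. ennreal ((cmod (F z))\<^sup>2) * w (cmod z) \<partial>lborel)
     = (\<Sum>n. ennreal ((cmod (taylor_coeff F n))\<^sup>2) * (\<integral>\<^sup>+z\<in>ball (0::complex) R. ennreal (cmod z ^ (2*n)) * w (cmod z) \<partial>lborel))"
proof -
  define g where "g z = (ennreal ((cmod (F z))\<^sup>2) * indicator (ball 0 R) z) * w (cmod z)" for z
  have [measurable]: "(\<lambda>z. ennreal ((cmod (F z))\<^sup>2) * indicator (ball 0 R) z) \<in> borel_measurable borel"
    by (rule borel_measurable_ennreal_continuous_indicator)
       (auto intro!: continuous_intros holomorphic_on_imp_continuous_on F)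
  have g_meas[measurable]: "g \<in> borel_measurable borel" unfolding g_def[abs_def] by measurable
  have [measurable]: "ball (0::complex) R \<in> sets borel" by simp
  have e_meas[measurable]: "(\<lambda>\<theta>. exp (\<i> * complex_of_real \<theta>)) \<in> borel_measurable borel"
    by (intro borel_measurable_continuous_onI continuous_intros)
  have avg: "(\<integral>\<^sup>+\<theta>. g (z * exp (\<i> * of_real \<theta>)) * indicator {0..2*pi} \<theta> \<partial>lborel)
    = ennreal (2*pi) * ((\<Sum>n. ennreal ((cmod (taylor_coeff F n))\<^sup>2) * (ennreal (cmod z ^ (2*n)) * w (cmod z) * indicator (ball 0 R) z)))" for z
  proof (cases "z \<in> ball 0 R")
    case True
    then have z: "cmod z < R" by simp
    have m: "(\<lambda>\<theta>. ennreal ((cmod (F (z * exp (\<i> * of_real \<theta>))))\<^sup>2) * indicator {0..2*pi} \<theta>) \<in> borel_measurable borel"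
    proof (rule borel_measurable_ennreal_continuous_indicator)
      show "continuous_on {0..2*pi} (\<lambda>x. (cmod (F (z * exp (\<i> * complex_of_real x))))\<^sup>2)"
        by (intro continuous_intros continuous_on_compose2[OF holomorphic_on_imp_continuous_on[OF F]])
           (use z in \<open>auto simp: norm_mult\<close>)
    qed auto
    then have m': "(\<lambda>\<theta>. ennreal ((cmod (F (z * exp (\<i> * of_real \<theta>))))\<^sup>2) * indicator {0..2*pi} \<theta>) \<in> borel_measurable lborel"
      by simp
    have "(\<integral>\<^sup>+\<theta>. g (z * exp (\<i> * of_real \<theta>)) * indicator {0..2*pi} \<theta> \<partial>lborel)
      = (\<integral>\<^sup>+\<theta>. (ennreal ((cmod (F (z * exp (\<i> * of_real \<theta>))))\<^sup>2) * indicator {0..2*pi} \<theta>) * w (cmod z) \<partial>lborel)"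
      by (intro nn_integral_cong) (use z in \<open>auto simp: g_def norm_mult mult_ac split: split_indicator\<close>)
    also have "\<dots> = ennreal (2*pi) * ((\<Sum>n. ennreal ((cmod (taylor_coeff F n))\<^sup>2 * cmod z ^ (2*n))) * w (cmod z))"
      unfolding nn_integral_multc[OF m'] circle_parseval[OF F z] by (simp add: mult_ac)
    finally show ?thesis using True
      by (simp add: ennreal_suminf_multc[symmetric] ennreal_mult mult.assoc)
  next
    case False
    then have "g (z * exp (\<i> * of_real \<theta>)) = 0" for \<theta> by (simp add: g_def norm_mult)
    then show ?thesis using False by simp
  qed
  have "ennreal (2*pi) * (\<integral>\<^sup>+z. g z \<partial>lborel) = (\<integral>\<^sup>+\<theta>. (\<integral>\<^sup>+z. g z \<partial>lborel) * indicator {0..2*pi} \<theta> \<partial>(lborel :: real measure))"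
    by (subst nn_integral_cmult) (auto simp: mult.commute)
  also have "\<dots> = (\<integral>\<^sup>+\<theta>. (\<integral>\<^sup>+z. g (z * exp (\<i> * of_real \<theta>)) * indicator {0..2*pi} \<theta> \<partial>lborel) \<partial>(lborel :: real measure))"
  proof (rule nn_integral_cong)
    fix \<theta> :: real
    have "(\<integral>\<^sup>+z. g (z * exp (\<i> * of_real \<theta>)) \<partial>lborel) = (\<integral>\<^sup>+z. g z \<partial>lborel)"
      using nn_integral_lborel_rotate[OF g_meas, of "exp (\<i> * of_real \<theta>)"] by (simp add: mult.commute)
    then show "(\<integral>\<^sup>+z. g z \<partial>lborel) * indicator {0..2*pi} \<theta> = (\<integral>\<^sup>+z. g (z * exp (\<i> * of_real \<theta>)) * indicator {0..2*pi} \<theta> \<partial>lborel)"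
      by (subst nn_integral_multc) auto
  qed
  also have "\<dots> = (\<integral>\<^sup>+z. (\<integral>\<^sup>+\<theta>. g (z * exp (\<i> * of_real \<theta>)) * indicator {0..2*pi} \<theta> \<partial>(lborel :: real measure)) \<partial>lborel)"
    by (rule lborel_pair.Fubini'[symmetric]) measurable
  also have "\<dots> = ennreal (2*pi) * (\<integral>\<^sup>+z. (\<Sum>n. ennreal ((cmod (taylor_coeff F n))\<^sup>2) * (ennreal (cmod z ^ (2*n)) * w (cmod z) * indicator (ball 0 R) z)) \<partial>lborel)"
    unfolding avg by (rule nn_integral_cmult) measurable
  also have "(\<integral>\<^sup>+z. (\<Sum>n. ennreal ((cmod (taylor_coeff F n))\<^sup>2) * (ennreal (cmod z ^ (2*n)) * w (cmod z) * indicator (ball 0 R) z)) \<partial>lborel)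
      = (\<Sum>n. ennreal ((cmod (taylor_coeff F n))\<^sup>2) * (\<integral>\<^sup>+z. (ennreal (cmod z ^ (2*n)) * w (cmod z) * indicator (ball (0::complex) R) z) \<partial>lborel))"
    by (subst nn_integral_suminf, measurable) (intro suminf_cong nn_integral_cmult, measurable)
  finally have "(\<integral>\<^sup>+z. g z \<partial>lborel) = (\<Sum>n. ennreal ((cmod (taylor_coeff F n))\<^sup>2) * (\<integral>\<^sup>+z\<in>ball (0::complex) R. ennreal (cmod z ^ (2*n)) * w (cmod z) \<partial>lborel))"
    by (subst (asm) ennreal_mult_cancel_left) auto
  then show ?thesis by (simp add: g_def mult_ac)
qed

section \<open>Point evaluations and the Hardy norm\<close>

lemma borel_measurable_cmod_square_indicator:
  assumes "F holomorphic_on A" and "open A"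
  shows "(\<lambda>z. ennreal ((cmod (F z))\<^sup>2) * indicator A z) \<in> borel_measurable borel"
  by (rule borel_measurable_ennreal_continuous_indicator)
     (use assms in \<open>auto intro!: continuous_intros holomorphic_on_imp_continuous_on\<close>)

text \<open>After moving \<open>w\<close> to the origin, keep only the constant term of the Parseval
  expansion.\<close>

lemma nn_integral_submean:
  fixes g :: "complex \<Rightarrow> complex"
  assumes g: "g holomorphic_on ball w s" and s: "0 < s"
  shows "ennreal (pi * s\<^sup>2 * (cmod (g w))\<^sup>2) \<le> (\<integral>\<^sup>+v\<in>ball w s. ennreal ((cmod (g v))\<^sup>2) \<partial>lborel)"
proof -
  define F where "F \<zeta> = g (w + \<zeta>)" for \<zeta>
  have F: "F holomorphic_on ball 0 s"
    unfolding F_def[abs_def]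
    by (rule holomorphic_on_compose_gen[OF _ g, unfolded o_def]) (auto intro!: holomorphic_intros simp: dist_norm)
  have m: "(\<lambda>v. ennreal ((cmod (g v))\<^sup>2) * indicator (ball w s) v) \<in> borel_measurable borel"
    by (rule borel_measurable_cmod_square_indicator) (use g in auto)
  have "(\<integral>\<^sup>+v\<in>ball w s. ennreal ((cmod (g v))\<^sup>2) \<partial>lborel)
      = (\<integral>\<^sup>+v. ennreal ((cmod (g v))\<^sup>2) * indicator (ball w s) v \<partial>distr lborel borel ((+) w))"
    by (simp add: lborel_distr_plus)
  also have "\<dots> = (\<integral>\<^sup>+\<zeta>. ennreal ((cmod (F \<zeta>))\<^sup>2) * indicator (ball 0 s) \<zeta> \<partial>lborel)"
    using m by (subst nn_integral_distr) (auto simp: F_def dist_norm intro!: nn_integral_cong split: split_indicator)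
  also have "\<dots> = (\<Sum>n. ennreal ((cmod (taylor_coeff F n))\<^sup>2) * (\<integral>\<^sup>+z\<in>ball (0::complex) s. ennreal (cmod z ^ (2*n)) * 1 \<partial>lborel))"
    using nn_integral_disc_parseval[OF F, of "\<lambda>_. 1"] by simp
  also have "\<dots> \<ge> (\<Sum>n<1. ennreal ((cmod (taylor_coeff F n))\<^sup>2) * (\<integral>\<^sup>+z\<in>ball (0::complex) s. ennreal (cmod z ^ (2*n)) * 1 \<partial>lborel))"
    by (rule sum_le_suminf) auto
  finally have "ennreal ((cmod (g w))\<^sup>2) * (\<integral>\<^sup>+z. indicator (ball (0::complex) s) z \<partial>lborel) \<le> (\<integral>\<^sup>+v\<in>ball w s. ennreal ((cmod (g v))\<^sup>2) \<partial>lborel)"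
    by (simp add: F_def del: nn_integral_indicator)
  moreover have "(\<integral>\<^sup>+z. indicator (ball (0::complex) s) z \<partial>lborel) = ennreal (pi * s\<^sup>2)"
    using s by (simp add: emeasure_ball eval_unit_ball_vol)
  ultimately show ?thesis
    by (simp add: ennreal_mult'[symmetric] mult.commute)
qed

text \<open>Cauchy-Schwarz for the coefficients scaled by \<open>\<rho> ^ n\<close> against the
  powers of \<open>|z| / \<rho>\<close>, whose squares have a geometric sum. The Hardy space uses
  \<open>\<rho> = 1\<close>, the weighted Bergman space an intermediate radius.\<close>

lemma cmod_square_le_coeff:
  assumes F: "F holomorphic_on ball 0 1" and z: "cmod z < \<rho>" "\<rho> \<le> 1"
    and A: "(\<Sum>n. ennreal ((cmod (taylor_coeff F n))\<^sup>2 * \<rho> ^ (2*n))) \<le> ennreal A" "0 \<le> A"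
  shows "(cmod (F z))\<^sup>2 \<le> A / (1 - (cmod z / \<rho>)\<^sup>2)"
proof -
  define q where "q = cmod z / \<rho>"
  have \<rho>: "0 < \<rho>" using z norm_ge_zero[of z] by linarith
  have q: "0 \<le> q" "q < 1" using z \<rho> by (auto simp: q_def)
  then have q2: "q\<^sup>2 < 1" by (simp add: power_less_one_iff abs_square_less_1)
  have partial: "(cmod (\<Sum>n<N. taylor_coeff F n * z ^ n))\<^sup>2 \<le> A / (1 - q\<^sup>2)" for N
  proof -
    have "(\<Sum>n<N. ennreal ((cmod (taylor_coeff F n))\<^sup>2 * \<rho> ^ (2*n))) \<le> ennreal A"
      by (rule order_trans[OF sum_le_suminf A(1)]) auto
    then have a: "(\<Sum>n<N. (cmod (taylor_coeff F n))\<^sup>2 * \<rho> ^ (2*n)) \<le> A"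
      using A(2) \<rho> by (subst (asm) sum_ennreal) (auto simp: ennreal_le_iff)
    have "(\<Sum>n<N. (q\<^sup>2) ^ n) \<le> (\<Sum>n. (q\<^sup>2) ^ n)"
      by (rule sum_le_suminf) (use q2 in \<open>auto intro!: summable_geometric\<close>)
    also have "\<dots> = 1 / (1 - q\<^sup>2)" using q2 by (subst suminf_geometric) auto
    finally have b: "(\<Sum>n<N. (q\<^sup>2) ^ n) \<le> 1 / (1 - q\<^sup>2)" .
    have "cmod (\<Sum>n<N. taylor_coeff F n * z ^ n) \<le> (\<Sum>n<N. cmod (taylor_coeff F n) * \<rho> ^ n * q ^ n)"
      by (rule order_trans[OF norm_sum], rule eq_refl, rule sum.cong)
         (use \<rho> in \<open>auto simp: norm_mult norm_power q_def power_divide\<close>)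
    then have "(cmod (\<Sum>n<N. taylor_coeff F n * z ^ n))\<^sup>2 \<le> (\<Sum>n<N. (cmod (taylor_coeff F n) * \<rho> ^ n) * q ^ n)\<^sup>2"
      by (intro power_mono) auto
    also have "\<dots> \<le> (\<Sum>n<N. (cmod (taylor_coeff F n) * \<rho> ^ n)\<^sup>2) * (\<Sum>n<N. (q ^ n)\<^sup>2)"
      by (rule Cauchy_Schwarz_ineq_sum)
    also have "\<dots> = (\<Sum>n<N. (cmod (taylor_coeff F n))\<^sup>2 * \<rho> ^ (2*n)) * (\<Sum>n<N. (q\<^sup>2) ^ n)"
      by (simp add: power_mult_distrib power_mult[symmetric] mult.commute)
    also have "\<dots> \<le> A * (1 / (1 - q\<^sup>2))"
      by (rule mult_mono[OF a b A(2)]) (auto intro!: sum_nonneg)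
    finally show ?thesis by simp
  qed
  have "(\<lambda>N. \<Sum>n<N. taylor_coeff F n * z ^ n) \<longlonglongrightarrow> F z"
    using taylor_coeff_sums[OF F, of z] z by (simp add: sums_def)
  then have "(\<lambda>N. (cmod (\<Sum>n<N. taylor_coeff F n * z ^ n))\<^sup>2) \<longlonglongrightarrow> (cmod (F z))\<^sup>2"
    by (intro tendsto_intros)
  then show ?thesis unfolding q_def[symmetric] by (rule LIMSEQ_le_const2) (use partial in auto)
qed

text \<open>This is the inner integral after Fubini when \<open>\<omega>\<close> is written as an
  integral of \<open>(t - r) * \<sigma> t\<close>; with \<open>t = 1\<close> it gives the moments of
  the Hardy weight \<open>1 - r\<close>.\<close>

lemma nn_integral_moment_kernel:
  assumes t: "0 \<le> t"
  shows "(\<integral>\<^sup>+r\<in>{0..t}. ennreal (r ^ (2*k+1) * (t - r)) \<partial>lborel) = ennreal (t ^ (2*k+3) / ((2*k+2) * (2*k+3)))"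
proof -
  let ?F = "\<lambda>r. t * r ^ (2*k+2) / (2*k+2) - r ^ (2*k+3) / (2*k+3)"
  have "(\<integral>\<^sup>+r\<in>{0..t}. ennreal (r ^ (2*k+1) * (t - r)) \<partial>lborel) = ennreal (?F t - ?F 0)"
  proof (rule nn_integral_FTC_Icc)
    fix r :: real
    have pow: "((\<lambda>r. r ^ Suc p / real (Suc p)) has_real_derivative r ^ p) (at r)" for p
      by (rule DERIV_cong[OF DERIV_cdivide[OF DERIV_pow]]) simp
    have "((\<lambda>r. t * (r ^ Suc (2*k+1) / real (Suc (2*k+1))) - r ^ Suc (2*k+2) / real (Suc (2*k+2)))
        has_real_derivative (t * r ^ (2*k+1) - r ^ (2*k+2))) (at r)"
      by (intro DERIV_diff DERIV_cmult pow)
    also have "(\<lambda>r. t * (r ^ Suc (2*k+1) / real (Suc (2*k+1))) - r ^ Suc (2*k+2) / real (Suc (2*k+2))) = ?F"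
      by (simp add: eval_nat_numeral add.commute)
    also have "t * r ^ (2*k+1) - r ^ (2*k+2) = r ^ (2*k+1) * (t - r)"
      by (simp add: algebra_simps)
    finally show "(?F has_real_derivative (r ^ (2*k+1) * (t - r))) (at r)" .
  qed (use t in auto)
  also have "?F t - ?F 0 = t ^ (2*k+3) / ((2*k+2) * (2*k+3))"
  proof -
    have p: "t * t ^ (2*k+2) = t ^ (2*k+3)" by (simp add: numeral_3_eq_3)
    have "?F t - ?F 0 = t ^ (2*k+3) * (1 / (2*k+2) - 1 / (2*k+3))"
      unfolding p by (simp add: algebra_simps)
    also have "1 / real (2*k+2) - 1 / real (2*k+3) = 1 / ((2*k+2) * (2*k+3))"
      by (simp add: field_simps)
    finally show ?thesis by simp
  qed
  finally show ?thesis .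
qed

text \<open>A finite partial sum is continuous in \<open>r\<close> up to 1, so the bound on each
  circle passes to the limit without exchanging limit and series.\<close>

lemma suminf_taylor_coeff_le_hardy:
  assumes F: "F holomorphic_on ball 0 1"
  shows "(\<Sum>n. ennreal ((cmod (taylor_coeff F n))\<^sup>2)) \<le> hardy_norm2 F"
proof -
  have "(\<Sum>n<N. ennreal ((cmod (taylor_coeff F n))\<^sup>2)) \<le> hardy_norm2 F" for N
  proof -
    let ?s = "\<lambda>r. \<Sum>n<N. ennreal ((cmod (taylor_coeff F n))\<^sup>2 * r ^ (2*n))"
    have le: "?s r \<le> hardy_norm2 F" if r: "0 < r" "r < 1" for r
    proof -
      have "?s r \<le> (\<Sum>n. ennreal ((cmod (taylor_coeff F n))\<^sup>2 * r ^ (2*n)))"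
        by (rule sum_le_suminf) auto
      also have "\<dots> = (ennreal (2*pi) * (\<Sum>n. ennreal ((cmod (taylor_coeff F n))\<^sup>2 * r ^ (2*n)))) / ennreal (2*pi)"
        by (subst mult.commute, subst ennreal_mult_divide_eq) auto
      also have "\<dots> = (\<integral>\<^sup>+\<theta>\<in>{0..2*pi}. ennreal ((cmod (F (of_real r * exp (\<i> * of_real \<theta>))))\<^sup>2) \<partial>lborel) / ennreal (2*pi)"
        by (subst circle_parseval[OF F]) (use r in \<open>simp_all only: norm_of_real abs_of_pos\<close>)
      also have "\<dots> \<le> hardy_norm2 F"
        unfolding hardy_norm2_def using r by (intro SUP_upper) auto
      finally show ?thesis .
    qed
    have "(?s \<longlongrightarrow> (\<Sum>n<N. ennreal ((cmod (taylor_coeff F n))\<^sup>2 * 1 ^ (2*n)))) (at_left 1)"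
      by (intro tendsto_sum tendsto_ennrealI tendsto_intros)
    moreover have "eventually (\<lambda>r. ?s r \<le> hardy_norm2 F) (at_left 1)"
      using eventually_at_left_real[OF zero_less_one] by (rule eventually_mono, intro le) auto
    ultimately show ?thesis
      by (auto intro!: tendsto_upperbound[where F = "at_left (1::real)"])
  qed
  then show ?thesis unfolding suminf_eq_SUP by (intro SUP_least)
qed

text \<open>The moment of order \<open>k\<close> is \<open>2 * pi / ((2*k+2) * (2*k+3))\<close>,
  which absorbs the factor \<open>(k+1)^2\<close> coming from the coefficients of
  \<open>deriv F\<close>.\<close>

lemma littlewood_paley_hardy:
  assumes F: "F holomorphic_on ball 0 1"
  shows "(\<integral>\<^sup>+z\<in>ball 0 1. ennreal ((cmod (deriv F z))\<^sup>2 * (1 - cmod z)) \<partial>lborel) \<le> ennreal (2*pi) * hardy_norm2 F"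
proof -
  have dF: "deriv F holomorphic_on ball 0 1" using F by (rule holomorphic_deriv) auto
  have mom: "(\<integral>\<^sup>+z\<in>ball (0::complex) 1. ennreal (cmod z ^ (2*k)) * ennreal (1 - cmod z) \<partial>lborel) = ennreal (2 * pi / ((2*k+2) * (2*k+3)))" for k :: nat
  proof -
    have "(\<integral>\<^sup>+z\<in>ball (0::complex) 1. ennreal (cmod z ^ (2*k)) * ennreal (1 - cmod z) \<partial>lborel)
      = (\<integral>\<^sup>+r. ennreal (2 * pi * r) * indicator {0..1} r * (ennreal (r ^ (2*k)) * ennreal (1 - r)) \<partial>lborel)"
      by (rule nn_integral_disc_radial[where G = "\<lambda>r. ennreal (r ^ (2*k)) * ennreal (1 - r)"]) measurable
    also have "\<dots> = (\<integral>\<^sup>+r. ennreal (2 * pi) * (ennreal (r ^ (2*k+1) * (1 - r)) * indicator {0..1} r) \<partial>lborel)"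
      by (intro nn_integral_cong) (auto simp: ennreal_mult'[symmetric] mult_ac split: split_indicator)
    also have "\<dots> = ennreal (2*pi) * ennreal (1 ^ (2*k+3) / ((2*k+2) * (2*k+3)))"
      by (subst nn_integral_cmult) (use nn_integral_moment_kernel[of 1 k] in auto)
    finally show ?thesis by (simp add: ennreal_mult'[symmetric])
  qed
  have "(\<integral>\<^sup>+z\<in>ball 0 1. ennreal ((cmod (deriv F z))\<^sup>2 * (1 - cmod z)) \<partial>lborel)
     = (\<integral>\<^sup>+z\<in>ball 0 1. ennreal ((cmod (deriv F z))\<^sup>2) * ennreal (1 - cmod z) \<partial>lborel)"
    by (simp add: ennreal_mult')
  also have "\<dots> = (\<Sum>k. ennreal ((cmod (taylor_coeff (deriv F) k))\<^sup>2) * ennreal (2 * pi / ((2*k+2) * (2*k+3))))"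
    by (subst nn_integral_disc_parseval[OF dF, of "\<lambda>r. ennreal (1 - r)"]) (auto simp: mom)
  also have "\<dots> \<le> (\<Sum>k. ennreal (2*pi) * ennreal ((cmod (taylor_coeff F (Suc k)))\<^sup>2))"
  proof (rule suminf_le)
    fix k :: nat
    have "(real (Suc k))\<^sup>2 * (1 / ((2*k+2) * (2*k+3))) \<le> 1"
    proof -
      have "(real (Suc k))\<^sup>2 \<le> (2*k+2) * (2*k+3)"
        by (simp add: power2_eq_square algebra_simps)
      moreover have "0 < real ((2 * k + 2) * (2*k+3))" by (simp only: of_nat_0_less_iff) simp
      ultimately show ?thesis by (simp only: times_divide_eq_right mult_1_right divide_le_eq_1_pos)
    qed
    then have "(2 * pi * (cmod (taylor_coeff F (Suc k)))\<^sup>2) * ((real (Suc k))\<^sup>2 * (1 / ((2*k+2) * (2*k+3)))) \<le> (2 * pi * (cmod (taylor_coeff F (Suc k)))\<^sup>2) * 1"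
      by (rule mult_left_mono) auto
    then show "ennreal ((cmod (taylor_coeff (deriv F) k))\<^sup>2) * ennreal (2 * pi / ((2*k+2) * (2*k+3))) \<le> ennreal (2*pi) * ennreal ((cmod (taylor_coeff F (Suc k)))\<^sup>2)"
      unfolding taylor_coeff_deriv norm_mult norm_of_nat power_mult_distrib
      by (subst (1 2) ennreal_mult'[symmetric]) (auto intro!: ennreal_leI simp: mult_ac)
  qed auto
  also have "\<dots> = ennreal (2*pi) * (\<Sum>k. ennreal ((cmod (taylor_coeff F (Suc k)))\<^sup>2))"
    by (rule ennreal_suminf_cmult)
  also have "\<dots> \<le> ennreal (2*pi) * (\<Sum>n. ennreal ((cmod (taylor_coeff F n))\<^sup>2))"
    by (intro mult_left_mono, subst (2) suminf_offset[where i = 1]) auto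
  also have "\<dots> \<le> ennreal (2*pi) * hardy_norm2 F"
    by (intro mult_left_mono suminf_taylor_coeff_le_hardy F) auto
  finally show ?thesis .
qed

lemma hardy_point_bound:
  assumes F: "F \<in> H2" and z: "cmod z < 1"
  shows "(cmod (F z))\<^sup>2 \<le> (H2_norm F)\<^sup>2 / (1 - (cmod z)\<^sup>2)"
proof -
  have hol: "F holomorphic_on ball 0 1" and fin: "hardy_norm2 F < \<infinity>" using F by (auto simp: H2_def)
  have "hardy_norm2 F = ennreal ((H2_norm F)\<^sup>2)" using fin by (simp add: H2_norm_def)
  then have "(\<Sum>n. ennreal ((cmod (taylor_coeff F n))\<^sup>2 * 1 ^ (2*n))) \<le> ennreal ((H2_norm F)\<^sup>2)"
    using suminf_taylor_coeff_le_hardy[OF hol] by (simp only: power_one mult_1_right)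
  from cmod_square_le_coeff[OF hol z order_refl this] show ?thesis by (simp only: div_by_1 zero_le_power2)
qed

section \<open>Weighted Bergman norms\<close>

lemma ball_complex_measurable [measurable]: "ball (c::complex) r \<in> sets borel"
  by simp

text \<open>Assumption \<open>doubling\<close> is (W2) with the exponent \<open>1 + \<delta>\<close> rounded up to a natural number.\<close>

locale weight =
  fixes \<sigma> \<omega> :: "real \<Rightarrow> real" and m :: nat
  assumes cont_\<sigma>: "continuous_on {0..<1} \<sigma>"
    and pos_\<sigma>: "\<And>t. 0 \<le> t \<Longrightarrow> t < 1 \<Longrightarrow> 0 < \<sigma> t"
    and fin_\<sigma>: "(\<integral>\<^sup>+t\<in>{0..<1}. ennreal (\<sigma> t) \<partial>lborel) < \<infinity>"
    and cont_\<omega>: "continuous_on {0..<1} \<omega>"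
    and pos_\<omega>: "\<And>r. 0 \<le> r \<Longrightarrow> r < 1 \<Longrightarrow> 0 < \<omega> r"
    and \<omega>_eq: "\<And>r. 0 \<le> r \<Longrightarrow> r < 1 \<Longrightarrow> (\<integral>\<^sup>+t\<in>{r..<1}. ennreal ((t - r) * \<sigma> t) \<partial>lborel) = ennreal (\<omega> r)"
    and doubling: "\<And>r s. 0 \<le> r \<Longrightarrow> r \<le> s \<Longrightarrow> s < 1 \<Longrightarrow> \<omega> r * (1 - s) ^ m \<le> \<omega> s * (1 - r) ^ m"
    and m_pos: "0 < m"
begin

text \<open>Cut off outside \<open>[0, 1)\<close>, the weights are Borel on the whole line and can
  serve as the radial factor in \<open>nn_integral_disc_parseval\<close>.\<close>

definition W :: "real \<Rightarrow> ennreal" where "W r = ennreal (\<sigma> r) * indicator {0..<1} r"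

definition V :: "real \<Rightarrow> ennreal" where "V r = ennreal (\<omega> r) * indicator {0..<1} r"

lemma W_measurable [measurable]: "W \<in> borel_measurable borel"
  unfolding W_def[abs_def] by (rule borel_measurable_ennreal_continuous_indicator[OF cont_\<sigma>]) simp

lemma V_measurable [measurable]: "V \<in> borel_measurable borel"
  unfolding V_def[abs_def] by (rule borel_measurable_ennreal_continuous_indicator[OF cont_\<omega>]) simp

lemma \<omega>_kernel_measurable:
  assumes "0 \<le> r"
  shows "(\<lambda>t. ennreal ((t - r) * \<sigma> t) * indicator {r..<1} t) \<in> borel_measurable borel"
  by (rule borel_measurable_ennreal_continuous_indicator)
     (use assms in \<open>auto intro!: continuous_intros continuous_on_subset[OF cont_\<sigma>]\<close>)

text \<open>For fixed \<open>t\<close> the quotient \<open>(t - r) / (1 - r)\<close> decreases as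
  \<open>r\<close> grows to \<open>t\<close>, and \<open>\<omega> r / (1 - r)\<close> is the
  integral of these quotients against \<open>\<sigma>\<close>.\<close>

lemma \<omega>_ratio:
  assumes r: "0 \<le> r" "r \<le> s" "s < 1"
  shows "\<omega> s * (1 - r) \<le> \<omega> r * (1 - s)"
proof -
  have "ennreal (1 - r) * (\<integral>\<^sup>+t\<in>{s..<1}. ennreal ((t - s) * \<sigma> t) \<partial>lborel)
      = (\<integral>\<^sup>+t. ennreal (1 - r) * (ennreal ((t - s) * \<sigma> t) * indicator {s..<1} t) \<partial>lborel)"
    using \<omega>_kernel_measurable[of s] r by (subst nn_integral_cmult) auto
  also have "\<dots> \<le> (\<integral>\<^sup>+t. ennreal (1 - s) * (ennreal ((t - r) * \<sigma> t) * indicator {r..<1} t) \<partial>lborel)"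
  proof (rule nn_integral_mono)
    fix t :: real
    show "ennreal (1 - r) * (ennreal ((t - s) * \<sigma> t) * indicator {s..<1} t) \<le> ennreal (1 - s) * (ennreal ((t - r) * \<sigma> t) * indicator {r..<1} t)"
    proof (cases "t \<in> {s..<1}")
      case True
      \<comment> \<open>This product is the difference of the two sides of the next
        inequality.\<close>
      have "0 \<le> (s - r) * (1 - t)" using r True by (intro mult_nonneg_nonneg) auto
      then have "(1 - r) * (t - s) \<le> (1 - s) * (t - r)" by (simp add: algebra_simps)
      then have "((1 - r) * (t - s)) * \<sigma> t \<le> ((1 - s) * (t - r)) * \<sigma> t"
        using pos_\<sigma>[of t] True r by (intro mult_right_mono) auto
      then show ?thesis using True r
        by (simp add: ennreal_mult'[symmetric] mult.assoc ennreal_leI)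
    qed simp
  qed
  also have "\<dots> = ennreal (1 - s) * (\<integral>\<^sup>+t\<in>{r..<1}. ennreal ((t - r) * \<sigma> t) \<partial>lborel)"
    using \<omega>_kernel_measurable[of r] r by (subst nn_integral_cmult) auto
  finally have "ennreal ((1 - r) * \<omega> s) \<le> ennreal ((1 - s) * \<omega> r)"
    using r by (simp add: \<omega>_eq ennreal_mult')
  then show ?thesis using r pos_\<omega>[of r] by (simp add: ennreal_le_iff mult.commute)
qed

lemma \<omega>_antimono:
  assumes r: "0 \<le> r" "r \<le> s" "s < 1"
  shows "\<omega> s \<le> \<omega> r"
proof -
  have "\<omega> r * (1 - s) \<le> \<omega> r * (1 - r)"
    using pos_\<omega>[of r] r by (intro mult_left_mono) auto
  then have "\<omega> s * (1 - r) \<le> \<omega> r * (1 - r)"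
    using \<omega>_ratio[OF r] by linarith
  then show ?thesis using r by simp
qed

text \<open>This is \<open>pi\<close> times the squared norm, kept in \<open>ennreal\<close> so that
  estimates can be made before membership in \<open>A2 \<sigma>\<close> is known.\<close>

definition N2 :: "(complex \<Rightarrow> complex) \<Rightarrow> ennreal" where
  "N2 f = (\<integral>\<^sup>+z\<in>ball 0 1. ennreal ((cmod (f z))\<^sup>2) * W (cmod z) \<partial>lborel)"

text \<open>The argument stands for a derivative: \<open>D2 (deriv f)\<close> is the weighted
  Dirichlet integral of \<open>f\<close>.\<close>

definition D2 :: "(complex \<Rightarrow> complex) \<Rightarrow> ennreal" where
  "D2 f = (\<integral>\<^sup>+z\<in>ball 0 1. ennreal ((cmod (f z))\<^sup>2) * V (cmod z) \<partial>lborel)"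

definition mass :: ennreal where
  "mass = (\<integral>\<^sup>+z\<in>ball (0::complex) 1. W (cmod z) \<partial>lborel)"

lemma bergman_norm2_eq: "bergman_norm2 \<sigma> f = N2 f / ennreal pi"
proof -
  have "(\<integral>\<^sup>+z\<in>ball 0 1. ennreal ((cmod (f z))\<^sup>2 * \<sigma> (cmod z)) \<partial>lborel) = N2 f"
    unfolding N2_def by (intro nn_integral_cong) (auto simp: W_def ennreal_mult' split: split_indicator)
  then show ?thesis by (simp add: bergman_norm2_def)
qed

lemma N2_eq: "N2 f = ennreal pi * bergman_norm2 \<sigma> f"
  unfolding bergman_norm2_eq by (subst ennreal_times_divide, subst mult.commute, subst ennreal_mult_divide_eq) auto

lemma A2_iff: "f \<in> A2 \<sigma> \<longleftrightarrow> f holomorphic_on ball 0 1 \<and> N2 f < \<infinity>"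
  by (auto simp: A2_def N2_eq ennreal_mult_less_top)

lemma N2_eq_norm:
  assumes "f \<in> A2 \<sigma>"
  shows "N2 f = ennreal (pi * (A2_norm \<sigma> f)\<^sup>2)"
proof -
  have "bergman_norm2 \<sigma> f < \<infinity>" using assms by (simp add: A2_def)
  then show ?thesis by (simp add: N2_eq A2_norm_def ennreal_mult)
qed

lemma A2_norm_tendsto_0:
  assumes "\<And>n. f n \<in> A2 \<sigma>"
  shows "(\<lambda>n. A2_norm \<sigma> (f n)) \<longlonglongrightarrow> 0 \<longleftrightarrow> (\<lambda>n. N2 (f n)) \<longlonglongrightarrow> 0"
proof -
  have "(\<lambda>n. N2 (f n)) \<longlonglongrightarrow> 0 \<longleftrightarrow> (\<lambda>n. pi * (A2_norm \<sigma> (f n))\<^sup>2) \<longlonglongrightarrow> 0"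
    unfolding N2_eq_norm[OF assms] ennreal_0[symmetric] by (rule tendsto_ennreal_iff) auto
  also have "\<dots> \<longleftrightarrow> (\<lambda>n. A2_norm \<sigma> (f n)) \<longlonglongrightarrow> 0"
  proof
    assume "(\<lambda>n. pi * (A2_norm \<sigma> (f n))\<^sup>2) \<longlonglongrightarrow> 0"
    then have "(\<lambda>n. sqrt ((pi * (A2_norm \<sigma> (f n))\<^sup>2) / pi)) \<longlonglongrightarrow> sqrt (0 / pi)" by (intro tendsto_intros) auto
    then show "(\<lambda>n. A2_norm \<sigma> (f n)) \<longlonglongrightarrow> 0" by (simp add: A2_norm_def)
  next
    assume "(\<lambda>n. A2_norm \<sigma> (f n)) \<longlonglongrightarrow> 0"
    then have "(\<lambda>n. pi * (A2_norm \<sigma> (f n))\<^sup>2) \<longlonglongrightarrow> pi * 0\<^sup>2" by (intro tendsto_intros)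
    then show "(\<lambda>n. pi * (A2_norm \<sigma> (f n))\<^sup>2) \<longlonglongrightarrow> 0" by simp
  qed
  finally show ?thesis by blast
qed

lemma N2_integrand_measurable:
  assumes "f holomorphic_on ball 0 1"
  shows "(\<lambda>z. ennreal ((cmod (f z))\<^sup>2) * W (cmod z) * indicator (ball 0 1) z) \<in> borel_measurable borel"
    and "(\<lambda>z. ennreal ((cmod (f z))\<^sup>2) * V (cmod z) * indicator (ball 0 1) z) \<in> borel_measurable borel"
proof -
  have [measurable]: "(\<lambda>z. ennreal ((cmod (f z))\<^sup>2) * indicator (ball 0 1) z) \<in> borel_measurable borel"
    by (rule borel_measurable_cmod_square_indicator) (use assms in auto)
  have "(\<lambda>z. (ennreal ((cmod (f z))\<^sup>2) * indicator (ball 0 1) z) * W (cmod z)) \<in> borel_measurable borel"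
    "(\<lambda>z. (ennreal ((cmod (f z))\<^sup>2) * indicator (ball 0 1) z) * V (cmod z)) \<in> borel_measurable borel"
    by measurable
  then show "(\<lambda>z. ennreal ((cmod (f z))\<^sup>2) * W (cmod z) * indicator (ball 0 1) z) \<in> borel_measurable borel"
    and "(\<lambda>z. ennreal ((cmod (f z))\<^sup>2) * V (cmod z) * indicator (ball 0 1) z) \<in> borel_measurable borel"
    by (simp_all only: mult_ac)
qed

text \<open>The crude bound \<open>(a + b)^2 \<le> 2 * a^2 + 2 * b^2\<close> replaces Minkowski's
  inequality; the factor 2 is harmless for finiteness and boundedness.\<close>

lemma N2_diff_le:
  assumes f: "f holomorphic_on ball 0 1" and g: "g holomorphic_on ball 0 1"
  shows "N2 (f - g) \<le> 2 * N2 f + 2 * N2 g"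
proof -
  have "N2 (f - g) \<le> (\<integral>\<^sup>+z. 2 * (ennreal ((cmod (f z))\<^sup>2) * W (cmod z) * indicator (ball 0 1) z)
      + 2 * (ennreal ((cmod (g z))\<^sup>2) * W (cmod z) * indicator (ball 0 1) z) \<partial>lborel)"
    unfolding N2_def
  proof (rule nn_integral_mono)
    fix z :: complex
    have "(cmod (f z - g z))\<^sup>2 \<le> (cmod (f z) + cmod (g z))\<^sup>2"
      by (intro power_mono norm_triangle_ineq4) auto
    also have "\<dots> \<le> 2 * (cmod (f z))\<^sup>2 + 2 * (cmod (g z))\<^sup>2"
      using sum_squares_bound[of "cmod (f z)" "cmod (g z)"] by (simp add: power2_sum)
    finally have "ennreal ((cmod (f z - g z))\<^sup>2) \<le> 2 * ennreal ((cmod (f z))\<^sup>2) + 2 * ennreal ((cmod (g z))\<^sup>2)"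
      by (drule_tac ennreal_leI) (simp add: ennreal_mult')
    then have "ennreal ((cmod (f z - g z))\<^sup>2) * (W (cmod z) * indicator (ball 0 1) z) \<le> (2 * ennreal ((cmod (f z))\<^sup>2) + 2 * ennreal ((cmod (g z))\<^sup>2)) * (W (cmod z) * indicator (ball 0 1) z)"
      by (rule mult_right_mono) auto
    then show "ennreal ((cmod ((f - g) z))\<^sup>2) * W (cmod z) * indicator (ball 0 1) z \<le> 2 * (ennreal ((cmod (f z))\<^sup>2) * W (cmod z) * indicator (ball 0 1) z) + 2 * (ennreal ((cmod (g z))\<^sup>2) * W (cmod z) * indicator (ball 0 1) z)"
      by (simp add: distrib_right mult.assoc)
  qed
  also have "\<dots> = 2 * N2 f + 2 * N2 g"
    unfolding N2_def using N2_integrand_measurable(1)[OF f] N2_integrand_measurable(1)[OF g]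
    by (subst nn_integral_add) (auto simp: nn_integral_cmult)
  finally show ?thesis .
qed

lemma A2_diff: "f \<in> A2 \<sigma> \<Longrightarrow> g \<in> A2 \<sigma> \<Longrightarrow> f - g \<in> A2 \<sigma>"
  unfolding A2_iff
  by (auto intro!: holomorphic_on_diff simp: fun_diff_def)
     (auto intro!: le_less_trans[OF N2_diff_le, unfolded fun_diff_def] simp: ennreal_mult_less_top)

lemma N2_cong: "(\<And>z. cmod z < 1 \<Longrightarrow> f z = g z) \<Longrightarrow> N2 f = N2 g"
  unfolding N2_def by (intro nn_integral_cong) (auto split: split_indicator)

lemma mass_finite: "mass < \<infinity>"
proof -
  have "mass = (\<integral>\<^sup>+r. ennreal (2 * pi * r) * indicator {0..1} r * W r \<partial>lborel)"
    unfolding mass_def by (rule nn_integral_disc_radial) measurable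
  also have "\<dots> \<le> (\<integral>\<^sup>+r. ennreal (2*pi) * W r \<partial>lborel)"
    by (intro nn_integral_mono) (auto simp: W_def split: split_indicator intro!: mult_right_mono ennreal_leI)
  also have "\<dots> = ennreal (2*pi) * (\<integral>\<^sup>+r\<in>{0..<1}. ennreal (\<sigma> r) \<partial>lborel)"
    by (subst nn_integral_cmult) (simp_all add: W_measurable, simp add: W_def[abs_def])
  also have "\<dots> < \<infinity>" using fin_\<sigma> by (auto simp: ennreal_mult_less_top)
  finally show ?thesis .
qed

lemma N2_bounded:
  assumes "\<And>z. cmod z < 1 \<Longrightarrow> cmod (f z) \<le> B"
  shows "N2 f \<le> ennreal (B\<^sup>2) * mass"
proof -
  have "N2 f \<le> (\<integral>\<^sup>+z. ennreal (B\<^sup>2) * (W (cmod z) * indicator (ball (0::complex) 1) z) \<partial>lborel)"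
    unfolding N2_def by (intro nn_integral_mono)
      (auto split: split_indicator intro!: mult_right_mono ennreal_leI power_mono assms)
  also have "\<dots> = ennreal (B\<^sup>2) * mass" unfolding mass_def
    by (rule nn_integral_cmult) measurable
  finally show ?thesis .
qed

definition moment :: "nat \<Rightarrow> ennreal" where
  "moment n = (\<integral>\<^sup>+z\<in>ball (0::complex) 1. ennreal (cmod z ^ (2*n)) * W (cmod z) \<partial>lborel)"

lemma moment_0: "moment 0 = mass"
  by (simp add: moment_def mass_def)

lemma moment_radial: "moment n = (\<integral>\<^sup>+t. ennreal (2 * pi * t ^ (2*n+1)) * W t \<partial>lborel)"
proof -
  have "moment n = (\<integral>\<^sup>+r. ennreal (2 * pi * r) * indicator {0..1} r * (ennreal (r ^ (2*n)) * W r) \<partial>lborel)"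
    unfolding moment_def by (rule nn_integral_disc_radial[where G = "\<lambda>r. ennreal (r ^ (2*n)) * W r"]) measurable
  also have "\<dots> = (\<integral>\<^sup>+t. ennreal (2 * pi * t ^ (2*n+1)) * W t \<partial>lborel)"
  proof (rule nn_integral_cong)
    fix t :: real
    have "ennreal (2 * pi * t) * ennreal (t ^ (2*n)) = ennreal (2 * pi * t ^ (2*n+1))" if "0 \<le> t"
      using that by (subst ennreal_mult'[symmetric]) (auto simp: mult_ac)
    then show "ennreal (2 * pi * t) * indicator {0..1} t * (ennreal (t ^ (2*n)) * W t) = ennreal (2 * pi * t ^ (2*n+1)) * W t"
      by (auto simp: W_def mult.assoc[symmetric] split: split_indicator)
  qed
  finally show ?thesis .
qed

text \<open>Insert the integral formula for \<open>\<omega>\<close> and exchange the order: the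
  inner integral in \<open>r\<close> is \<open>nn_integral_moment_kernel\<close>, and its two extra
  powers of \<open>t\<close> turn \<open>k\<close> into \<open>Suc k\<close>.\<close>

lemma moment_\<omega>:
  "(\<integral>\<^sup>+z\<in>ball (0::complex) 1. ennreal (cmod z ^ (2*k)) * V (cmod z) \<partial>lborel)
     = ennreal (1 / real ((2*k+2) * (2*k+3))) * moment (Suc k)"
proof -
  \<comment> \<open>The cut-off \<open>0 \<le> r \<le> t\<close> is built into the kernel so that it
    is jointly measurable and Fubini applies.\<close>
  define K where "K r t = (if 0 \<le> r \<and> r \<le> t then ennreal (r ^ (2*k+1) * (t - r)) else 0)" for r t :: real
  have [measurable]: "(\<lambda>(r, t). K r t) \<in> borel_measurable (borel \<Otimes>\<^sub>M borel)"
    unfolding K_def by measurable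
  have "(\<integral>\<^sup>+z\<in>ball (0::complex) 1. ennreal (cmod z ^ (2*k)) * V (cmod z) \<partial>lborel)
     = (\<integral>\<^sup>+r. ennreal (2 * pi * r) * indicator {0..1} r * (ennreal (r ^ (2*k)) * V r) \<partial>lborel)"
    by (rule nn_integral_disc_radial[where G = "\<lambda>r. ennreal (r ^ (2*k)) * V r"]) measurable
  also have "\<dots> = (\<integral>\<^sup>+r. \<integral>\<^sup>+t. ennreal (2*pi) * (K r t * W t) \<partial>lborel \<partial>lborel)"
  proof (rule nn_integral_cong)
    fix r :: real
    consider "r < 0" | "0 \<le> r" "r < 1" | "1 \<le> r" by linarith
    then show "ennreal (2 * pi * r) * indicator {0..1} r * (ennreal (r ^ (2*k)) * V r)
       = (\<integral>\<^sup>+t. ennreal (2*pi) * (K r t * W t) \<partial>lborel)"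
    proof cases
      case 2
      have "(\<integral>\<^sup>+t. ennreal (2*pi) * (K r t * W t) \<partial>lborel)
        = (\<integral>\<^sup>+t. ennreal (2*pi * r^(2*k+1)) * (ennreal ((t - r) * \<sigma> t) * indicator {r..<1} t) \<partial>lborel)"
        by (intro nn_integral_cong)
           (use 2 in \<open>auto simp: K_def W_def mult.assoc[symmetric] ennreal_mult'[symmetric] split: split_indicator\<close>)
      also have "\<dots> = ennreal (2*pi * r^(2*k+1)) * ennreal (\<omega> r)"
        using \<omega>_kernel_measurable[of r] 2 by (subst nn_integral_cmult) (auto simp: \<omega>_eq)
      finally have *: "(\<integral>\<^sup>+t. ennreal (2*pi) * (K r t * W t) \<partial>lborel) = ennreal (2*pi * r^(2*k+1)) * ennreal (\<omega> r)" .
      have "ennreal (2 * pi * r) * ennreal (r ^ (2*k)) = ennreal (2*pi * r^(2*k+1))"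
        using 2 by (subst ennreal_mult'[symmetric]) (auto simp: mult_ac)
      then show ?thesis using 2
        unfolding * by (simp add: V_def mult.assoc[symmetric])
    next
      case 3
      then have "K r t * W t = 0" for t by (auto simp: K_def W_def split: split_indicator)
      then have "ennreal (2*pi) * (K r t * W t) = 0" for t by simp
      then have "(\<integral>\<^sup>+t. ennreal (2*pi) * (K r t * W t) \<partial>lborel) = 0" by (simp only: nn_integral_const mult_zero_left)
      then show ?thesis using 3 by (simp add: V_def)
    qed (simp add: K_def)
  qed
  also have "\<dots> = (\<integral>\<^sup>+t. \<integral>\<^sup>+r. ennreal (2*pi) * (K r t * W t) \<partial>lborel \<partial>lborel)"
    by (rule lborel_pair.Fubini'[symmetric]) measurable
  also have "\<dots> = (\<integral>\<^sup>+t. ennreal (1 / real ((2*k+2) * (2*k+3))) * (ennreal (2 * pi * t ^ (2 * Suc k + 1)) * W t) \<partial>lborel)"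
  proof (rule nn_integral_cong)
    fix t :: real
    show "(\<integral>\<^sup>+r. ennreal (2*pi) * (K r t * W t) \<partial>lborel) = ennreal (1 / real ((2*k+2) * (2*k+3))) * (ennreal (2 * pi * t ^ (2 * Suc k + 1)) * W t)"
    proof (cases "0 \<le> t \<and> t < 1")
      case True
      have "(\<integral>\<^sup>+r. ennreal (2*pi) * (K r t * W t) \<partial>lborel) = (\<integral>\<^sup>+r. (ennreal (2*pi) * W t) * (ennreal (r ^ (2*k+1) * (t - r)) * indicator {0..t} r) \<partial>lborel)"
        by (intro nn_integral_cong) (auto simp: K_def mult_ac split: split_indicator)
      also have "\<dots> = (ennreal (2*pi) * W t) * ennreal (t ^ (2*k+3) / real ((2*k+2) * (2*k+3)))"
        using nn_integral_moment_kernel[of t k] True by (subst nn_integral_cmult) auto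
      also have "\<dots> = (ennreal (2*pi) * ennreal (t ^ (2*k+3) / real ((2*k+2) * (2*k+3)))) * W t"
        by (simp only: mult_ac)
      also have "ennreal (2*pi) * ennreal (t ^ (2*k+3) / real ((2*k+2) * (2*k+3))) = ennreal (1 / real ((2*k+2) * (2*k+3))) * ennreal (2 * pi * t ^ (2 * Suc k + 1))"
        by (subst (1 2) ennreal_mult'[symmetric]) (auto simp: eval_nat_numeral)
      finally show ?thesis by (simp only: mult_ac)
    next
      case False
      then have "W t = 0" by (auto simp: W_def)
      then show ?thesis by simp
    qed
  qed
  also have "\<dots> = ennreal (1 / real ((2*k+2) * (2*k+3))) * moment (Suc k)"
    unfolding moment_radial by (rule nn_integral_cmult) measurable
  finally show ?thesis .
qed

lemma N2_series:
  assumes f: "f holomorphic_on ball 0 1"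
  shows "N2 f = (\<Sum>n. ennreal ((cmod (taylor_coeff f n))\<^sup>2) * moment n)"
  unfolding N2_def moment_def by (rule nn_integral_disc_parseval[OF f W_measurable])

lemma D2_series:
  assumes f: "f holomorphic_on ball 0 1"
  shows "D2 (deriv f) = (\<Sum>k. ennreal ((real (Suc k))\<^sup>2 / real ((2*k+2) * (2*k+3))) * (ennreal ((cmod (taylor_coeff f (Suc k)))\<^sup>2) * moment (Suc k)))"
proof -
  have df: "deriv f holomorphic_on ball 0 1" using f by (rule holomorphic_deriv) auto
  have "D2 (deriv f) = (\<Sum>k. ennreal ((cmod (taylor_coeff (deriv f) k))\<^sup>2) * (ennreal (1 / real ((2*k+2) * (2*k+3))) * moment (Suc k)))"
    unfolding D2_def by (subst nn_integral_disc_parseval[OF df V_measurable]) (simp only: moment_\<omega>)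
  also have "\<dots> = (\<Sum>k. ennreal ((real (Suc k))\<^sup>2 / real ((2*k+2) * (2*k+3))) * (ennreal ((cmod (taylor_coeff f (Suc k)))\<^sup>2) * moment (Suc k)))"
  proof (rule suminf_cong)
    fix k
    have "ennreal ((cmod (taylor_coeff (deriv f) k))\<^sup>2) * ennreal (1 / real ((2*k+2) * (2*k+3))) = ennreal ((real (Suc k))\<^sup>2 / real ((2*k+2) * (2*k+3))) * ennreal ((cmod (taylor_coeff f (Suc k)))\<^sup>2)"
      unfolding taylor_coeff_deriv norm_mult norm_of_nat power_mult_distrib
      by (subst (1 2) ennreal_mult'[symmetric]) auto
    then show "ennreal ((cmod (taylor_coeff (deriv f) k))\<^sup>2) * (ennreal (1 / real ((2*k+2) * (2*k+3))) * moment (Suc k)) =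
        ennreal ((real (Suc k))\<^sup>2 / real ((2*k+2) * (2*k+3))) * (ennreal ((cmod (taylor_coeff f (Suc k)))\<^sup>2) * moment (Suc k))"
      by (simp only: mult.assoc[symmetric])
  qed
  finally show ?thesis .
qed

lemma N2_split:
  assumes f: "f holomorphic_on ball 0 1"
  shows "N2 f = ennreal ((cmod (f 0))\<^sup>2) * mass + (\<Sum>k. ennreal ((cmod (taylor_coeff f (Suc k)))\<^sup>2) * moment (Suc k))"
  unfolding N2_series[OF f] by (subst suminf_offset[where i = 1]) (auto simp: moment_0 add.commute)

text \<open>Coefficient by coefficient, the two sides have the ratio
  \<open>(k+1) / (2 * (2*k+3))\<close>, which is below 1.\<close>

lemma littlewood_paley_le:
  assumes f: "f holomorphic_on ball 0 1"
  shows "D2 (deriv f) \<le> N2 f"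
proof -
  have "D2 (deriv f) \<le> (\<Sum>k. ennreal ((cmod (taylor_coeff f (Suc k)))\<^sup>2) * moment (Suc k))"
    unfolding D2_series[OF f]
  proof (rule suminf_le)
    fix k :: nat
    have "(real (Suc k))\<^sup>2 \<le> (2*k+2) * (2*k+3)" by (simp add: power2_eq_square algebra_simps)
    moreover have "0 < real ((2 * k + 2) * (2*k+3))" by (simp only: of_nat_0_less_iff) simp
    ultimately have "(real (Suc k))\<^sup>2 / real ((2*k+2) * (2*k+3)) \<le> 1" by (simp only: divide_le_eq_1_pos)
    then have "ennreal ((real (Suc k))\<^sup>2 / real ((2*k+2) * (2*k+3))) \<le> 1"
      by (metis ennreal_1 ennreal_leI)
    then show "ennreal ((real (Suc k))\<^sup>2 / real ((2*k+2) * (2*k+3))) * (ennreal ((cmod (taylor_coeff f (Suc k)))\<^sup>2) * moment (Suc k)) \<le> ennreal ((cmod (taylor_coeff f (Suc k)))\<^sup>2) * moment (Suc k)"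
      using mult_right_mono[of _ 1 "ennreal ((cmod (taylor_coeff f (Suc k)))\<^sup>2) * moment (Suc k)"] by simp
  qed auto
  then show ?thesis unfolding N2_split[OF f] by (rule order_trans) simp
qed

text \<open>The coefficient ratio \<open>(k+1) / (2 * (2*k+3))\<close> is smallest at
  \<open>k = 0\<close>, where it is 1/6; hence the 6. The constant term, lost by differentiation, is
  restored separately.\<close>

lemma littlewood_paley_ge:
  assumes f: "f holomorphic_on ball 0 1"
  shows "N2 f \<le> ennreal ((cmod (f 0))\<^sup>2) * mass + 6 * D2 (deriv f)"
proof -
  have "(\<Sum>k. ennreal ((cmod (taylor_coeff f (Suc k)))\<^sup>2) * moment (Suc k)) \<le> 6 * D2 (deriv f)"
    unfolding D2_series[OF f] ennreal_suminf_cmult[symmetric]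
  proof (rule suminf_le)
    fix k :: nat
    let ?c = "(real (Suc k))\<^sup>2 / real ((2*k+2) * (2*k+3))"
    have "real ((2*k+2) * (2*k+3)) \<le> 6 * (real (Suc k))\<^sup>2" by (simp add: power2_eq_square algebra_simps)
    moreover have "0 < real ((2 * k + 2) * (2*k+3))" by (simp only: of_nat_0_less_iff) simp
    ultimately have "1 \<le> 6 * ?c" by (simp only: times_divide_eq_right le_divide_eq_1_pos)
    then have "1 \<le> ennreal (6 * ?c)" by (metis ennreal_1 ennreal_leI)
    then have "1 \<le> 6 * ennreal ?c" by (simp only: ennreal_mult'[OF zero_le_numeral] ennreal_numeral)
    then show "ennreal ((cmod (taylor_coeff f (Suc k)))\<^sup>2) * moment (Suc k) \<le> 6 * (ennreal ?c * (ennreal ((cmod (taylor_coeff f (Suc k)))\<^sup>2) * moment (Suc k)))"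
      using mult_right_mono[of 1 "6 * ennreal ?c" "ennreal ((cmod (taylor_coeff f (Suc k)))\<^sup>2) * moment (Suc k)"]
      by (simp only: mult_1_left mult.assoc zero_le)
  qed auto
  then show ?thesis unfolding N2_split[OF f] by (rule add_left_mono)
qed

text \<open>Restricting \<open>moment n\<close> to radii beyond \<open>\<rho>\<close>, halfway from
  \<open>|z|\<close> to 1, bounds it below by a multiple of
  \<open>\<omega> \<rho> / h * \<rho> ^ (2*n)\<close>. So the Bergman norm controls a coefficient
  sum of Hardy type at radius \<open>\<rho>\<close>. The doubling property then replaces
  \<open>\<omega> \<rho>\<close> by \<open>\<omega> |z|\<close> at the price of
  \<open>2 ^ m\<close>.\<close>

lemma point_bound:
  assumes f: "f \<in> A2 \<sigma>" and z: "cmod z < 1"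
  shows "\<omega> (cmod z) * (cmod (f z))\<^sup>2 \<le> 2 ^ m * (A2_norm \<sigma> f)\<^sup>2"
proof -
  define h where "h = 1 - cmod z"
  define \<rho> where "\<rho> = 1 - h / 2"
  have h: "0 < h" "h \<le> 1" using z by (auto simp: h_def)
  have \<rho>: "cmod z < \<rho>" "\<rho> < 1" "1/2 \<le> \<rho>" using h by (auto simp: \<rho>_def h_def field_simps)
  have hol: "f holomorphic_on ball 0 1" using f by (simp add: A2_def)
  define A where "A = h / (2 * \<omega> \<rho>) * (A2_norm \<sigma> f)\<^sup>2"
  have w\<rho>: "0 < \<omega> \<rho>" using \<rho> by (intro pos_\<omega>) auto
  have mom: "ennreal (2 * pi * \<omega> \<rho> / h * \<rho> ^ (2*n)) \<le> moment n" for n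
  proof -
    have "ennreal (2 * pi * \<omega> \<rho> / h * \<rho> ^ (2*n)) = ennreal (2 * pi / h * \<rho> ^ (2*n)) * ennreal (\<omega> \<rho>)"
      using h \<rho> by (subst ennreal_mult'[symmetric]) (auto simp: field_simps)
    also have "\<dots> = (\<integral>\<^sup>+t. ennreal (2 * pi / h * \<rho> ^ (2*n)) * (ennreal ((t - \<rho>) * \<sigma> t) * indicator {\<rho>..<1} t) \<partial>lborel)"
      using \<rho> \<omega>_kernel_measurable[of \<rho>] by (subst nn_integral_cmult) (auto simp: \<omega>_eq)
    also have "\<dots> \<le> moment n"
      unfolding moment_radial
    proof (rule nn_integral_mono)
      fix t :: real
      show "ennreal (2 * pi / h * \<rho> ^ (2*n)) * (ennreal ((t - \<rho>) * \<sigma> t) * indicator {\<rho>..<1} t) \<le> ennreal (2 * pi * t ^ (2*n+1)) * W t"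
      proof (cases "t \<in> {\<rho>..<1}")
        case True
        have "(2 * pi / h) * \<rho> ^ (2*n) * (t - \<rho>) \<le> (2 * pi / h) * t ^ (2*n) * (h/2)"
          using True \<rho> h by (intro mult_mono power_mono) (auto simp: \<rho>_def)
        also have "\<dots> = pi * t ^ (2*n)" using h by simp
        \<comment> \<open>This is \<open>2 * t \<ge> 1\<close>, from
          \<open>t \<ge> \<rho> \<ge> 1/2\<close>.\<close>
        also have "\<dots> \<le> 2 * pi * t ^ (2*n+1)"
        proof -
          have "pi * t ^ (2*n) * 1 \<le> pi * t ^ (2*n) * (2 * t)"
            using True \<rho> by (intro mult_left_mono) auto
          then show ?thesis by (simp add: mult_ac)
        qed
        finally have "(2 * pi / h) * \<rho> ^ (2*n) * (t - \<rho>) * \<sigma> t \<le> 2 * pi * t ^ (2*n+1) * \<sigma> t"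
          using pos_\<sigma>[of t] True \<rho> by (intro mult_right_mono) auto
        then show ?thesis using True \<rho> h
          by (simp add: W_def ennreal_mult'[symmetric] mult.assoc ennreal_leI)
      qed simp
    qed
    finally show ?thesis .
  qed
  have "(\<Sum>n. ennreal ((cmod (taylor_coeff f n))\<^sup>2 * \<rho> ^ (2*n))) \<le> ennreal (h / (2 * pi * \<omega> \<rho>)) * N2 f"
    unfolding N2_series[OF hol] ennreal_suminf_cmult[symmetric]
  proof (rule suminf_le)
    fix n
    have "ennreal ((cmod (taylor_coeff f n))\<^sup>2 * \<rho> ^ (2*n)) = ennreal (h / (2 * pi * \<omega> \<rho>)) * (ennreal ((cmod (taylor_coeff f n))\<^sup>2) * ennreal (2 * pi * \<omega> \<rho> / h * \<rho> ^ (2*n)))"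
      using h w\<rho> by (subst ennreal_mult'[symmetric], simp, subst ennreal_mult'[symmetric])
        (auto intro!: arg_cong[where f = ennreal] simp: field_simps)
    also have "\<dots> \<le> ennreal (h / (2 * pi * \<omega> \<rho>)) * (ennreal ((cmod (taylor_coeff f n))\<^sup>2) * moment n)"
      by (intro mult_left_mono mom) auto
    finally show "ennreal ((cmod (taylor_coeff f n))\<^sup>2 * \<rho> ^ (2*n)) \<le> ennreal (h / (2 * pi * \<omega> \<rho>)) * (ennreal ((cmod (taylor_coeff f n))\<^sup>2) * moment n)" .
  qed auto
  also have "\<dots> = ennreal A"
    unfolding N2_eq_norm[OF f] A_def using h w\<rho>
    by (subst ennreal_mult'[symmetric]) (auto intro!: arg_cong[where f = ennreal] simp: field_simps)
  finally have "(cmod (f z))\<^sup>2 \<le> A / (1 - (cmod z / \<rho>)\<^sup>2)"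
    using h w\<rho> \<rho> by (intro cmod_square_le_coeff[OF hol]) (auto simp: A_def)
  also have "\<dots> \<le> A / (h / 2)"
  proof (rule divide_left_mono)
    \<comment> \<open>As \<open>1 - h / 2\<close> is \<open>\<rho>\<close>, the claim is
      \<open>|z| \<le> \<rho>^2\<close>, the inequality of arithmetic and geometric means for 1 and
      \<open>|z|\<close>.\<close>
    have q: "cmod z / \<rho> \<le> 1 - h / 2"
    proof -
      have "cmod z \<le> (1 - h/2) * \<rho>" using sum_squares_bound[of 1 "cmod z"]
        by (simp add: h_def \<rho>_def algebra_simps power2_eq_square)
      then show ?thesis using \<rho> by (simp add: divide_le_eq)
    qed
    have "(cmod z / \<rho>)\<^sup>2 \<le> cmod z / \<rho>"
      using power_decreasing[of 1 2 "cmod z / \<rho>"] \<rho> by simp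
    then show "h / 2 \<le> 1 - (cmod z / \<rho>)\<^sup>2" using q by linarith
    then show "0 < (1 - (cmod z / \<rho>)\<^sup>2) * (h / 2)" using h by (intro mult_pos_pos) auto
    show "0 \<le> A" using h w\<rho> by (auto simp: A_def)
  qed
  also have "\<dots> = (A2_norm \<sigma> f)\<^sup>2 / \<omega> \<rho>" using h by (simp add: A_def)
  finally have "\<omega> \<rho> * (cmod (f z))\<^sup>2 \<le> (A2_norm \<sigma> f)\<^sup>2" using w\<rho> by (simp add: field_simps)
  moreover have "\<omega> (cmod z) \<le> 2 ^ m * \<omega> \<rho>"
  proof -
    have "\<omega> (cmod z) * (h/2) ^ m \<le> \<omega> \<rho> * h ^ m"
      using doubling[of "cmod z" \<rho>] \<rho> by (simp add: h_def \<rho>_def)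
    then show ?thesis using h by (simp add: power_divide field_simps)
  qed
  then have "\<omega> (cmod z) * (cmod (f z))\<^sup>2 \<le> 2 ^ m * (\<omega> \<rho> * (cmod (f z))\<^sup>2)"
    by (simp add: mult.assoc[symmetric] mult_right_mono)
  ultimately show ?thesis
    by (meson mult_left_mono order_trans zero_le_numeral zero_le_power)
qed

end

section \<open>Carleson embedding\<close>

lemma self_map_cmod_less:
  fixes \<phi> :: "complex \<Rightarrow> complex"
  shows "\<phi> ` ball 0 1 \<subseteq> ball 0 1 \<Longrightarrow> cmod z < 1 \<Longrightarrow> cmod (\<phi> z) < 1"
  by (metis image_subset_iff mem_ball_0)

text \<open>In the submean inequality on a disc about \<open>w\<close>, centre and variable exchange
  roles: for \<open>v\<close> in that disc, \<open>w\<close> lies in the window at \<open>v\<close>,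
  and the area factor can be expressed by \<open>1 - |v|\<close>.\<close>

lemma cmod_square_le_window:
  fixes g :: "complex \<Rightarrow> complex"
  assumes g: "g holomorphic_on ball 0 1" and w: "cmod w < 1"
  shows "ennreal ((cmod (g w))\<^sup>2) \<le> (\<integral>\<^sup>+v\<in>ball 0 1. ennreal ((cmod (g v))\<^sup>2) * (ennreal (25 / (1 - cmod v)\<^sup>2) * indicator (ball v ((1 - cmod v) / 2)) w) \<partial>lborel)"
proof -
  \<comment> \<open>With this radius \<open>1 - |v|\<close> lies between \<open>3 * s\<close> and
    \<open>5 * s\<close> on the disc; the lower bound puts \<open>w\<close> into the window at
    \<open>v\<close>, the upper one yields 25.\<close>
  define s where "s = (1 - cmod w) / 4"
  have s: "0 < s" using w by (simp add: s_def)
  have v: "cmod v < 1" "w \<in> ball v ((1 - cmod v) / 2)" "(1 - cmod v)\<^sup>2 \<le> 25 * s\<^sup>2" "1 - cmod v > 0"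
    if "v \<in> ball w s" for v
  proof -
    have d: "cmod (w - v) < s" using that by (simp add: dist_norm)
    have 1: "cmod v \<le> cmod w + cmod (w - v)" "cmod w \<le> cmod v + cmod (w - v)"
      using norm_triangle_ineq4[of w "w - v"] norm_triangle_ineq[of v "w - v"] by auto
    then show "cmod v < 1" using d s by (simp add: s_def)
    then show "1 - cmod v > 0" by simp
    show "w \<in> ball v ((1 - cmod v) / 2)"
      using d 1 by (simp add: dist_norm norm_minus_commute s_def)
    have "1 - cmod v \<le> 5 * s" using d 1 by (simp add: s_def)
    then have "(1 - cmod v)\<^sup>2 \<le> (5 * s)\<^sup>2" using \<open>cmod v < 1\<close> by (intro power_mono) auto
    then show "(1 - cmod v)\<^sup>2 \<le> 25 * s\<^sup>2" by (simp add: power_mult_distrib)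
  qed
  have sub: "ball w s \<subseteq> ball 0 1" using v by (auto simp: dist_norm)
  have "ennreal ((cmod (g w))\<^sup>2) \<le> ennreal (1 / s\<^sup>2) * ennreal (pi * s\<^sup>2 * (cmod (g w))\<^sup>2)"
  proof -
    have "(cmod (g w))\<^sup>2 * 1 \<le> (cmod (g w))\<^sup>2 * pi" using pi_ge_two by (intro mult_left_mono) auto
    then show ?thesis using s by (subst ennreal_mult'[symmetric]) (auto simp: mult_ac intro!: ennreal_leI)
  qed
  also have "\<dots> \<le> ennreal (1 / s\<^sup>2) * (\<integral>\<^sup>+v\<in>ball w s. ennreal ((cmod (g v))\<^sup>2) \<partial>lborel)"
    by (intro mult_left_mono nn_integral_submean s holomorphic_on_subset[OF g sub]) auto
  also have "\<dots> = (\<integral>\<^sup>+v. ennreal (1 / s\<^sup>2) * (ennreal ((cmod (g v))\<^sup>2) * indicator (ball w s) v) \<partial>lborel)"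
    using borel_measurable_cmod_square_indicator[OF holomorphic_on_subset[OF g sub]]
    by (subst nn_integral_cmult) auto
  also have "\<dots> \<le> (\<integral>\<^sup>+v\<in>ball 0 1. ennreal ((cmod (g v))\<^sup>2) * (ennreal (25 / (1 - cmod v)\<^sup>2) * indicator (ball v ((1 - cmod v) / 2)) w) \<partial>lborel)"
  proof (rule nn_integral_mono)
    fix v :: complex
    show "ennreal (1 / s\<^sup>2) * (ennreal ((cmod (g v))\<^sup>2) * indicator (ball w s) v) \<le> ennreal ((cmod (g v))\<^sup>2) * (ennreal (25 / (1 - cmod v)\<^sup>2) * indicator (ball v ((1 - cmod v) / 2)) w) * indicator (ball 0 1) v"
    proof (cases "v \<in> ball w s")
      case True
      have "1 / s\<^sup>2 \<le> 25 / (1 - cmod v)\<^sup>2"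
        using v(3,4)[OF True] s by (simp add: field_simps)
      then have "ennreal (1 / s\<^sup>2) \<le> ennreal (25 / (1 - cmod v)\<^sup>2)" by (rule ennreal_leI)
      then have "ennreal (1 / s\<^sup>2) * ennreal ((cmod (g v))\<^sup>2) \<le> ennreal (25 / (1 - cmod v)\<^sup>2) * ennreal ((cmod (g v))\<^sup>2)"
        by (rule mult_right_mono) auto
      then show ?thesis using True v(1,2)[OF True] by (simp only: indicator_simps mult_1_right mult.commute) (simp add: mult.commute)
    qed simp
  qed
  finally show ?thesis .
qed

text \<open>Integrate the window estimate at the points \<open>\<phi> z\<close> and apply Fubini;
  the multiplicity of \<open>\<phi>\<close> is absorbed by the measure of the preimage of the
  window.\<close>

lemma carleson_embedding:
  fixes g \<phi> :: "complex \<Rightarrow> complex" and p :: "complex \<Rightarrow> ennreal"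
  assumes g: "g holomorphic_on ball 0 1" and \<phi>: "\<phi> holomorphic_on ball 0 1" "\<phi> ` ball 0 1 \<subseteq> ball 0 1"
    and p [measurable]: "(\<lambda>z. p z * indicator (ball 0 1) z) \<in> borel_measurable borel"
  shows "(\<integral>\<^sup>+z\<in>ball 0 1. ennreal ((cmod (g (\<phi> z)))\<^sup>2) * p z \<partial>lborel)
    \<le> (\<integral>\<^sup>+u\<in>ball 0 1. ennreal ((cmod (g u))\<^sup>2) * (ennreal (25 / (1 - cmod u)\<^sup>2) *
         (\<integral>\<^sup>+z\<in>ball 0 1. p z * indicator (ball u ((1 - cmod u) / 2)) (\<phi> z) \<partial>lborel)) \<partial>lborel)"
proof -
  \<comment> \<open>Extension by zero makes the map Borel on the whole plane.\<close>
  define \<phi>0 where "\<phi>0 z = (if z \<in> ball 0 1 then \<phi> z else 0)" for z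
  have [measurable]: "\<phi>0 \<in> borel_measurable borel"
    unfolding \<phi>0_def[abs_def]
    by (rule borel_measurable_continuous_on_if) (auto intro: holomorphic_on_imp_continuous_on \<phi>)
  define q where "q z = p z * indicator (ball 0 1) z" for z
  define G where "G u = ennreal ((cmod (g u))\<^sup>2) * indicator (ball 0 1) u" for u
  have [measurable]: "q \<in> borel_measurable borel" using p by (simp add: q_def[abs_def])
  have [measurable]: "G \<in> borel_measurable borel"
    unfolding G_def[abs_def] using g by (rule borel_measurable_cmod_square_indicator) auto
  \<comment> \<open>Written as an inequality, the indicator of the moving ball is jointly measurable
    in \<open>u\<close> and \<open>w\<close>.\<close>
  define I :: "complex \<Rightarrow> complex \<Rightarrow> ennreal" where "I u w = (if cmod (u - w) < (1 - cmod u) / 2 then 1 else 0)" for u w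
  have [measurable]: "(\<lambda>(u, w). I u w) \<in> borel_measurable (borel \<Otimes>\<^sub>M borel)"
    unfolding I_def by measurable
  have I: "indicator (ball u ((1 - cmod u) / 2)) w = I u w" for u w
    by (simp add: I_def indicator_def dist_norm)
  have "(\<integral>\<^sup>+z\<in>ball 0 1. ennreal ((cmod (g (\<phi> z)))\<^sup>2) * p z \<partial>lborel)
     \<le> (\<integral>\<^sup>+z. (\<integral>\<^sup>+u. G u * (ennreal (25 / (1 - cmod u)\<^sup>2) * I u (\<phi>0 z)) \<partial>lborel) * q z \<partial>lborel)"
  proof (rule nn_integral_mono)
    fix z :: complex
    show "ennreal ((cmod (g (\<phi> z)))\<^sup>2) * p z * indicator (ball 0 1) z \<le> (\<integral>\<^sup>+u. G u * (ennreal (25 / (1 - cmod u)\<^sup>2) * I u (\<phi>0 z)) \<partial>lborel) * q z"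
    proof (cases "z \<in> ball 0 1")
      case True
      then have w: "cmod (\<phi> z) < 1" using self_map_cmod_less[OF \<phi>(2)] by simp
      have "ennreal ((cmod (g (\<phi> z)))\<^sup>2) \<le> (\<integral>\<^sup>+u. G u * (ennreal (25 / (1 - cmod u)\<^sup>2) * I u (\<phi> z)) \<partial>lborel)"
        using cmod_square_le_window[OF g w] by (simp add: I G_def mult_ac)
      then show ?thesis using True by (auto simp: q_def \<phi>0_def intro!: mult_right_mono)
    qed simp
  qed
  also have "\<dots> = (\<integral>\<^sup>+z. \<integral>\<^sup>+u. G u * (ennreal (25 / (1 - cmod u)\<^sup>2) * I u (\<phi>0 z)) * q z \<partial>lborel \<partial>lborel)"
    by (intro nn_integral_cong nn_integral_multc[symmetric]) measurable
  also have "\<dots> = (\<integral>\<^sup>+u. \<integral>\<^sup>+z. G u * (ennreal (25 / (1 - cmod u)\<^sup>2) * I u (\<phi>0 z)) * q z \<partial>lborel \<partial>lborel)"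
    by (rule lborel_pair.Fubini'[symmetric]) measurable
  also have "\<dots> = (\<integral>\<^sup>+u. G u * (ennreal (25 / (1 - cmod u)\<^sup>2) * (\<integral>\<^sup>+z. q z * I u (\<phi>0 z) \<partial>lborel)) \<partial>lborel)"
  proof (rule nn_integral_cong)
    fix u :: complex
    have "(\<integral>\<^sup>+z. G u * (ennreal (25 / (1 - cmod u)\<^sup>2) * I u (\<phi>0 z)) * q z \<partial>lborel) = (\<integral>\<^sup>+z. (G u * ennreal (25 / (1 - cmod u)\<^sup>2)) * (q z * I u (\<phi>0 z)) \<partial>lborel)"
      by (simp only: mult_ac)
    also have "\<dots> = (G u * ennreal (25 / (1 - cmod u)\<^sup>2)) * (\<integral>\<^sup>+z. q z * I u (\<phi>0 z) \<partial>lborel)"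
      by (rule nn_integral_cmult) measurable
    finally show "(\<integral>\<^sup>+z. G u * (ennreal (25 / (1 - cmod u)\<^sup>2) * I u (\<phi>0 z)) * q z \<partial>lborel) = G u * (ennreal (25 / (1 - cmod u)\<^sup>2) * (\<integral>\<^sup>+z. q z * I u (\<phi>0 z) \<partial>lborel))"
      by (simp only: mult.assoc)
  qed
  also have "\<dots> = (\<integral>\<^sup>+u\<in>ball 0 1. ennreal ((cmod (g u))\<^sup>2) * (ennreal (25 / (1 - cmod u)\<^sup>2) *
         (\<integral>\<^sup>+z\<in>ball 0 1. p z * indicator (ball u ((1 - cmod u) / 2)) (\<phi> z) \<partial>lborel)) \<partial>lborel)"
  proof (rule nn_integral_cong)
    fix u :: complex
    have "q z * I u (\<phi>0 z) = p z * indicator (ball u ((1 - cmod u) / 2)) (\<phi> z) * indicator (ball 0 1) z" for z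
      by (cases "z \<in> ball 0 1") (simp_all add: q_def \<phi>0_def I)
    then show "G u * (ennreal (25 / (1 - cmod u)\<^sup>2) * (\<integral>\<^sup>+z. q z * I u (\<phi>0 z) \<partial>lborel)) =
       ennreal ((cmod (g u))\<^sup>2) * (ennreal (25 / (1 - cmod u)\<^sup>2) *
         (\<integral>\<^sup>+z\<in>ball 0 1. p z * indicator (ball u ((1 - cmod u) / 2)) (\<phi> z) \<partial>lborel)) * indicator (ball 0 1) u"
      by (simp only: G_def mult_ac)
  qed
  finally show ?thesis .
qed

text \<open>Cauchy's estimate on the disc of radius \<open>(1 - \<rho>) / 2\<close> about
  \<open>u\<close>, which stays inside the disc of radius \<open>(1 + \<rho>) / 2\<close> about
  0.\<close>

lemma cauchy_deriv_bound:
  assumes f: "f holomorphic_on ball 0 1" and \<rho>: "\<rho> < 1" and u: "cmod u \<le> \<rho>"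
    and B: "\<And>v. cmod v \<le> (1 + \<rho>) / 2 \<Longrightarrow> cmod (f v) \<le> B"
  shows "cmod (deriv f u) \<le> B / ((1 - \<rho>) / 2)"
proof -
  let ?r = "(1 - \<rho>) / 2"
  have le: "cmod v \<le> (1 + \<rho>) / 2" if "v \<in> cball u ?r" for v
  proof -
    have "cmod v \<le> cmod u + cmod (v - u)" using norm_triangle_ineq[of u "v - u"] by simp
    then show ?thesis using that u by (simp add: dist_norm norm_minus_commute field_simps)
  qed
  have sub: "cball u ?r \<subseteq> ball 0 1" using le \<rho> by fastforce
  have "cmod ((deriv ^^ 1) f u) \<le> fact 1 * B / ?r ^ 1"
  proof (rule Cauchy_inequality)
    show "f holomorphic_on ball u ?r" using f sub ball_subset_cball by (metis holomorphic_on_subset order_trans)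
    show "continuous_on (cball u ?r) f" using f sub by (metis holomorphic_on_imp_continuous_on holomorphic_on_subset)
    show "0 < ?r" using \<rho> by simp
    fix x assume "cmod (u - x) = ?r"
    then show "cmod (f x) \<le> B" by (intro B le) (simp add: dist_norm)
  qed
  then show ?thesis by simp
qed

section \<open>Compactness from vanishing window masses\<close>

context weight
begin

definition window :: "(complex \<Rightarrow> complex) \<Rightarrow> complex \<Rightarrow> ennreal" where
  "window \<phi> u = (\<integral>\<^sup>+z\<in>ball 0 1. (ennreal ((cmod (deriv \<phi> z))\<^sup>2) * V (cmod z)) * indicator (ball u ((1 - cmod u) / 2)) (\<phi> z) \<partial>lborel)"

text \<open>Dropping the indicator leaves the weighted Dirichlet integral of \<open>\<phi>\<close>
  itself, and \<open>\<phi>\<close> is bounded by 1.\<close>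

lemma window_le_mass:
  assumes \<phi>: "\<phi> holomorphic_on ball 0 1" "\<phi> ` ball 0 1 \<subseteq> ball 0 1"
  shows "window \<phi> u \<le> mass"
proof -
  have "window \<phi> u \<le> D2 (deriv \<phi>)"
    unfolding window_def D2_def by (intro nn_integral_mono) (auto split: split_indicator)
  also have "\<dots> \<le> N2 \<phi>" by (rule littlewood_paley_le[OF \<phi>(1)])
  also have "\<dots> \<le> ennreal (1\<^sup>2) * mass"
  proof (rule N2_bounded)
    fix z :: complex assume "cmod z < 1"
    then show "cmod (\<phi> z) \<le> 1" using self_map_cmod_less[OF \<phi>(2)] by (simp add: less_imp_le)
  qed
  finally show ?thesis by simp
qed

text \<open>The Carleson integral is split at \<open>|u| = \<rho>\<close>: outside, the small
  windows give \<open>\<epsilon> * N2 f\<close>; inside, the squared derivative is at most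
  \<open>B\<close> and each window at most \<open>mass\<close>. That \<open>\<rho>\<close> and
  \<open>K\<close> do not depend on \<open>f\<close> is what turns locally uniform smallness into
  smallness in norm.\<close>

lemma N2_compose_le:
  assumes \<phi>: "\<phi> holomorphic_on ball 0 1" "\<phi> ` ball 0 1 \<subseteq> ball 0 1"
    and van: "\<forall>\<epsilon>>0. \<exists>\<rho><1. \<forall>u. \<rho> < cmod u \<longrightarrow> cmod u < 1 \<longrightarrow> window \<phi> u \<le> ennreal (\<epsilon> * ((1 - cmod u)\<^sup>2 * \<omega> (cmod u)))"
    and \<epsilon>: "0 < \<epsilon>"
  shows "\<exists>\<rho> K. 0 \<le> \<rho> \<and> \<rho> < 1 \<and> 0 \<le> K \<and> (\<forall>f B. f holomorphic_on ball 0 1 \<longrightarrow> (\<forall>u. cmod u \<le> \<rho> \<longrightarrow> (cmod (deriv f u))\<^sup>2 \<le> B) \<longrightarrow> 0 \<le> B \<longrightarrow>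
     N2 (f \<circ> \<phi>) \<le> ennreal ((cmod (f (\<phi> 0)))\<^sup>2) * mass + ennreal \<epsilon> * N2 f + ennreal (K * B))"
proof -
  \<comment> \<open>150 is \<open>25 * 6\<close>: 25 from the Carleson embedding, 6 from
    \<open>littlewood_paley_ge\<close>.\<close>
  have "0 < \<epsilon> / 150" using \<epsilon> by simp
  then obtain \<rho>' where \<rho>': "\<rho>' < 1" "\<And>u. \<rho>' < cmod u \<Longrightarrow> cmod u < 1 \<Longrightarrow> window \<phi> u \<le> ennreal (\<epsilon> / 150 * ((1 - cmod u)\<^sup>2 * \<omega> (cmod u)))"
    using van by blast
  define \<rho> where "\<rho> = max 0 \<rho>'"
  have \<rho>: "0 \<le> \<rho>" "\<rho> < 1" using \<rho>' by (auto simp: \<rho>_def)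
  have near: "window \<phi> u \<le> ennreal (\<epsilon> / 150 * ((1 - cmod u)\<^sup>2 * \<omega> (cmod u)))" if "\<rho> < cmod u" "cmod u < 1" for u
    using \<rho>'(2)[of u] that by (simp add: \<rho>_def)
  define M where "M = enn2real mass"
  have M: "mass = ennreal M" "0 \<le> M" using mass_finite by (auto simp: M_def)
  \<comment> \<open>\<open>K'\<close> bounds the window factor for \<open>|u| \<le> \<rho>\<close>;
    in \<open>K\<close>, the \<open>pi\<close> is the area of the disc and the 6 comes from
    \<open>littlewood_paley_ge\<close>.\<close>
  define K' where "K' = 25 / (1 - \<rho>)\<^sup>2 * M"
  define K where "K = 6 * (K' * pi)"
  have K': "0 \<le> K'" using M by (simp add: K'_def)
  have "N2 (f \<circ> \<phi>) \<le> ennreal ((cmod (f (\<phi> 0)))\<^sup>2) * mass + ennreal \<epsilon> * N2 f + ennreal (K * B)"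
    if f: "f holomorphic_on ball 0 1" and B: "\<And>u. cmod u \<le> \<rho> \<Longrightarrow> (cmod (deriv f u))\<^sup>2 \<le> B" "0 \<le> B" for f B
  proof -
    have df: "deriv f holomorphic_on ball 0 1" using f by (rule holomorphic_deriv) auto
    have d\<phi>: "deriv \<phi> holomorphic_on ball 0 1" using \<phi>(1) by (rule holomorphic_deriv) auto
    have hol: "f \<circ> \<phi> holomorphic_on ball 0 1" by (rule holomorphic_on_compose_gen[OF \<phi>(1) f \<phi>(2)])
    have chain: "deriv (f \<circ> \<phi>) z = deriv f (\<phi> z) * deriv \<phi> z" if "z \<in> ball 0 1" for z
    proof (rule deriv_chain)
      show "\<phi> field_differentiable at z" using \<phi>(1) that by (auto simp: holomorphic_on_open field_differentiable_def)
      have "\<phi> z \<in> ball 0 1" using \<phi>(2) that by blast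
      then show "f field_differentiable at (\<phi> z)" using f by (auto simp: holomorphic_on_open field_differentiable_def)
    qed
    have pm: "(\<lambda>z. (ennreal ((cmod (deriv \<phi> z))\<^sup>2) * V (cmod z)) * indicator (ball 0 1) z) \<in> borel_measurable borel"
      by (rule N2_integrand_measurable(2)[OF d\<phi>])
    have "D2 (deriv (f \<circ> \<phi>)) = (\<integral>\<^sup>+z\<in>ball 0 1. ennreal ((cmod (deriv f (\<phi> z)))\<^sup>2) * (ennreal ((cmod (deriv \<phi> z))\<^sup>2) * V (cmod z)) \<partial>lborel)"
      unfolding D2_def
    proof (rule nn_integral_cong)
      fix z :: complex
      show "ennreal ((cmod (deriv (f \<circ> \<phi>) z))\<^sup>2) * V (cmod z) * indicator (ball 0 1) z = ennreal ((cmod (deriv f (\<phi> z)))\<^sup>2) * (ennreal ((cmod (deriv \<phi> z))\<^sup>2) * V (cmod z)) * indicator (ball 0 1) z"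
        by (cases "z \<in> ball 0 1") (simp_all add: chain norm_mult power_mult_distrib ennreal_mult' mult.assoc)
    qed
    also have "\<dots> \<le> (\<integral>\<^sup>+u\<in>ball 0 1. ennreal ((cmod (deriv f u))\<^sup>2) * (ennreal (25 / (1 - cmod u)\<^sup>2) * window \<phi> u) \<partial>lborel)"
      using carleson_embedding[OF df \<phi> pm] unfolding window_def .
    also have "\<dots> \<le> (\<integral>\<^sup>+u. ennreal (\<epsilon> / 6) * (ennreal ((cmod (deriv f u))\<^sup>2) * V (cmod u) * indicator (ball 0 1) u) + ennreal (K' * B) * indicator (ball 0 1) u \<partial>lborel)"
    proof (rule nn_integral_mono)
      fix u :: complex
      show "ennreal ((cmod (deriv f u))\<^sup>2) * (ennreal (25 / (1 - cmod u)\<^sup>2) * window \<phi> u) * indicator (ball 0 1) u \<le> ennreal (\<epsilon> / 6) * (ennreal ((cmod (deriv f u))\<^sup>2) * V (cmod u) * indicator (ball 0 1) u) + ennreal (K' * B) * indicator (ball 0 1) u"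
      proof (cases "u \<in> ball 0 1")
        case True
        then have u: "cmod u < 1" by simp
        show ?thesis
        proof (cases "\<rho> < cmod u")
          case r: True
          have "ennreal (25 / (1 - cmod u)\<^sup>2) * window \<phi> u \<le> ennreal (25 / (1 - cmod u)\<^sup>2) * ennreal (\<epsilon> / 150 * ((1 - cmod u)\<^sup>2 * \<omega> (cmod u)))"
            by (intro mult_left_mono near r u) auto
          also have "\<dots> = ennreal (\<epsilon> / 6) * V (cmod u)"
            using u \<epsilon> by (simp add: V_def ennreal_mult'[symmetric])
          finally have "ennreal ((cmod (deriv f u))\<^sup>2) * (ennreal (25 / (1 - cmod u)\<^sup>2) * window \<phi> u) \<le> ennreal ((cmod (deriv f u))\<^sup>2) * (ennreal (\<epsilon> / 6) * V (cmod u))"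
            by (rule mult_left_mono) auto
          then have "ennreal ((cmod (deriv f u))\<^sup>2) * (ennreal (25 / (1 - cmod u)\<^sup>2) * window \<phi> u) \<le> ennreal (\<epsilon> / 6) * (ennreal ((cmod (deriv f u))\<^sup>2) * V (cmod u))"
            by (simp only: mult.left_commute)
          then show ?thesis using True by (simp add: add_increasing2)
        next
          case r: False
          have "25 / (1 - cmod u)\<^sup>2 \<le> 25 / (1 - \<rho>)\<^sup>2"
            using r \<rho> by (intro divide_left_mono power_mono mult_pos_pos) auto
          then have "ennreal ((cmod (deriv f u))\<^sup>2) * (ennreal (25 / (1 - cmod u)\<^sup>2) * window \<phi> u) \<le> ennreal B * (ennreal (25 / (1 - \<rho>)\<^sup>2) * mass)"
            by (intro mult_mono ennreal_leI B window_le_mass \<phi>) (use r in auto)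
          also have "\<dots> = ennreal (K' * B)"
            using B M by (simp add: K'_def ennreal_mult'[symmetric] mult_ac)
          finally show ?thesis using True by (simp add: add_increasing)
        qed
      qed simp
    qed
    also have "\<dots> = ennreal (\<epsilon> / 6) * D2 (deriv f) + ennreal (K' * B) * emeasure lborel (ball (0::complex) 1)"
      unfolding D2_def using N2_integrand_measurable(2)[OF df]
      by (subst nn_integral_add) (auto simp: nn_integral_cmult)
    also have "\<dots> \<le> ennreal (\<epsilon> / 6) * N2 f + ennreal (K' * B * pi)"
      using B K' by (intro add_mono mult_left_mono littlewood_paley_le f)
        (auto simp: emeasure_ball eval_unit_ball_vol ennreal_mult'[symmetric])
    finally have "6 * D2 (deriv (f \<circ> \<phi>)) \<le> 6 * (ennreal (\<epsilon> / 6) * N2 f + ennreal (K' * B * pi))"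
      by (rule mult_left_mono) auto
    also have "\<dots> = (ennreal 6 * ennreal (\<epsilon> / 6)) * N2 f + ennreal 6 * ennreal (K' * B * pi)"
      by (simp add: distrib_left mult.assoc)
    also have "ennreal 6 * ennreal (\<epsilon> / 6) = ennreal \<epsilon>" using \<epsilon> by (subst ennreal_mult'[symmetric]) auto
    also have "ennreal 6 * ennreal (K' * B * pi) = ennreal (K * B)"
      by (subst ennreal_mult'[symmetric]) (auto simp: K_def mult_ac)
    finally have "6 * D2 (deriv (f \<circ> \<phi>)) \<le> ennreal \<epsilon> * N2 f + ennreal (K * B)" .
    then have "ennreal ((cmod ((f \<circ> \<phi>) 0))\<^sup>2) * mass + 6 * D2 (deriv (f \<circ> \<phi>)) \<le> ennreal ((cmod (f (\<phi> 0)))\<^sup>2) * mass + (ennreal \<epsilon> * N2 f + ennreal (K * B))"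
      by (intro add_mono) auto
    with littlewood_paley_ge[OF hol] show ?thesis by (auto intro: order_trans simp: add.assoc)
  qed
  moreover have "0 \<le> K" using K' by (simp add: K_def)
  ultimately show ?thesis using \<rho> by blast
qed

text \<open>Fatou's lemma; it puts the locally uniform limit of a bounded sequence back into the
  space.\<close>

lemma N2_pointwise_limit_le:
  assumes f: "\<And>n. f n holomorphic_on ball 0 1" and g: "g holomorphic_on ball 0 1"
    and lim: "\<And>z. cmod z < 1 \<Longrightarrow> (\<lambda>n. f n z) \<longlonglongrightarrow> g z"
    and B: "\<And>n. N2 (f n) \<le> B"
  shows "N2 g \<le> B"
proof -
  have "N2 g = (\<integral>\<^sup>+z. liminf (\<lambda>n. ennreal ((cmod (f n z))\<^sup>2) * W (cmod z) * indicator (ball 0 1) z) \<partial>lborel)"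
    unfolding N2_def
  proof (rule nn_integral_cong)
    fix z :: complex
    show "ennreal ((cmod (g z))\<^sup>2) * W (cmod z) * indicator (ball 0 1) z = liminf (\<lambda>n. ennreal ((cmod (f n z))\<^sup>2) * W (cmod z) * indicator (ball 0 1) z)"
    proof (cases "z \<in> ball 0 1")
      case True
      have "(\<lambda>n. ennreal ((cmod (f n z))\<^sup>2 * \<sigma> (cmod z))) \<longlonglongrightarrow> ennreal ((cmod (g z))\<^sup>2 * \<sigma> (cmod z))"
        by (intro tendsto_ennrealI tendsto_intros lim) (use True in simp)
      then show ?thesis using True
        by (intro lim_imp_Liminf[symmetric]) (auto simp: W_def ennreal_mult')
    qed (simp add: Liminf_const)
  qed
  also have "\<dots> \<le> liminf (\<lambda>n. N2 (f n))"
    unfolding N2_def by (rule nn_integral_liminf) (use N2_integrand_measurable(1)[OF f] in simp)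
  also have "\<dots> \<le> limsup (\<lambda>n. N2 (f n))" by (rule Liminf_le_Limsup) simp
  also have "\<dots> \<le> B" by (rule Limsup_bounded) (simp add: B)
  finally show ?thesis .
qed

text \<open>Point evaluations make a bounded sequence locally bounded, so Montel's theorem gives a
  locally uniform limit \<open>g\<close> along a subsequence. The differences from \<open>g\<close>
  are bounded in norm and tend to 0 locally uniformly together with their derivatives, so
  \<open>N2_compose_le\<close> makes their images small.\<close>

lemma compact_operator_if_window_vanishing:
  assumes \<phi>: "\<phi> holomorphic_on ball 0 1" "\<phi> ` ball 0 1 \<subseteq> ball 0 1"
    and van: "\<forall>\<epsilon>>0. \<exists>\<rho><1. \<forall>u. \<rho> < cmod u \<longrightarrow> cmod u < 1 \<longrightarrow> window \<phi> u \<le> ennreal (\<epsilon> * ((1 - cmod u)\<^sup>2 * \<omega> (cmod u)))"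
  shows "compact_operator (A2 \<sigma>) (A2_norm \<sigma>) (comp_op \<phi>)"
proof -
  note est = N2_compose_le[OF \<phi> van]
  define M where "M = enn2real mass"
  have M: "mass = ennreal M" "0 \<le> M" using mass_finite by (auto simp: M_def)
  have maps: "comp_op \<phi> f \<in> A2 \<sigma>" if f: "f \<in> A2 \<sigma>" for f
  proof -
    have hol: "f holomorphic_on ball 0 1" and fin: "N2 f < \<infinity>" using f by (auto simp: A2_iff)
    \<comment> \<open>Any positive value of \<open>\<epsilon>\<close> would do here; 1 already shows
      that the operator maps the space into itself.\<close>
    obtain \<rho> K where \<rho>: "0 \<le> \<rho>" "\<rho> < 1" and K: "\<And>f B. f holomorphic_on ball 0 1 \<Longrightarrow> (\<And>u. cmod u \<le> \<rho> \<Longrightarrow> (cmod (deriv f u))\<^sup>2 \<le> B) \<Longrightarrow> 0 \<le> B \<Longrightarrow>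
      N2 (f \<circ> \<phi>) \<le> ennreal ((cmod (f (\<phi> 0)))\<^sup>2) * mass + ennreal 1 * N2 f + ennreal (K * B)"
      using est[of 1] by (metis zero_less_one)
    have "compact (deriv f ` cball 0 \<rho>)"
      by (intro compact_continuous_image continuous_on_subset[OF holomorphic_on_imp_continuous_on[OF holomorphic_deriv[OF hol]]])
         (use \<rho> in auto)
    then obtain b where b: "\<And>u. cmod u \<le> \<rho> \<Longrightarrow> cmod (deriv f u) \<le> b"
      unfolding compact_eq_bounded_closed bounded_iff by (metis imageI mem_cball_0)
    have "N2 (f \<circ> \<phi>) \<le> ennreal ((cmod (f (\<phi> 0)))\<^sup>2) * mass + ennreal 1 * N2 f + ennreal (K * b\<^sup>2)"
      by (rule K[OF hol]) (auto intro!: power_mono b)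
    also have "\<dots> < \<infinity>" using mass_finite fin by (auto simp: ennreal_mult_less_top)
    finally show ?thesis
      using holomorphic_on_compose_gen[OF \<phi>(1) hol \<phi>(2)] by (simp add: A2_iff comp_op_def)
  qed
  have seq: "\<exists>r g. strict_mono r \<and> g \<in> A2 \<sigma> \<and> (\<lambda>k. A2_norm \<sigma> (comp_op \<phi> (s (r k)) - g)) \<longlonglongrightarrow> 0"
    if s: "\<And>n. s n \<in> A2 \<sigma>" and B: "\<And>n. A2_norm \<sigma> (s n) \<le> B" for s :: "nat \<Rightarrow> complex \<Rightarrow> complex" and B
  proof -
    have s_hol: "s n holomorphic_on ball 0 1" for n using s by (auto simp: A2_iff)
    have A2_norm_nonneg: "0 \<le> A2_norm \<sigma> f" for f by (simp add: A2_norm_def)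
    have B0: "0 \<le> B" using A2_norm_nonneg B order_trans by blast
    have N2_s: "N2 (s n) \<le> ennreal (pi * B\<^sup>2)" for n
      unfolding N2_eq_norm[OF s] by (intro ennreal_leI mult_left_mono power_mono B A2_norm_nonneg) auto
    have loc: "\<exists>b. \<forall>h\<in>range s. \<forall>z\<in>K. cmod (h z) \<le> b" if K: "compact K" "K \<subseteq> ball 0 1" for K
    proof (cases "K = {}")
      case False
      \<comment> \<open>Since \<open>\<omega>\<close> is non-increasing, the point of largest
        modulus provides a bound valid on all of \<open>K\<close>.\<close>
      obtain x where x: "x \<in> K" "\<And>z. z \<in> K \<Longrightarrow> cmod z \<le> cmod x"
        using continuous_attains_sup[OF K(1) False, of cmod] by (auto intro: continuous_intros)
      have "cmod x < 1" using x K by auto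
      have "cmod (s n z) \<le> sqrt (2 ^ m * B\<^sup>2 / \<omega> (cmod x))" if z: "z \<in> K" for n z
      proof -
        have z1: "cmod z < 1" using z K by auto
        have wx: "0 < \<omega> (cmod x)" using \<open>cmod x < 1\<close> by (intro pos_\<omega>) auto
        have "\<omega> (cmod x) * (cmod (s n z))\<^sup>2 \<le> \<omega> (cmod z) * (cmod (s n z))\<^sup>2"
          by (intro mult_right_mono \<omega>_antimono x z \<open>cmod x < 1\<close>) auto
        also have "\<dots> \<le> 2 ^ m * (A2_norm \<sigma> (s n))\<^sup>2" by (rule point_bound[OF s z1])
        also have "\<dots> \<le> 2 ^ m * B\<^sup>2" by (intro mult_left_mono power_mono B A2_norm_nonneg) auto
        finally have "(cmod (s n z))\<^sup>2 \<le> 2 ^ m * B\<^sup>2 / \<omega> (cmod x)" using wx by (simp add: field_simps)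
        then show ?thesis by (rule real_le_rsqrt)
      qed
      then show ?thesis by blast
    qed auto
    obtain g r where g: "g holomorphic_on ball 0 1" and r: "strict_mono r"
      and pt: "\<And>z. z \<in> ball 0 1 \<Longrightarrow> (\<lambda>n. s (r n) z) \<longlonglongrightarrow> g z"
      and unif: "\<And>K. compact K \<Longrightarrow> K \<subseteq> ball 0 1 \<Longrightarrow> uniform_limit K (s \<circ> r) g sequentially"
    proof (rule Montel[of "ball 0 1" "range s" s])
      show "h holomorphic_on ball 0 1" if "h \<in> range s" for h using that s_hol by auto
      show "\<exists>b. \<forall>h\<in>range s. \<forall>z\<in>K. cmod (h z) \<le> b" if "compact K" "K \<subseteq> ball 0 1" for K
        by (rule loc[OF that])
    qed (auto intro: that)
    have N2_g: "N2 g \<le> ennreal (pi * B\<^sup>2)"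
      by (rule N2_pointwise_limit_le[of "\<lambda>n. s (r n)"]) (use s_hol g pt N2_s in auto)
    then have gA: "g \<in> A2 \<sigma>" using g by (auto simp: A2_iff intro: le_less_trans)
    define f where "f k = s (r k) - g" for k
    have fA: "f k \<in> A2 \<sigma>" for k unfolding f_def by (intro A2_diff s gA)
    then have f_hol: "f k holomorphic_on ball 0 1" for k by (auto simp: A2_iff)
    have N2_f: "N2 (f k) \<le> ennreal (4 * pi * B\<^sup>2)" for k
    proof -
      have "N2 (f k) \<le> 2 * N2 (s (r k)) + 2 * N2 g" unfolding f_def by (rule N2_diff_le[OF s_hol g])
      also have "\<dots> \<le> 2 * ennreal (pi * B\<^sup>2) + 2 * ennreal (pi * B\<^sup>2)"
        by (intro add_mono mult_left_mono N2_s N2_g) auto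
      also have "\<dots> = ennreal 4 * ennreal (pi * B\<^sup>2)" by (simp add: distrib_right[symmetric])
      also have "\<dots> = ennreal (4 * pi * B\<^sup>2)" by (subst ennreal_mult'[symmetric]) (auto simp: mult_ac)
      finally show ?thesis .
    qed
    have small: "\<forall>\<^sub>F k in sequentially. \<forall>z. cmod z \<le> \<rho> \<longrightarrow> cmod (f k z) \<le> \<eta>" if "\<rho> < 1" "0 < \<eta>" for \<rho> \<eta>
    proof -
      have "uniform_limit (cball 0 \<rho>) (s \<circ> r) g sequentially" using that by (intro unif) auto
      then have "\<forall>\<^sub>F k in sequentially. \<forall>z\<in>cball 0 \<rho>. dist ((s \<circ> r) k z) (g z) < \<eta>"
        using that unfolding uniform_limit_iff by blast
      then show ?thesis by (rule eventually_mono) (auto simp: f_def dist_norm intro: less_imp_le)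
    qed
    have "(\<lambda>k. N2 (f k \<circ> \<phi>)) \<longlonglongrightarrow> 0"
    proof (rule order_tendstoI)
      fix a :: ennreal assume "0 < a"
      then obtain c where c: "0 < c" "c < a" using dense by blast
      then have "c < top" using less_trans top.not_eq_extremum by fastforce
      then obtain e where e: "0 < e" "ennreal e < a"
        using c by (intro that[of "enn2real c"]) (auto simp: enn2real_positive_iff)
      \<comment> \<open>The three terms of the estimate will be at most
        \<open>\<epsilon> * M\<close>, \<open>\<epsilon> * (4 * pi * B^2)\<close> and
        \<open>\<epsilon>\<close>; this choice makes their sum \<open>e\<close>.\<close>
      define \<epsilon> where "\<epsilon> = e / (M + 4 * pi * B\<^sup>2 + 1)"
      have den: "0 < M + 4 * pi * B\<^sup>2 + 1" using M(2) by (intro add_nonneg_pos add_nonneg_nonneg) auto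
      then have \<epsilon>: "0 < \<epsilon>" using e by (simp add: \<epsilon>_def)
      obtain \<rho> K where \<rho>: "0 \<le> \<rho>" "\<rho> < 1" and K0: "0 \<le> K" and K: "\<And>f B. f holomorphic_on ball 0 1 \<Longrightarrow> (\<And>u. cmod u \<le> \<rho> \<Longrightarrow> (cmod (deriv f u))\<^sup>2 \<le> B) \<Longrightarrow> 0 \<le> B \<Longrightarrow>
        N2 (f \<circ> \<phi>) \<le> ennreal ((cmod (f (\<phi> 0)))\<^sup>2) * mass + ennreal \<epsilon> * N2 f + ennreal (K * B)"
        using est[OF \<epsilon>] by metis
      define b where "b = \<epsilon> / (K + 1)"
      have b: "0 < b" "K * b \<le> \<epsilon>" using \<epsilon> K0 by (auto simp: b_def field_simps)
      \<comment> \<open>With this bound on the larger disc, Cauchy's estimate gives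
        \<open>|deriv (f k) u| \<le> sqrt b\<close>.\<close>
      define \<eta> where "\<eta> = sqrt b * ((1 - \<rho>) / 2)"
      have \<eta>: "0 < \<eta>" using b \<rho> by (simp add: \<eta>_def)
      have "cmod (\<phi> 0) < 1" using self_map_cmod_less[OF \<phi>(2), of 0] by simp
      then have ev1: "\<forall>\<^sub>F k in sequentially. \<forall>z. cmod z \<le> cmod (\<phi> 0) \<longrightarrow> cmod (f k z) \<le> sqrt \<epsilon>"
        using \<epsilon> by (intro small) auto
      have ev2: "\<forall>\<^sub>F k in sequentially. \<forall>z. cmod z \<le> (1 + \<rho>) / 2 \<longrightarrow> cmod (f k z) \<le> \<eta>"
        using \<rho> \<eta> by (intro small) auto
      show "\<forall>\<^sub>F k in sequentially. N2 (f k \<circ> \<phi>) < a"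
        using ev1 ev2
      proof eventually_elim
        case (elim k)
        have d: "(cmod (deriv (f k) u))\<^sup>2 \<le> b" if "cmod u \<le> \<rho>" for u
        proof -
          have "cmod (deriv (f k) u) \<le> \<eta> / ((1 - \<rho>) / 2)"
            by (rule cauchy_deriv_bound[OF f_hol \<rho>(2) that]) (use elim(2) in blast)
          also have "\<dots> = sqrt b" using \<rho> by (simp add: \<eta>_def)
          finally have "(cmod (deriv (f k) u))\<^sup>2 \<le> (sqrt b)\<^sup>2" by (intro power_mono) auto
          then show ?thesis using b by simp
        qed
        have "(cmod (f k (\<phi> 0)))\<^sup>2 \<le> (sqrt \<epsilon>)\<^sup>2" using elim(1) by (intro power_mono) auto
        then have f0: "(cmod (f k (\<phi> 0)))\<^sup>2 \<le> \<epsilon>" using \<epsilon> by simp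
        have "N2 (f k \<circ> \<phi>) \<le> ennreal ((cmod (f k (\<phi> 0)))\<^sup>2) * mass + ennreal \<epsilon> * N2 (f k) + ennreal (K * b)"
          by (rule K[OF f_hol d]) (use b in auto)
        also have "\<dots> \<le> ennreal \<epsilon> * ennreal M + ennreal \<epsilon> * ennreal (4 * pi * B\<^sup>2) + ennreal \<epsilon>"
          unfolding M(1) by (intro add_mono mult_mono ennreal_leI f0 N2_f b) auto
        also have "\<dots> = ennreal (\<epsilon> * (M + 4 * pi * B\<^sup>2 + 1))"
          using \<epsilon> M(2) by (simp add: ennreal_mult'[symmetric] ennreal_plus[symmetric] distrib_left del: ennreal_plus)
        also have "\<epsilon> * (M + 4 * pi * B\<^sup>2 + 1) = e" using den by (simp add: \<epsilon>_def)
        finally show ?case using e by order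
      qed
    qed simp
    moreover have eq: "f k \<circ> \<phi> = comp_op \<phi> (s (r k)) - (g \<circ> \<phi>)" for k
      by (simp add: f_def comp_op_def fun_eq_iff)
    have "(\<lambda>k. A2_norm \<sigma> (f k \<circ> \<phi>)) \<longlonglongrightarrow> 0 \<longleftrightarrow> (\<lambda>k. N2 (f k \<circ> \<phi>)) \<longlonglongrightarrow> 0"
      by (rule A2_norm_tendsto_0) (use maps[OF fA] in \<open>simp add: comp_op_def\<close>)
    ultimately have "(\<lambda>k. A2_norm \<sigma> (comp_op \<phi> (s (r k)) - (g \<circ> \<phi>))) \<longlonglongrightarrow> 0" by (simp add: eq)
    then show ?thesis using r maps[OF gA] by (auto simp: comp_op_def)
  qed
  show ?thesis
    unfolding compact_operator_def
  proof (intro conjI ballI allI impI)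
    fix s :: "nat \<Rightarrow> complex \<Rightarrow> complex"
    assume "(\<forall>n. s n \<in> A2 \<sigma>) \<and> (\<exists>B. \<forall>n. A2_norm \<sigma> (s n) \<le> B)"
    then obtain B where "\<And>n. s n \<in> A2 \<sigma>" "\<And>n. A2_norm \<sigma> (s n) \<le> B" by blast
    then show "\<exists>r g. strict_mono r \<and> g \<in> A2 \<sigma> \<and> (\<lambda>k. A2_norm \<sigma> (comp_op \<phi> (s (r k)) - g)) \<longlonglongrightarrow> 0"
      by (rule seq)
  qed (rule maps)
qed

end

section \<open>Kernel functions in the Hardy space\<close>

text \<open>Compactness yields a subsequence whose images converge in norm, and point evaluations
  identify the limit as 0 on the disc. The functions live on the whole plane, so \<open>cong\<close>
  says that \<open>N\<close> ignores values outside the disc. Abstract \<open>X\<close> and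
  \<open>N\<close> let the lemma serve both \<open>H2\<close> and
  \<open>A2 \<sigma>\<close>.\<close>

lemma compact_operator_null_sequence:
  assumes comp: "compact_operator X N (comp_op \<phi>)" and \<phi>: "\<phi> ` ball 0 1 \<subseteq> ball 0 1"
    and diff: "\<And>f g. f \<in> X \<Longrightarrow> g \<in> X \<Longrightarrow> f - g \<in> X"
    and eval: "\<And>z. cmod z < 1 \<Longrightarrow> \<exists>c. \<forall>f\<in>X. cmod (f z) \<le> c * N f"
    and cong: "\<And>f g. (\<And>z. cmod z < 1 \<Longrightarrow> f z = g z) \<Longrightarrow> N f = N g"
    and s: "\<And>n. s n \<in> X" "\<And>n. N (s n) \<le> B"
    and null: "\<And>z. cmod z < 1 \<Longrightarrow> (\<lambda>n. s n z) \<longlonglongrightarrow> 0"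
  shows "\<exists>r :: nat \<Rightarrow> nat. strict_mono r \<and> (\<lambda>k. N (comp_op \<phi> (s (r k)))) \<longlonglongrightarrow> 0"
proof -
  obtain r g where r: "strict_mono r" and g: "g \<in> X" and lim: "(\<lambda>k. N (comp_op \<phi> (s (r k)) - g)) \<longlonglongrightarrow> 0"
    using comp s unfolding compact_operator_def by meson
  have maps: "comp_op \<phi> f \<in> X" if "f \<in> X" for f using comp that unfolding compact_operator_def by blast
  have g0: "g z = 0" if z: "cmod z < 1" for z
  proof -
    obtain c where c: "\<And>f. f \<in> X \<Longrightarrow> cmod (f z) \<le> c * N f" using eval[OF z] by blast
    have "(\<lambda>k. comp_op \<phi> (s (r k)) z - g z) \<longlonglongrightarrow> 0"
    proof (rule Lim_null_comparison)
      show "\<forall>\<^sub>F k in sequentially. cmod (comp_op \<phi> (s (r k)) z - g z) \<le> c * N (comp_op \<phi> (s (r k)) - g)"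
        using c[OF diff[OF maps[OF s(1)] g]] by simp
      show "(\<lambda>k. c * N (comp_op \<phi> (s (r k)) - g)) \<longlonglongrightarrow> 0"
        using tendsto_mult[OF tendsto_const lim, of c] by simp
    qed
    moreover have "(\<lambda>k. comp_op \<phi> (s (r k)) z) \<longlonglongrightarrow> 0"
      using LIMSEQ_subseq_LIMSEQ[OF null[OF self_map_cmod_less[OF \<phi> z]] r] by (simp add: comp_op_def o_def)
    ultimately have "(\<lambda>k. comp_op \<phi> (s (r k)) z - (comp_op \<phi> (s (r k)) z - g z)) \<longlonglongrightarrow> 0 - 0"
      by (rule tendsto_diff[rotated])
    then have "(\<lambda>k::nat. g z) \<longlonglongrightarrow> 0" by simp
    then show ?thesis by (simp add: LIMSEQ_const_iff)
  qed
  have "N (comp_op \<phi> (s (r k)) - g) = N (comp_op \<phi> (s (r k)))" for k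
    by (rule cong) (simp add: g0)
  then show ?thesis using r lim by auto
qed

lemma hardy_norm2_cong:
  assumes "\<And>z. cmod z < 1 \<Longrightarrow> f z = g z"
  shows "hardy_norm2 f = hardy_norm2 g"
  unfolding hardy_norm2_def
  by (intro SUP_cong arg_cong2[where f = "(/)"] nn_integral_cong refl) (auto simp: assms norm_mult)

lemma borel_measurable_circle:
  assumes f: "f holomorphic_on ball 0 1" and r: "0 \<le> r" "r < 1"
  shows "(\<lambda>\<theta>. ennreal ((cmod (f (of_real r * exp (\<i> * of_real \<theta>))))\<^sup>2) * indicator {0..2*pi} \<theta>) \<in> borel_measurable borel"
proof (rule borel_measurable_ennreal_continuous_indicator)
  show "continuous_on {0..2*pi} (\<lambda>x. (cmod (f (complex_of_real r * exp (\<i> * complex_of_real x))))\<^sup>2)"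
    by (intro continuous_intros continuous_on_compose2[OF holomorphic_on_imp_continuous_on[OF f]])
       (use r in \<open>auto simp: norm_mult\<close>)
qed auto

lemma hardy_norm2_diff_le:
  assumes f: "f holomorphic_on ball 0 1" and g: "g holomorphic_on ball 0 1"
  shows "hardy_norm2 (f - g) \<le> 2 * hardy_norm2 f + 2 * hardy_norm2 g"
  unfolding hardy_norm2_def[of "f - g"]
proof (rule SUP_least)
  fix r :: real assume r: "r \<in> {0..<1}"
  define I where "I f = (\<integral>\<^sup>+ \<theta> \<in> {0..2*pi}. ennreal ((cmod (f (of_real r * exp (\<i> * of_real \<theta>))))\<^sup>2) \<partial>lborel)" for f :: "complex \<Rightarrow> complex"
  have I_le: "I f / ennreal (2*pi) \<le> hardy_norm2 f" for f
    unfolding I_def hardy_norm2_def using r by (intro SUP_upper) auto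
  have "I (f - g) \<le> (\<integral>\<^sup>+\<theta>. 2 * (ennreal ((cmod (f (of_real r * exp (\<i> * of_real \<theta>))))\<^sup>2) * indicator {0..2*pi} \<theta>)
      + 2 * (ennreal ((cmod (g (of_real r * exp (\<i> * of_real \<theta>))))\<^sup>2) * indicator {0..2*pi} \<theta>) \<partial>lborel)"
    unfolding I_def
  proof (rule nn_integral_mono)
    fix \<theta> :: real
    let ?z = "of_real r * exp (\<i> * of_real \<theta>)"
    have "(cmod (f ?z - g ?z))\<^sup>2 \<le> (cmod (f ?z) + cmod (g ?z))\<^sup>2"
      by (intro power_mono norm_triangle_ineq4) auto
    also have "\<dots> \<le> 2 * (cmod (f ?z))\<^sup>2 + 2 * (cmod (g ?z))\<^sup>2"
      using sum_squares_bound[of "cmod (f ?z)" "cmod (g ?z)"] by (simp add: power2_sum)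
    finally have "ennreal ((cmod (f ?z - g ?z))\<^sup>2) \<le> 2 * ennreal ((cmod (f ?z))\<^sup>2) + 2 * ennreal ((cmod (g ?z))\<^sup>2)"
      by (drule_tac ennreal_leI) (simp add: ennreal_mult')
    then show "ennreal ((cmod ((f - g) ?z))\<^sup>2) * indicator {0..2*pi} \<theta> \<le> 2 * (ennreal ((cmod (f ?z))\<^sup>2) * indicator {0..2*pi} \<theta>) + 2 * (ennreal ((cmod (g ?z))\<^sup>2) * indicator {0..2*pi} \<theta>)"
      by (auto split: split_indicator)
  qed
  also have "\<dots> = 2 * I f + 2 * I g"
    unfolding I_def using borel_measurable_circle[OF f, of r] borel_measurable_circle[OF g, of r] r
    by (subst nn_integral_add) (auto simp: nn_integral_cmult)
  finally have "I (f - g) / ennreal (2*pi) \<le> (2 * I f + 2 * I g) / ennreal (2*pi)"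
    by (rule divide_right_mono_ennreal)
  also have "\<dots> = 2 * (I f / ennreal (2*pi)) + 2 * (I g / ennreal (2*pi))"
    by (simp add: divide_ennreal_def distrib_right mult.assoc)
  also have "\<dots> \<le> 2 * hardy_norm2 f + 2 * hardy_norm2 g"
    by (intro add_mono mult_left_mono I_le) auto
  finally show "(\<integral>\<^sup>+ \<theta> \<in> {0..2*pi}. ennreal ((cmod ((f - g) (of_real r * exp (\<i> * of_real \<theta>))))\<^sup>2) \<partial>lborel) / ennreal (2*pi)
      \<le> 2 * hardy_norm2 f + 2 * hardy_norm2 g" by (simp add: I_def)
qed

lemma H2_diff: "f \<in> H2 \<Longrightarrow> g \<in> H2 \<Longrightarrow> f - g \<in> H2"
  unfolding H2_def
  by (auto intro!: holomorphic_on_diff simp: fun_diff_def)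
     (auto intro!: le_less_trans[OF hardy_norm2_diff_le, unfolded fun_diff_def] simp: ennreal_mult_less_top)

text \<open>The Szego kernel scaled by \<open>sqrt (1 - |u|)\<close> instead of the exact
  \<open>sqrt (1 - |u|^2)\<close>; its squared Hardy norm is \<open>1 / (1 + |u|)\<close>.\<close>

definition kern :: "complex \<Rightarrow> complex \<Rightarrow> complex" where
  "kern u v = of_real (sqrt (1 - cmod u)) / (1 - cnj u * v)"

lemma cmod_one_minus_ge:
  assumes "cmod u < 1" "cmod v < 1"
  shows "1 - cmod u \<le> cmod (1 - cnj u * v)" and "1 - cmod v \<le> cmod (1 - cnj u * v)"
    and "1 - cnj u * v \<noteq> 0"
proof -
  have *: "1 - cmod u * cmod v \<le> cmod (1 - cnj u * v)"
    using norm_triangle_ineq2[of 1 "cnj u * v"] by (simp add: norm_mult)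
  have "cmod u * cmod v \<le> cmod u" "cmod u * cmod v \<le> cmod v"
    using assms by (auto simp: mult_left_le mult_left_le_one_le)
  then show "1 - cmod u \<le> cmod (1 - cnj u * v)" "1 - cmod v \<le> cmod (1 - cnj u * v)"
    using * by linarith+
  then have "0 < cmod (1 - cnj u * v)" using assms by linarith
  then show "1 - cnj u * v \<noteq> 0" by auto
qed

lemma kern_holomorphic: "cmod u < 1 \<Longrightarrow> kern u holomorphic_on ball 0 1"
  unfolding kern_def[abs_def] using cmod_one_minus_ge(3)[of u]
  by (auto intro!: holomorphic_intros)

lemma deriv_kern:
  assumes "cmod u < 1" "cmod v < 1"
  shows "deriv (kern u) v = of_real (sqrt (1 - cmod u)) * cnj u / (1 - cnj u * v)\<^sup>2"
  unfolding kern_def[abs_def] using cmod_one_minus_ge(3)[OF assms]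
  by (intro DERIV_imp_deriv) (auto intro!: derivative_eq_intros simp: power2_eq_square field_simps)

text \<open>The squared modulus of the kernel is dominated by the real part of a holomorphic function,
  so its circle means are controlled by a single point value (this replaces Littlewood subordination).\<close>

lemma hardy_norm2_kern_compose_le:
  assumes \<phi>: "\<phi> holomorphic_on ball 0 1" "\<phi> ` ball 0 1 \<subseteq> ball 0 1" and u: "cmod u < 1"
  shows "hardy_norm2 (kern u \<circ> \<phi>) \<le> ennreal (2 / (1 - cmod (\<phi> 0)))"
  unfolding hardy_norm2_def
proof (rule SUP_least)
  fix r :: real assume r: "r \<in> {0..<1}"
  \<comment> \<open>With \<open>x = cnj u * \<phi> z\<close>, the real part of \<open>F z\<close> is
    the Poisson expression \<open>(1 - |x|^2) / |1 - x|^2\<close>, whose numerator is at least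
    \<open>1 - |u|\<close> because \<open>|x| \<le> |u|\<close>.\<close>
  define F where "F z = (1 + cnj u * \<phi> z) / (1 - cnj u * \<phi> z)" for z
  note lt = self_map_cmod_less[OF \<phi>(2)]
  have nz: "1 - cnj u * \<phi> z \<noteq> 0" if "cmod z < 1" for z by (rule cmod_one_minus_ge(3)[OF u lt[OF that]])
  have F: "F holomorphic_on ball 0 1"
    unfolding F_def[abs_def] using nz by (auto intro!: holomorphic_intros \<phi>)
  have ReF: "(cmod ((kern u \<circ> \<phi>) z))\<^sup>2 \<le> Re (F z)" if z: "cmod z < 1" for z
  proof -
    let ?x = "cnj u * \<phi> z"
    have "Re (F z) = Re ((1 + ?x) * cnj (1 - ?x)) / (cmod (1 - ?x))\<^sup>2"
      unfolding F_def by (subst complex_div_cnj) (simp add: Re_divide_of_real del: complex_cnj_diff flip: of_real_power)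
    also have "Re ((1 + ?x) * cnj (1 - ?x)) = 1 - (cmod ?x)\<^sup>2"
      unfolding cmod_power2 by (simp add: algebra_simps power2_eq_square)
    finally have eq: "Re (F z) = (1 - (cmod ?x)\<^sup>2) / (cmod (1 - ?x))\<^sup>2" .
    have x: "cmod ?x \<le> cmod u" using lt[OF z] by (simp add: norm_mult mult_left_le)
    have "(cmod ?x)\<^sup>2 \<le> cmod ?x" using x u power_decreasing[of 1 2 "cmod ?x"] by simp
    then have "1 - cmod u \<le> 1 - (cmod ?x)\<^sup>2" using x by linarith
    moreover have "(cmod ((kern u \<circ> \<phi>) z))\<^sup>2 = (1 - cmod u) / (cmod (1 - ?x))\<^sup>2"
      using u by (simp add: kern_def norm_divide power_divide)
    ultimately show ?thesis unfolding eq by (simp add: divide_right_mono)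
  qed
  have on_circle: "cmod (of_real r * exp (\<i> * of_real \<theta>)) < 1" for \<theta> using r by (simp add: norm_mult)
  have "(\<integral>\<^sup>+ \<theta> \<in> {0..2*pi}. ennreal ((cmod ((kern u \<circ> \<phi>) (of_real r * exp (\<i> * of_real \<theta>))))\<^sup>2) \<partial>lborel)
    \<le> (\<integral>\<^sup>+ \<theta> \<in> {0..2*pi}. ennreal (Re (F (of_real r * exp (\<i> * of_real \<theta>)))) \<partial>lborel)"
    by (intro nn_integral_mono mult_right_mono ennreal_leI ReF on_circle) auto
  also have "\<dots> = ennreal (2 * pi * Re (F 0))"
  proof (rule nn_integral_has_integral_lebesgue')
    show "0 \<le> Re (F (of_real r * exp (\<i> * of_real \<theta>)))" for \<theta>
      using ReF[OF on_circle] by (rule order_trans[rotated]) simp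
    have "((\<lambda>\<theta>. F (of_real r * exp (\<i> * of_real \<theta>))) has_integral (2 * pi * F 0)) {0..2*pi}"
      by (rule circle_mean_value[OF F]) (use r in simp)
    from has_integral_Re[OF this] show "((\<lambda>\<theta>. Re (F (of_real r * exp (\<i> * of_real \<theta>)))) has_integral (2 * pi * Re (F 0))) {0..2*pi}"
      by simp
  qed
  finally have "(\<integral>\<^sup>+ \<theta> \<in> {0..2*pi}. ennreal ((cmod ((kern u \<circ> \<phi>) (of_real r * exp (\<i> * of_real \<theta>))))\<^sup>2) \<partial>lborel) / ennreal (2*pi)
     \<le> ennreal (2 * pi * Re (F 0)) / ennreal (2*pi)" by (rule divide_right_mono_ennreal)
  also have "\<dots> = ennreal (Re (F 0))"
    by (subst divide_ennreal) (use order_trans[OF zero_le_power2 ReF[of 0]] in auto)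
  also have "\<dots> \<le> ennreal (2 / (1 - cmod (\<phi> 0)))"
  proof (rule ennreal_leI)
    have p0: "cmod (\<phi> 0) < 1" by (rule lt) simp
    have "Re (F 0) \<le> cmod (F 0)" by (rule complex_Re_le_cmod)
    also have "\<dots> = cmod (1 + cnj u * \<phi> 0) / cmod (1 - cnj u * \<phi> 0)" by (simp add: F_def norm_divide)
    also have "\<dots> \<le> 2 / (1 - cmod (\<phi> 0))"
    proof (rule frac_le)
      have "cmod (cnj u * \<phi> 0) \<le> 1" using u p0 by (simp add: norm_mult mult_le_one)
      then show "cmod (1 + cnj u * \<phi> 0) \<le> 2" using norm_triangle_ineq[of 1 "cnj u * \<phi> 0"] by simp
      show "1 - cmod (\<phi> 0) \<le> cmod (1 - cnj u * \<phi> 0)" by (rule cmod_one_minus_ge(2)[OF u p0])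
    qed (use p0 in auto)
    finally show "Re (F 0) \<le> 2 / (1 - cmod (\<phi> 0))" .
  qed
  finally show "(\<integral>\<^sup>+ \<theta> \<in> {0..2*pi}. ennreal ((cmod ((kern u \<circ> \<phi>) (of_real r * exp (\<i> * of_real \<theta>))))\<^sup>2) \<partial>lborel) / ennreal (2*pi) \<le> ennreal (2 / (1 - cmod (\<phi> 0)))" .
qed

lemma kern_compose_in_H2:
  assumes \<phi>: "\<phi> holomorphic_on ball 0 1" "\<phi> ` ball 0 1 \<subseteq> ball 0 1" and u: "cmod u < 1"
  shows "kern u \<circ> \<phi> \<in> H2" and "(H2_norm (kern u \<circ> \<phi>))\<^sup>2 \<le> 2 / (1 - cmod (\<phi> 0))"
proof -
  note le = hardy_norm2_kern_compose_le[OF \<phi> u]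
  show "kern u \<circ> \<phi> \<in> H2"
    using holomorphic_on_compose_gen[OF \<phi>(1) kern_holomorphic[OF u] \<phi>(2)] le
    by (auto simp: H2_def intro: le_less_trans)
  have "cmod (\<phi> 0) < 1" using self_map_cmod_less[OF \<phi>(2), of 0] by simp
  then have "enn2real (hardy_norm2 (kern u \<circ> \<phi>)) \<le> 2 / (1 - cmod (\<phi> 0))"
    using le by (intro enn2real_leI) auto
  then show "(H2_norm (kern u \<circ> \<phi>))\<^sup>2 \<le> 2 / (1 - cmod (\<phi> 0))" by (simp add: H2_norm_def)
qed

text \<open>A substitute for the Schwarz-Pick lemma. The kernel at \<open>\<phi> z\<close>, composed
  with \<open>\<phi>\<close>, has squared modulus at least \<open>1 / (4 * h)\<close> at
  \<open>z\<close>, where \<open>h = 1 - |\<phi> z|\<close>, while the Hardy point bound allows at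
  most \<open>2 / (1 - |\<phi> 0|) / (1 - |z|)\<close>; 8 is \<open>4 * 2\<close>.\<close>

lemma self_map_boundary_distance:
  assumes \<phi>: "\<phi> holomorphic_on ball 0 1" "\<phi> ` ball 0 1 \<subseteq> ball 0 1" and z: "cmod z < 1"
  shows "1 - cmod z \<le> 8 / (1 - cmod (\<phi> 0)) * (1 - cmod (\<phi> z))"
proof -
  let ?u = "\<phi> z" and ?C = "2 / (1 - cmod (\<phi> 0))"
  have u: "cmod ?u < 1" by (rule self_map_cmod_less[OF \<phi>(2) z])
  define h where "h = 1 - cmod ?u"
  have h: "0 < h" "h \<le> 1" using u by (auto simp: h_def)
  have zsq: "1 - cmod z \<le> 1 - (cmod z)\<^sup>2" using power_decreasing[of 1 2 "cmod z"] z by simp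
  have "cmod (1 - cnj ?u * ?u) = 1 - (cmod ?u)\<^sup>2"
  proof -
    have "1 - cnj ?u * ?u = of_real (1 - (cmod ?u)\<^sup>2)" by (simp add: complex_norm_square mult.commute del: of_real_power)
    then show ?thesis using u by (metis abs_of_nonneg diff_ge_0_iff_ge norm_of_real less_imp_le norm_ge_zero power_le_one)
  qed
  moreover have "1 - (cmod ?u)\<^sup>2 \<le> 2 * h"
  proof -
    have "1 - (cmod ?u)\<^sup>2 = h * (1 + cmod ?u)" by (simp add: h_def algebra_simps power2_eq_square)
    also have "\<dots> \<le> h * 2" using h u by (intro mult_left_mono) auto
    finally show ?thesis by simp
  qed
  ultimately have d: "cmod (1 - cnj ?u * ?u) \<le> 2 * h" by simp
  have d0: "0 < cmod (1 - cnj ?u * ?u)" unfolding zero_less_norm_iff by (rule cmod_one_minus_ge(3)[OF u u])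
  have "1 / (4 * h) = h / (2 * h)\<^sup>2" using h by (simp add: power2_eq_square)
  also have "\<dots> \<le> h / (cmod (1 - cnj ?u * ?u))\<^sup>2"
    by (intro divide_left_mono power_mono mult_pos_pos zero_less_power d d0) (use h in simp_all)
  also have "\<dots> = (cmod ((kern ?u \<circ> \<phi>) z))\<^sup>2"
    using u by (simp add: kern_def norm_divide power_divide h_def)
  also have "\<dots> \<le> (H2_norm (kern ?u \<circ> \<phi>))\<^sup>2 / (1 - (cmod z)\<^sup>2)"
    by (rule hardy_point_bound[OF kern_compose_in_H2(1)[OF \<phi> u] z])
  also have "\<dots> \<le> ?C / (1 - cmod z)"
    using z zsq order_trans[OF zero_le_power2 kern_compose_in_H2(2)[OF \<phi> u]]
    by (intro frac_le kern_compose_in_H2(2)[OF \<phi> u]) auto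
  finally have "(1 - cmod z) * 1 \<le> ?C * (4 * h)" using z h by (simp only: field_simps) (simp add: field_simps)
  then show ?thesis by (simp add: h_def)
qed

text \<open>Defined separately because \<open>1 - r\<close> is not among the functions
  \<open>\<omega>\<close> of the locale: its second derivative vanishes while
  \<open>\<sigma>\<close> is positive.\<close>

definition hardy_window :: "(complex \<Rightarrow> complex) \<Rightarrow> complex \<Rightarrow> ennreal" where
  "hardy_window \<phi> u = (\<integral>\<^sup>+z\<in>ball 0 1. ennreal ((cmod (deriv \<phi> z))\<^sup>2 * (1 - cmod z)) * indicator (ball u ((1 - cmod u) / 2)) (\<phi> z) \<partial>lborel)"

text \<open>On the window, \<open>h ^ 3\<close> times the squared derivative of the kernel is
  bounded below, where \<open>h = 1 - |u|\<close>; so up to a constant the window mass is at most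
  \<open>h ^ 3\<close> times the Littlewood-Paley integral of
  \<open>kern u \<circ> \<phi>\<close>.\<close>

lemma hardy_window_le:
  assumes \<phi>: "\<phi> holomorphic_on ball 0 1" "\<phi> ` ball 0 1 \<subseteq> ball 0 1" and u: "1/2 \<le> cmod u" "cmod u < 1"
  shows "hardy_window \<phi> u \<le> ennreal (1000 * (1 - cmod u) ^ 3) * hardy_norm2 (kern u \<circ> \<phi>)"
proof -
  define h where "h = 1 - cmod u"
  have h: "0 < h" using u by (simp add: h_def)
  have F: "kern u \<circ> \<phi> holomorphic_on ball 0 1" by (rule holomorphic_on_compose_gen[OF \<phi>(1) kern_holomorphic[OF u(2)] \<phi>(2)])
  \<comment> \<open>From \<open>|1 - cnj u * v| \<le> 5/2 * h\<close> and
    \<open>|u| \<ge> 1/2\<close>, the product of \<open>h ^ 3\<close> and the squared derivative is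
    at least \<open>4 / 625\<close>; 157 is the next integer above \<open>625 / 4\<close>.\<close>
  have lower: "1 \<le> 157 * h ^ 3 * (cmod (deriv (kern u) v))\<^sup>2" if v: "v \<in> ball u (h / 2)" "cmod v < 1" for v
  proof -
    have "1 - cnj u * v = of_real (1 - (cmod u)\<^sup>2) + cnj u * (u - v)"
      by (simp add: complex_norm_square algebra_simps del: of_real_power)
    then have "cmod (1 - cnj u * v) \<le> cmod (of_real (1 - (cmod u)\<^sup>2)) + cmod (cnj u * (u - v))"
      using norm_triangle_ineq by metis
    also have "\<dots> = (1 - (cmod u)\<^sup>2) + cmod u * cmod (u - v)"
      using u(2) by (simp only: norm_of_real norm_mult complex_mod_cnj) (simp add: power_le_one)
    also have "\<dots> \<le> 2 * h + 1 * (h / 2)"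
    proof (rule add_mono)
      have "1 - (cmod u)\<^sup>2 = h * (1 + cmod u)" by (simp add: h_def algebra_simps power2_eq_square)
      also have "\<dots> \<le> h * 2" using h u by (intro mult_left_mono) auto
      finally show "1 - (cmod u)\<^sup>2 \<le> 2 * h" by simp
      show "cmod u * cmod (u - v) \<le> 1 * (h / 2)" using u v h by (intro mult_mono) (auto simp: dist_norm)
    qed
    finally have d: "cmod (1 - cnj u * v) \<le> 5/2 * h" by simp
    have d0: "0 < cmod (1 - cnj u * v)" unfolding zero_less_norm_iff by (rule cmod_one_minus_ge(3)[OF u(2) v(2)])
    have "157 * h ^ 3 * (cmod (deriv (kern u) v))\<^sup>2 = 157 * h ^ 3 * (h * (cmod u)\<^sup>2 / (cmod (1 - cnj u * v)) ^ 4)"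
      using u by (simp add: deriv_kern[OF u(2) v(2)] norm_divide norm_mult power_divide power_mult_distrib norm_power h_def flip: power_mult)
    also have "\<dots> \<ge> 157 * h ^ 3 * (h * (1/2)\<^sup>2 / (5/2 * h) ^ 4)"
      by (intro mult_left_mono frac_le power_mono zero_less_power d d0 u) (use h in simp_all)
    moreover have "157 * h ^ 3 * (h * (1/2)\<^sup>2 / (5/2 * h) ^ 4) = 628 / 625"
      using h by (simp add: power_mult_distrib power_divide field_simps eval_nat_numeral)
    ultimately show ?thesis by simp
  qed
  have "hardy_window \<phi> u \<le> (\<integral>\<^sup>+z. ennreal (157 * h ^ 3) * (ennreal ((cmod (deriv (kern u \<circ> \<phi>) z))\<^sup>2 * (1 - cmod z)) * indicator (ball 0 1) z) \<partial>lborel)"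
    unfolding hardy_window_def
  proof (rule nn_integral_mono)
    fix z :: complex
    show "ennreal ((cmod (deriv \<phi> z))\<^sup>2 * (1 - cmod z)) * indicator (ball u ((1 - cmod u) / 2)) (\<phi> z) * indicator (ball 0 1) z
      \<le> ennreal (157 * h ^ 3) * (ennreal ((cmod (deriv (kern u \<circ> \<phi>) z))\<^sup>2 * (1 - cmod z)) * indicator (ball 0 1) z)"
    proof (cases "z \<in> ball 0 1 \<and> \<phi> z \<in> ball u (h / 2)")
      case True
      then have z: "cmod z < 1" and v: "\<phi> z \<in> ball u (h / 2)" by auto
      have v1: "cmod (\<phi> z) < 1" by (rule self_map_cmod_less[OF \<phi>(2) z])
      have "deriv (kern u \<circ> \<phi>) z = deriv (kern u) (\<phi> z) * deriv \<phi> z"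
      proof (rule deriv_chain)
        show "\<phi> field_differentiable at z" using \<phi>(1) z by (auto simp: holomorphic_on_open field_differentiable_def)
        show "kern u field_differentiable at (\<phi> z)" using kern_holomorphic[OF u(2)] v1 by (auto simp: holomorphic_on_open field_differentiable_def)
      qed
      then have eq: "(cmod (deriv (kern u \<circ> \<phi>) z))\<^sup>2 = (cmod (deriv (kern u) (\<phi> z)))\<^sup>2 * (cmod (deriv \<phi> z))\<^sup>2"
        by (simp add: norm_mult power_mult_distrib)
      have "1 * ((cmod (deriv \<phi> z))\<^sup>2 * (1 - cmod z)) \<le> (157 * h ^ 3 * (cmod (deriv (kern u) (\<phi> z)))\<^sup>2) * ((cmod (deriv \<phi> z))\<^sup>2 * (1 - cmod z))"
        using z by (intro mult_right_mono lower v v1) auto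
      then have "(cmod (deriv \<phi> z))\<^sup>2 * (1 - cmod z) \<le> 157 * h ^ 3 * ((cmod (deriv (kern u \<circ> \<phi>) z))\<^sup>2 * (1 - cmod z))"
        unfolding eq by (simp add: mult.assoc)
      then have "ennreal ((cmod (deriv \<phi> z))\<^sup>2 * (1 - cmod z)) \<le> ennreal (157 * h ^ 3) * ennreal ((cmod (deriv (kern u \<circ> \<phi>) z))\<^sup>2 * (1 - cmod z))"
        using h by (subst ennreal_mult'[symmetric]) (auto intro!: ennreal_leI)
      then show ?thesis using z by (auto split: split_indicator)
    qed (auto simp: h_def split: split_indicator)
  qed
  also have "\<dots> = ennreal (157 * h ^ 3) * (\<integral>\<^sup>+z\<in>ball 0 1. ennreal ((cmod (deriv (kern u \<circ> \<phi>) z))\<^sup>2 * (1 - cmod z)) \<partial>lborel)"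
  proof (rule nn_integral_cmult)
    have "(\<lambda>z. ennreal ((cmod (deriv (kern u \<circ> \<phi>) z))\<^sup>2 * (1 - cmod z)) * indicator (ball 0 1) z) \<in> borel_measurable borel"
      by (rule borel_measurable_ennreal_continuous_indicator)
         (auto intro!: continuous_intros holomorphic_on_imp_continuous_on holomorphic_deriv[OF F])
    then show "(\<lambda>z. ennreal ((cmod (deriv (kern u \<circ> \<phi>) z))\<^sup>2 * (1 - cmod z)) * indicator (ball 0 1) z) \<in> borel_measurable lborel" by simp
  qed
  also have "\<dots> \<le> ennreal (157 * h ^ 3) * (ennreal (2*pi) * hardy_norm2 (kern u \<circ> \<phi>))"
    by (intro mult_left_mono littlewood_paley_hardy F) auto
  also have "\<dots> = ennreal (157 * h ^ 3 * (2 * pi)) * hardy_norm2 (kern u \<circ> \<phi>)"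
    using h by (subst mult.assoc[symmetric], subst ennreal_mult'[symmetric]) auto
  also have "\<dots> \<le> ennreal (1000 * h ^ 3) * hardy_norm2 (kern u \<circ> \<phi>)"
  \<comment> \<open>1000 rounds \<open>157 * 2 * pi\<close> up.\<close>
  proof (intro mult_right_mono ennreal_leI)
    have "157 * h ^ 3 * (2 * pi) \<le> 157 * h ^ 3 * (2 * 3.15)"
      using h pi_approx by (intro mult_left_mono) auto
    also have "\<dots> \<le> 1000 * h ^ 3" using h by simp
    finally show "157 * h ^ 3 * (2 * pi) \<le> 1000 * h ^ 3" .
  qed auto
  finally show ?thesis by (simp add: h_def)
qed

section \<open>Compactness\<close>

lemma kern_in_H2:
  assumes u: "cmod u < 1"
  shows "kern u \<in> H2" and "H2_norm (kern u) \<le> sqrt 2" and "hardy_norm2 (kern u) \<le> 2"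
proof -
  have id: "id holomorphic_on ball 0 1" "id ` ball 0 1 \<subseteq> (ball 0 1 :: complex set)"
    by (auto simp: id_def intro: holomorphic_intros)
  show "kern u \<in> H2" using kern_compose_in_H2(1)[OF id u] by simp
  have "(H2_norm (kern u))\<^sup>2 \<le> 2" using kern_compose_in_H2(2)[OF id u] by simp
  then show "H2_norm (kern u) \<le> sqrt 2" by (rule real_le_rsqrt)
  show "hardy_norm2 (kern u) \<le> 2" using hardy_norm2_kern_compose_le[OF id u] by simp
qed

lemma one_minus_cmod_tendsto_0:
  assumes "\<And>n. 1 - inverse (real (Suc n)) < cmod (u n)" "\<And>n. cmod (u n) < 1"
  shows "(\<lambda>n. 1 - cmod (u n)) \<longlonglongrightarrow> 0"
proof (rule tendsto_sandwich[OF _ _ tendsto_const LIMSEQ_inverse_real_of_nat])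
  show "\<forall>\<^sub>F n in sequentially. 0 \<le> 1 - cmod (u n)" using assms(2) by (intro always_eventually allI) (simp add: less_imp_le)
  show "\<forall>\<^sub>F n in sequentially. 1 - cmod (u n) \<le> inverse (real (Suc n))"
    using assms(1) by (intro always_eventually allI) (smt (verit))
qed

text \<open>Otherwise there are kernels at points tending to the circle whose images stay away from
  0 in norm. These kernels are bounded in \<open>H2\<close> and tend to 0 at each point because of
  the factor \<open>sqrt (1 - |u|)\<close>, which contradicts
  \<open>compact_operator_null_sequence\<close>.\<close>

lemma hardy_compact_kern_vanishing:
  assumes \<phi>: "\<phi> holomorphic_on ball 0 1" "\<phi> ` ball 0 1 \<subseteq> ball 0 1"
    and comp: "compact_operator H2 H2_norm (comp_op \<phi>)" and \<epsilon>: "0 < \<epsilon>"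
  shows "\<exists>\<rho><1. \<forall>u. \<rho> < cmod u \<longrightarrow> cmod u < 1 \<longrightarrow> hardy_norm2 (kern u \<circ> \<phi>) \<le> ennreal \<epsilon>"
proof (rule ccontr)
  assume neg: "\<not> ?thesis"
  have "\<exists>u. 1 - inverse (real (Suc n)) < cmod u \<and> cmod u < 1 \<and> \<not> hardy_norm2 (kern u \<circ> \<phi>) \<le> ennreal \<epsilon>" for n
  proof -
    have "1 - inverse (real (Suc n)) < 1" by simp
    with neg show ?thesis by blast
  qed
  then obtain u where u: "\<And>n. 1 - inverse (real (Suc n)) < cmod (u n)" "\<And>n. cmod (u n) < 1"
      "\<And>n. \<not> hardy_norm2 (kern (u n) \<circ> \<phi>) \<le> ennreal \<epsilon>" by metis
  have h0: "(\<lambda>n. 1 - cmod (u n)) \<longlonglongrightarrow> 0" by (rule one_minus_cmod_tendsto_0[OF u(1,2)])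
  have "\<exists>r :: nat \<Rightarrow> nat. strict_mono r \<and> (\<lambda>k. H2_norm (comp_op \<phi> (kern (u (r k))))) \<longlonglongrightarrow> 0"
  proof (rule compact_operator_null_sequence[OF comp \<phi>(2) H2_diff])
    fix z :: complex assume z: "cmod z < 1"
    have "cmod (f z) \<le> sqrt (1 / (1 - (cmod z)\<^sup>2)) * H2_norm f" if "f \<in> H2" for f
    proof -
      have "cmod (f z) \<le> sqrt ((H2_norm f)\<^sup>2 / (1 - (cmod z)\<^sup>2))"
        by (rule real_le_rsqrt[OF hardy_point_bound[OF that z]])
      also have "\<dots> = sqrt (1 / (1 - (cmod z)\<^sup>2)) * H2_norm f"
        by (simp add: real_sqrt_divide H2_norm_def)
      finally show ?thesis .
    qed
    then show "\<exists>c. \<forall>f\<in>H2. cmod (f z) \<le> c * H2_norm f" by blast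
    have "(\<lambda>n. sqrt (1 - cmod (u n)) / (1 - cmod z)) \<longlonglongrightarrow> sqrt 0 / (1 - cmod z)"
      by (intro tendsto_intros h0) (use z in auto)
    then have lim: "(\<lambda>n. sqrt (1 - cmod (u n)) / (1 - cmod z)) \<longlonglongrightarrow> 0" by simp
    show "(\<lambda>n. kern (u n) z) \<longlonglongrightarrow> 0"
    proof (rule Lim_null_comparison[OF _ lim], intro always_eventually allI)
      fix n
      show "cmod (kern (u n) z) \<le> sqrt (1 - cmod (u n)) / (1 - cmod z)"
        unfolding kern_def norm_divide
        using cmod_one_minus_ge(2)[OF u(2)[of n] z] z u(2)[of n] by (intro frac_le) auto
    qed
  next
    show "kern (u n) \<in> H2" "H2_norm (kern (u n)) \<le> sqrt 2" for n by (rule kern_in_H2[OF u(2)])+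
    show "H2_norm f = H2_norm g" if "\<And>z. cmod z < 1 \<Longrightarrow> f z = g z" for f g
      using hardy_norm2_cong[OF that] by (simp add: H2_norm_def)
  qed
  then obtain r where r: "(\<lambda>k. H2_norm (comp_op \<phi> (kern (u (r k))))) \<longlonglongrightarrow> 0" by blast
  have "sqrt \<epsilon> \<le> H2_norm (comp_op \<phi> (kern (u n)))" for n
  proof -
    \<comment> \<open>\<open>enn2real\<close> sends infinity to 0, so the lower bound survives only
      because this norm is finite.\<close>
    have "hardy_norm2 (kern (u n) \<circ> \<phi>) < top"
      using hardy_norm2_kern_compose_le[OF \<phi> u(2)[of n]] by (auto intro: le_less_trans)
    then have "\<epsilon> \<le> enn2real (hardy_norm2 (kern (u n) \<circ> \<phi>))"
      using u(3)[of n] \<epsilon> by (cases "hardy_norm2 (kern (u n) \<circ> \<phi>)") (auto simp: ennreal_le_iff not_le)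
    then show ?thesis by (simp add: H2_norm_def comp_op_def)
  qed
  then have "sqrt \<epsilon> \<le> 0" by (intro LIMSEQ_le_const[OF r]) auto
  then show False using \<epsilon> by simp
qed

text \<open>The filter encodes approach to the circle uniformly in the argument; the form with a
  radius is the one that enters the estimates.\<close>

lemma filterlim_boundary_iff:
  "filterlim (g :: complex \<Rightarrow> real) at_top (filtercomap cmod (at_left 1))
    \<longleftrightarrow> (\<forall>M. \<exists>\<rho><1. \<forall>z. \<rho> < cmod z \<longrightarrow> cmod z < 1 \<longrightarrow> M \<le> g z)"
proof -
  have "eventually (\<lambda>z. M \<le> g z) (filtercomap cmod (at_left 1))
    \<longleftrightarrow> (\<exists>\<rho><1. \<forall>z. \<rho> < cmod z \<longrightarrow> cmod z < 1 \<longrightarrow> M \<le> g z)" (is "?L \<longleftrightarrow> ?R") for M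
  proof
    assume ?L
    then obtain Q where Q: "eventually Q (at_left 1)" "\<And>z. Q (cmod z) \<Longrightarrow> M \<le> g z"
      unfolding eventually_filtercomap by blast
    obtain b where "b < 1" "\<And>y. b < y \<Longrightarrow> y < 1 \<Longrightarrow> Q y"
      using Q(1) unfolding eventually_at_left_field by blast
    then show ?R using Q(2) by (intro exI[of _ b]) simp
  next
    assume ?R
    then obtain b where "b < 1" "\<And>z. b < cmod z \<Longrightarrow> cmod z < 1 \<Longrightarrow> M \<le> g z" by blast
    then show ?L unfolding eventually_filtercomap eventually_at_left_field
      by (intro exI[of _ "\<lambda>y. b < y \<and> y < 1"]) auto
  qed
  then show ?thesis unfolding filterlim_at_top by simp
qed

section \<open>Comparison with the Hardy weight, and part (i)\<close>

context weight
begin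

text \<open>The weights are compared pointwise on the preimage of a single window, so
  \<open>c\<close> may depend on \<open>u\<close>.\<close>

lemma window_le_hardy_window:
  assumes \<phi>: "\<phi> holomorphic_on ball 0 1" and c: "0 \<le> c"
    and le: "\<And>z. cmod z < 1 \<Longrightarrow> \<phi> z \<in> ball u ((1 - cmod u) / 2) \<Longrightarrow> \<omega> (cmod z) \<le> c * (1 - cmod z)"
  shows "window \<phi> u \<le> ennreal c * hardy_window \<phi> u"
proof -
  have "window \<phi> u \<le> (\<integral>\<^sup>+z. ennreal c * (ennreal ((cmod (deriv \<phi> z))\<^sup>2 * (1 - cmod z)) * indicator (ball u ((1 - cmod u) / 2)) (\<phi> z) * indicator (ball 0 1) z) \<partial>lborel)"
    unfolding window_def
  proof (rule nn_integral_mono)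
    fix z :: complex
    show "ennreal ((cmod (deriv \<phi> z))\<^sup>2) * V (cmod z) * indicator (ball u ((1 - cmod u) / 2)) (\<phi> z) * indicator (ball 0 1) z
      \<le> ennreal c * (ennreal ((cmod (deriv \<phi> z))\<^sup>2 * (1 - cmod z)) * indicator (ball u ((1 - cmod u) / 2)) (\<phi> z) * indicator (ball 0 1) z)"
    proof (cases "z \<in> ball 0 1 \<and> \<phi> z \<in> ball u ((1 - cmod u) / 2)")
      case True
      then have "(cmod (deriv \<phi> z))\<^sup>2 * \<omega> (cmod z) \<le> (cmod (deriv \<phi> z))\<^sup>2 * (c * (1 - cmod z))"
        by (intro mult_left_mono le) auto
      then have "ennreal ((cmod (deriv \<phi> z))\<^sup>2 * \<omega> (cmod z)) \<le> ennreal (c * ((cmod (deriv \<phi> z))\<^sup>2 * (1 - cmod z)))"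
        by (intro ennreal_leI) (simp add: mult_ac)
      then show ?thesis using True c by (simp add: V_def ennreal_mult')
    qed (auto split: split_indicator)
  qed
  also have "\<dots> = ennreal c * hardy_window \<phi> u"
    unfolding hardy_window_def
  proof (rule nn_integral_cmult)
    let ?S = "ball 0 1 \<inter> \<phi> -` ball u ((1 - cmod u) / 2)"
    have S: "open ?S"
      by (rule continuous_open_preimage[OF holomorphic_on_imp_continuous_on[OF \<phi>]]) auto
    have "continuous_on ?S (\<lambda>z. (cmod (deriv \<phi> z))\<^sup>2 * (1 - cmod z))"
      by (intro continuous_intros continuous_on_subset[OF holomorphic_on_imp_continuous_on[OF holomorphic_deriv[OF \<phi>]]]) auto
    then have "(\<lambda>z. ennreal ((cmod (deriv \<phi> z))\<^sup>2 * (1 - cmod z)) * indicator ?S z) \<in> borel_measurable borel"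
      by (rule borel_measurable_ennreal_continuous_indicator) (use S in simp)
    also have "(\<lambda>z. ennreal ((cmod (deriv \<phi> z))\<^sup>2 * (1 - cmod z)) * indicator ?S z)
       = (\<lambda>z. ennreal ((cmod (deriv \<phi> z))\<^sup>2 * (1 - cmod z)) * indicator (ball u ((1 - cmod u) / 2)) (\<phi> z) * indicator (ball 0 1) z)"
      by (auto simp: fun_eq_iff split: split_indicator)
    finally show "(\<lambda>z. ennreal ((cmod (deriv \<phi> z))\<^sup>2 * (1 - cmod z)) * indicator (ball u ((1 - cmod u) / 2)) (\<phi> z) * indicator (ball 0 1) z) \<in> borel_measurable lborel"
      by simp
  qed
  finally show ?thesis .
qed

end

text \<open>The window has radius half of \<open>1 - |u|\<close>, which gives the
  \<open>3/2\<close>; \<open>self_map_boundary_distance\<close> carries this over to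
  \<open>z\<close>, and 12 is \<open>8 * 3/2\<close>.\<close>

lemma preimage_window_boundary_distance:
  assumes \<phi>: "\<phi> holomorphic_on ball 0 1" "\<phi> ` ball 0 1 \<subseteq> ball 0 1" and z: "cmod z < 1"
    and w: "\<phi> z \<in> ball u ((1 - cmod u) / 2)"
  shows "1 - cmod (\<phi> z) \<le> 3/2 * (1 - cmod u)" and "1 - cmod z \<le> 12 / (1 - cmod (\<phi> 0)) * (1 - cmod u)"
proof -
  have "cmod u \<le> cmod (\<phi> z) + cmod (u - \<phi> z)" using norm_triangle_ineq[of "\<phi> z" "u - \<phi> z"] by simp
  then show 1: "1 - cmod (\<phi> z) \<le> 3/2 * (1 - cmod u)" using w by (simp add: dist_norm field_simps)
  have p0: "0 < 1 - cmod (\<phi> 0)" using self_map_cmod_less[OF \<phi>(2), of 0] by simp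
  have "1 - cmod z \<le> 8 / (1 - cmod (\<phi> 0)) * (1 - cmod (\<phi> z))" by (rule self_map_boundary_distance[OF \<phi> z])
  also have "\<dots> \<le> 8 / (1 - cmod (\<phi> 0)) * (3/2 * (1 - cmod u))" using 1 p0 by (intro mult_left_mono) auto
  also have "\<dots> = 12 / (1 - cmod (\<phi> 0)) * (1 - cmod u)"
  proof -
    have "8 / P * (3/2 * x) = 12 / P * x" for P x :: real by simp
    then show ?thesis .
  qed
  finally show "1 - cmod z \<le> 12 / (1 - cmod (\<phi> 0)) * (1 - cmod u)" .
qed

context weight
begin

lemma compact_operator_if_hardy_compact:
  assumes \<phi>: "\<phi> holomorphic_on ball 0 1" "\<phi> ` ball 0 1 \<subseteq> ball 0 1"
    and comp: "compact_operator H2 H2_norm (comp_op \<phi>)"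
  shows "compact_operator (A2 \<sigma>) (A2_norm \<sigma>) (comp_op \<phi>)"
proof (rule compact_operator_if_window_vanishing[OF \<phi>], intro allI impI)
  fix \<epsilon> :: real assume \<epsilon>: "0 < \<epsilon>"
  define C where "C = 12 / (1 - cmod (\<phi> 0))"
  have p0: "0 < 1 - cmod (\<phi> 0)" using self_map_cmod_less[OF \<phi>(2), of 0] by simp
  then have C: "1 \<le> C" by (simp add: C_def field_simps)
  \<comment> \<open>Cancels the 1000 of \<open>hardy_window_le\<close> and the doubling loss
    \<open>C ^ m\<close>.\<close>
  define \<eta> where "\<eta> = \<epsilon> / (1000 * C ^ m)"
  have \<eta>: "0 < \<eta>" using \<epsilon> C by (simp add: \<eta>_def)
  obtain \<rho>1 where \<rho>1: "\<rho>1 < 1" "\<And>u. \<rho>1 < cmod u \<Longrightarrow> cmod u < 1 \<Longrightarrow> hardy_norm2 (kern u \<circ> \<phi>) \<le> ennreal \<eta>"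
    using hardy_compact_kern_vanishing[OF \<phi> comp \<eta>] by blast
  \<comment> \<open>\<open>1/2\<close> is required by \<open>hardy_window_le\<close>, and
    \<open>1 - 1 / C\<close> keeps \<open>1 - C * h\<close> positive.\<close>
  define \<rho> where "\<rho> = max \<rho>1 (max (1/2) (1 - 1 / C))"
  have "window \<phi> u \<le> ennreal (\<epsilon> * ((1 - cmod u)\<^sup>2 * \<omega> (cmod u)))" if u: "\<rho> < cmod u" "cmod u < 1" for u
  proof -
    define h where "h = 1 - cmod u"
    have h: "0 < h" "C * h < 1" using u C by (auto simp: h_def \<rho>_def field_simps)
    then have h': "h \<le> C * h" using mult_right_mono[OF C, of h] by simp
    have wu: "0 < \<omega> (cmod u)" using u by (intro pos_\<omega>) auto
    have "window \<phi> u \<le> ennreal (C ^ m * \<omega> (cmod u) / h) * hardy_window \<phi> u"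
    proof (rule window_le_hardy_window[OF \<phi>(1)])
      fix z assume z: "cmod z < 1" and v: "\<phi> z \<in> ball u ((1 - cmod u) / 2)"
      \<comment> \<open>A radius below both \<open>|z|\<close> and \<open>|u|\<close>: the ratio
        property compares \<open>|z|\<close> with \<open>r0\<close>, the doubling property compares
        \<open>r0\<close> with \<open>|u|\<close>.\<close>
      define r0 where "r0 = 1 - C * h"
      have r0: "0 \<le> r0" "r0 \<le> cmod z" "r0 \<le> cmod u"
        using h h' preimage_window_boundary_distance(2)[OF \<phi> z v] by (auto simp: r0_def C_def h_def)
      have 1: "\<omega> (cmod z) * (C * h) \<le> \<omega> r0 * (1 - cmod z)" using \<omega>_ratio[OF r0(1,2) z] by (simp add: r0_def)
      have "\<omega> r0 * h ^ m \<le> \<omega> (cmod u) * (C * h) ^ m" using doubling[OF r0(1,3) u(2)] by (simp add: r0_def h_def)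
      then have 2: "\<omega> r0 \<le> \<omega> (cmod u) * C ^ m" using h by (simp add: power_mult_distrib)
      have "\<omega> (cmod z) * h \<le> \<omega> (cmod z) * (C * h)" using h' pos_\<omega>[of "cmod z"] z by (intro mult_left_mono) auto
      also note 1
      also have "\<omega> r0 * (1 - cmod z) \<le> \<omega> (cmod u) * C ^ m * (1 - cmod z)" using 2 z by (intro mult_right_mono) auto
      finally show "\<omega> (cmod z) \<le> C ^ m * \<omega> (cmod u) / h * (1 - cmod z)" using h by (simp add: field_simps)
    qed (use C wu h in simp)
    also have "\<dots> \<le> ennreal (C ^ m * \<omega> (cmod u) / h) * (ennreal (1000 * h ^ 3) * ennreal \<eta>)"
    proof (rule mult_left_mono)
      have "hardy_window \<phi> u \<le> ennreal (1000 * h ^ 3) * hardy_norm2 (kern u \<circ> \<phi>)"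
        unfolding h_def by (rule hardy_window_le[OF \<phi>]) (use u in \<open>auto simp: \<rho>_def\<close>)
      also have "\<dots> \<le> ennreal (1000 * h ^ 3) * ennreal \<eta>"
        by (intro mult_left_mono \<rho>1) (use u in \<open>auto simp: \<rho>_def\<close>)
      finally show "hardy_window \<phi> u \<le> ennreal (1000 * h ^ 3) * ennreal \<eta>" .
    qed simp
    also have "\<dots> = ennreal (C ^ m * \<omega> (cmod u) / h * (1000 * h ^ 3 * \<eta>))"
      using C wu h by (subst ennreal_mult'[symmetric], simp, subst ennreal_mult'[symmetric]) auto
    also have "C ^ m * \<omega> (cmod u) / h * (1000 * h ^ 3 * \<eta>) = \<epsilon> * (h\<^sup>2 * \<omega> (cmod u))"
      using C h by (simp add: \<eta>_def field_simps eval_nat_numeral)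
    finally show ?thesis by (simp add: h_def)
  qed
  moreover have "\<rho> < 1" using \<rho>1 C by (simp add: \<rho>_def)
  ultimately show "\<exists>\<rho><1. \<forall>u. \<rho> < cmod u \<longrightarrow> cmod u < 1 \<longrightarrow> window \<phi> u \<le> ennreal (\<epsilon> * ((1 - cmod u)\<^sup>2 * \<omega> (cmod u)))"
    by blast
qed

text \<open>The \<open>m\<close>-th power of the Szego kernel, normalised so that its squared
  modulus at \<open>u\<close> is comparable to \<open>1 / \<omega> |u|\<close>, the largest order
  that \<open>point_bound\<close> permits for bounded norm.\<close>

definition peak :: "complex \<Rightarrow> complex \<Rightarrow> complex" where
  "peak u v = of_real ((1 - cmod u) ^ m / sqrt (\<omega> (cmod u))) / (1 - cnj u * v) ^ m"

lemma peak_holomorphic: "cmod u < 1 \<Longrightarrow> peak u holomorphic_on ball 0 1"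
  unfolding peak_def[abs_def] using cmod_one_minus_ge(3)[of u]
  by (auto intro!: holomorphic_intros)

lemma cmod_peak:
  assumes "cmod u < 1"
  shows "(cmod (peak u v))\<^sup>2 = (1 - cmod u) ^ (2*m) / \<omega> (cmod u) / cmod (1 - cnj u * v) ^ (2*m)"
proof -
  let ?c = "(1 - cmod u) ^ m / sqrt (\<omega> (cmod u))"
  have w: "0 < \<omega> (cmod u)" using assms by (intro pos_\<omega>) auto
  have "0 \<le> ?c" using assms w by simp
  then have "cmod (peak u v) = ?c / cmod (1 - cnj u * v) ^ m"
    by (simp only: peak_def norm_divide norm_of_real norm_power abs_of_nonneg)
  then show ?thesis using w by (simp add: power_divide power_mult_distrib power_even_eq)
qed

lemma cmod_peak_deriv:
  assumes u: "cmod u < 1" and v: "cmod v < 1"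
  shows "(cmod (deriv (peak u) v))\<^sup>2 = (1 - cmod u) ^ (2*m) / \<omega> (cmod u) * ((real m)\<^sup>2 * (cmod u)\<^sup>2 / cmod (1 - cnj u * v) ^ (2*m+2))"
proof -
  let ?c = "(1 - cmod u) ^ m / sqrt (\<omega> (cmod u))" and ?d = "1 - cnj u * v"
  have nz: "?d \<noteq> 0" by (rule cmod_one_minus_ge(3)[OF u v])
  have "((\<lambda>v. 1 - cnj u * v) has_field_derivative - cnj u) (at v)"
    by (auto intro!: derivative_eq_intros)
  from DERIV_power[OF this, of m]
  have "((\<lambda>v. (1 - cnj u * v) ^ m) has_field_derivative of_nat m * (- cnj u * ?d ^ (m - Suc 0))) (at v)" .
  from DERIV_cmult[OF DERIV_inverse_fun[OF this], of "of_real ?c"] nz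
  have "(peak u has_field_derivative of_real ?c * - (of_nat m * (- cnj u * ?d ^ (m - Suc 0)) * inverse ((?d ^ m) ^ Suc (Suc 0)))) (at v)"
    by (simp add: peak_def[abs_def] divide_inverse)
  also have "- (of_nat m * (- cnj u * ?d ^ (m - Suc 0)) * inverse ((?d ^ m) ^ Suc (Suc 0))) = of_nat m * cnj u / ?d ^ (m + 1)"
  proof -
    \<comment> \<open>\<open>m - Suc 0\<close> is truncated subtraction; positivity of
      \<open>m\<close> makes it the true exponent.\<close>
    obtain k where k: "m = Suc k" using m_pos by (cases m) auto
    define x where "x = ?d ^ k"
    have "x \<noteq> 0" using nz by (simp add: x_def)
    then show ?thesis using nz unfolding k by (simp add: x_def[symmetric] divide_simps)
  qed
  finally have "(peak u has_field_derivative (of_real ?c * (of_nat m * cnj u / ?d ^ (m + 1)))) (at v)" .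
  then have "deriv (peak u) v = of_real ?c * (of_nat m * cnj u / ?d ^ (m + 1))" by (rule DERIV_imp_deriv)
  then have "cmod (deriv (peak u) v) = ?c * (real m * cmod u / cmod ?d ^ (m + 1))"
    using u pos_\<omega>[of "cmod u"] by (simp only: norm_mult norm_divide norm_power norm_of_real norm_of_nat complex_mod_cnj) simp
  then show ?thesis
    using u pos_\<omega>[of "cmod u"] by (simp add: power_mult_distrib power_divide power_mult[symmetric] algebra_simps) (simp add: power2_eq_square)
qed

text \<open>If \<open>|u| \<le> |v|\<close>, one factor is moved by \<open>\<omega>_ratio\<close>;
  otherwise \<open>doubling\<close> moves all \<open>m\<close> of them. In both cases the other
  \<open>m - 1\<close> factors, \<open>1 - |u|\<close> or \<open>1 - |v|\<close>, are dominated by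
  \<open>|1 - cnj u * v|\<close>.\<close>

lemma \<omega>_kernel_bound:
  assumes u: "cmod u < 1" and v: "cmod v < 1"
  shows "\<omega> (cmod v) * (1 - cmod u) ^ m \<le> \<omega> (cmod u) * (1 - cmod v) * cmod (1 - cnj u * v) ^ (m - 1)"
proof -
  define A where "A = cmod (1 - cnj u * v)"
  note A = cmod_one_minus_ge(1,2)[OF u v, folded A_def]
  have pm: "x ^ m = x * x ^ (m - 1)" for x :: real using m_pos by (cases m) auto
  have wu: "0 < \<omega> (cmod u)" using u by (intro pos_\<omega>) auto
  show ?thesis
  proof (cases "cmod u \<le> cmod v")
    case True
    have "\<omega> (cmod v) * (1 - cmod u) ^ m = (\<omega> (cmod v) * (1 - cmod u)) * (1 - cmod u) ^ (m - 1)"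
      by (simp add: pm)
    also have "\<dots> \<le> (\<omega> (cmod u) * (1 - cmod v)) * A ^ (m - 1)"
      by (rule mult_mono[OF \<omega>_ratio power_mono[OF A(1)]]) (use True u v wu in auto)
    finally show ?thesis by (simp add: A_def)
  next
    case False
    have "\<omega> (cmod v) * (1 - cmod u) ^ m \<le> \<omega> (cmod u) * (1 - cmod v) ^ m"
      using doubling[of "cmod v" "cmod u"] False u by simp
    also have "\<dots> = (\<omega> (cmod u) * (1 - cmod v)) * (1 - cmod v) ^ (m - 1)" by (simp add: pm)
    also have "\<dots> \<le> (\<omega> (cmod u) * (1 - cmod v)) * A ^ (m - 1)"
      using v A wu by (intro mult_left_mono power_mono) auto
    finally show ?thesis by (simp add: A_def)
  qed
qed

text \<open>With \<open>h = 1 - |u|\<close> and \<open>A = |1 - cnj u * v|\<close>, half of the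
  factor \<open>h ^ (2*m)\<close> is spent on \<open>\<omega>_kernel_bound\<close> and the other
  half is at most \<open>h * A ^ (m - 1)\<close>. What remains,
  \<open>h * |u|^2 * (1 - |v|) / A ^ 4\<close>, is the Hardy integrand of the kernel.\<close>

lemma peak_deriv_le_kern_deriv:
  assumes u: "cmod u < 1" and v: "cmod v < 1"
  shows "(cmod (deriv (peak u) v))\<^sup>2 * \<omega> (cmod v) \<le> (real m)\<^sup>2 * ((cmod (deriv (kern u) v))\<^sup>2 * (1 - cmod v))"
proof -
  define A where "A = cmod (1 - cnj u * v)"
  define h where "h = 1 - cmod u"
  define q where "q = (real m)\<^sup>2 * (cmod u)\<^sup>2"
  have h: "0 < h" using u by (simp add: h_def)
  have A: "h \<le> A" using cmod_one_minus_ge(1)[OF u v] by (simp add: A_def h_def)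
  then have A0: "0 < A" using h by linarith
  have wu: "0 < \<omega> (cmod u)" using u by (intro pos_\<omega>) auto
  have pm: "x ^ m = x * x ^ (m - 1)" for x :: real using m_pos by (cases m) auto
  have "h ^ m \<le> h * A ^ (m - 1)" unfolding pm using h A by (intro mult_left_mono power_mono) auto
  have "(cmod (deriv (peak u) v))\<^sup>2 * \<omega> (cmod v) = (h ^ m * q) / (\<omega> (cmod u) * A ^ (2*m+2)) * (\<omega> (cmod v) * h ^ m)"
    unfolding cmod_peak_deriv[OF u v] A_def[symmetric] h_def[symmetric] q_def
    by (simp add: mult_2 power_add)
  also have "\<dots> \<le> (h ^ m * q) / (\<omega> (cmod u) * A ^ (2*m+2)) * (\<omega> (cmod u) * (1 - cmod v) * A ^ (m - 1))"
    using \<omega>_kernel_bound[OF u v, folded A_def h_def] h wu A0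
    by (intro mult_left_mono) (auto simp: q_def)
  also have "\<dots> = h ^ m * (q * (1 - cmod v) * A ^ (m - 1) / A ^ (2*m+2))"
    using wu by simp
  also have "\<dots> \<le> (h * A ^ (m - 1)) * (q * (1 - cmod v) * A ^ (m - 1) / A ^ (2*m+2))"
    using \<open>h ^ m \<le> h * A ^ (m - 1)\<close> v A0 by (intro mult_right_mono) (auto simp: q_def)
  also have "\<dots> = h * q * (1 - cmod v) / A ^ 4"
  proof -
    have "A ^ (2*m+2) = A ^ (m - 1) * A ^ (m - 1) * A ^ 4"
      using m_pos by (simp flip: power_add)
    then show ?thesis using A0 by simp
  qed
  also have "\<dots> = (real m)\<^sup>2 * ((cmod (deriv (kern u) v))\<^sup>2 * (1 - cmod v))"
    using u by (simp add: deriv_kern[OF u v] norm_divide norm_mult power_divide power_mult_distrib norm_power h_def q_def A_def flip: power_mult)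
  finally show ?thesis .
qed

text \<open>\<open>doubling\<close> from radius 0 gives
  \<open>\<omega> 0 * (1 - r) ^ m \<le> \<omega> r\<close>, and the spare power
  \<open>(1 - r) ^ m\<close> is at most \<open>1 - r\<close>. The left side is the squared modulus
  of a peak at the origin; its decay makes the peaks tend to 0 pointwise.\<close>

lemma height_le: "0 \<le> r \<Longrightarrow> r < 1 \<Longrightarrow> (1 - r) ^ (2*m) / \<omega> r \<le> (1 - r) / \<omega> 0"
proof -
  assume r: "0 \<le> r" "r < 1"
  have w: "0 < \<omega> 0" "0 < \<omega> r" using r by (auto intro: pos_\<omega>)
  have "\<omega> 0 * (1 - r) ^ m \<le> \<omega> r" using doubling[of 0 r] r by simp
  then have "(\<omega> 0 * (1 - r) ^ m) * (1 - r) ^ m \<le> \<omega> r * (1 - r) ^ 1"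
    using r m_pos w by (intro mult_mono power_decreasing) auto
  then have "\<omega> 0 * (1 - r) ^ (2*m) \<le> \<omega> r * (1 - r)"
    by (simp add: mult_2 power_add mult.assoc)
  then show ?thesis using w by (simp add: divide_le_eq pos_le_divide_eq mult.commute)
qed

text \<open>The value at 0 contributes \<open>mass / \<omega> 0\<close>. The derivative part is at
  most \<open>m^2\<close> times the Hardy integral of the kernel, hence at most
  \<open>4 * pi * m^2\<close>; the 6 of \<open>littlewood_paley_ge\<close> and the division by
  \<open>pi\<close> leave 24.\<close>

lemma peak_in_A2:
  assumes u: "cmod u < 1"
  shows "peak u \<in> A2 \<sigma>"
    and "(A2_norm \<sigma> (peak u))\<^sup>2 \<le> enn2real mass / \<omega> 0 + 24 * (real m)\<^sup>2"
proof -
  define M where "M = enn2real mass"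
  have M: "mass = ennreal M" "0 \<le> M" using mass_finite by (auto simp: M_def)
  have w0: "0 < \<omega> 0" by (intro pos_\<omega>) auto
  have hol: "peak u holomorphic_on ball 0 1" by (rule peak_holomorphic[OF u])
  have p0: "(cmod (peak u 0))\<^sup>2 \<le> 1 / \<omega> 0"
  proof -
    have "(cmod (peak u 0))\<^sup>2 \<le> (1 - cmod u) / \<omega> 0" using height_le[of "cmod u"] u by (simp add: cmod_peak[OF u])
    also have "\<dots> \<le> 1 / \<omega> 0" using w0 by (intro divide_right_mono) auto
    finally show ?thesis .
  qed
  have km: "(\<lambda>z. ennreal ((cmod (deriv (kern u) z))\<^sup>2 * (1 - cmod z)) * indicator (ball 0 1) z) \<in> borel_measurable borel"
    by (rule borel_measurable_ennreal_continuous_indicator)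
       (auto intro!: continuous_intros holomorphic_on_imp_continuous_on holomorphic_deriv[OF kern_holomorphic[OF u]])
  have "D2 (deriv (peak u)) \<le> (\<integral>\<^sup>+v. ennreal ((real m)\<^sup>2) * (ennreal ((cmod (deriv (kern u) v))\<^sup>2 * (1 - cmod v)) * indicator (ball 0 1) v) \<partial>lborel)"
    unfolding D2_def
  proof (rule nn_integral_mono)
    fix v :: complex
    show "ennreal ((cmod (deriv (peak u) v))\<^sup>2) * V (cmod v) * indicator (ball 0 1) v \<le> ennreal ((real m)\<^sup>2) * (ennreal ((cmod (deriv (kern u) v))\<^sup>2 * (1 - cmod v)) * indicator (ball 0 1) v)"
    proof (cases "v \<in> ball 0 1")
      case True
      then show ?thesis using ennreal_leI[OF peak_deriv_le_kern_deriv[OF u, of v]]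
        by (simp add: V_def ennreal_mult')
    qed simp
  qed
  also have "\<dots> = ennreal ((real m)\<^sup>2) * (\<integral>\<^sup>+v\<in>ball 0 1. ennreal ((cmod (deriv (kern u) v))\<^sup>2 * (1 - cmod v)) \<partial>lborel)"
    by (rule nn_integral_cmult) (use km in simp)
  also have "\<dots> \<le> ennreal ((real m)\<^sup>2) * (ennreal (2*pi) * ennreal 2)"
    using kern_in_H2(3)[OF u]
    by (intro mult_left_mono order_trans[OF littlewood_paley_hardy[OF kern_holomorphic[OF u]]]) auto
  also have "\<dots> = ennreal (4 * pi * (real m)\<^sup>2)"
    by (subst ennreal_mult'[symmetric], simp, subst ennreal_mult'[symmetric]) (auto simp: mult_ac)
  finally have D: "D2 (deriv (peak u)) \<le> ennreal (4 * pi * (real m)\<^sup>2)" .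
  have "N2 (peak u) \<le> ennreal ((cmod (peak u 0))\<^sup>2) * mass + 6 * D2 (deriv (peak u))"
    by (rule littlewood_paley_ge[OF hol])
  also have "\<dots> \<le> ennreal (1 / \<omega> 0) * ennreal M + ennreal 6 * ennreal (4 * pi * (real m)\<^sup>2)"
    unfolding M(1) using D by (intro add_mono mult_mono ennreal_leI p0) auto
  also have "\<dots> = ennreal (M / \<omega> 0 + 24 * pi * (real m)\<^sup>2)"
    using w0 M(2) by (subst (1 2) ennreal_mult'[symmetric]) (auto simp: ennreal_plus[symmetric] mult_ac simp del: ennreal_plus)
  finally have N: "N2 (peak u) \<le> ennreal (M / \<omega> 0 + 24 * pi * (real m)\<^sup>2)" .
  then show mem: "peak u \<in> A2 \<sigma>" using hol by (auto simp: A2_iff intro: le_less_trans)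
  have "pi * (A2_norm \<sigma> (peak u))\<^sup>2 \<le> M / \<omega> 0 + 24 * pi * (real m)\<^sup>2"
    using N w0 M(2) unfolding N2_eq_norm[OF mem] by (subst (asm) ennreal_le_iff) (auto intro!: add_nonneg_nonneg)
  also have "\<dots> \<le> pi * (M / \<omega> 0) + 24 * pi * (real m)\<^sup>2"
  proof -
    have "1 * (M / \<omega> 0) \<le> pi * (M / \<omega> 0)" using pi_ge_two w0 M(2) by (intro mult_right_mono) auto
    then show ?thesis by simp
  qed
  also have "\<dots> = pi * (M / \<omega> 0 + 24 * (real m)\<^sup>2)" by (simp add: algebra_simps)
  finally show "(A2_norm \<sigma> (peak u))\<^sup>2 \<le> enn2real mass / \<omega> 0 + 24 * (real m)\<^sup>2"
    by (simp add: M_def)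
qed

text \<open>If the quotient stays bounded along \<open>z n\<close>, the peaks at
  \<open>u n = \<phi> (z n)\<close> are a bounded null sequence, so some of their images tend to 0
  in norm. But at \<open>z n\<close> the image takes the value of the peak at its own centre, and
  \<open>point_bound\<close> keeps the norm away from 0 because
  \<open>\<omega> |u n| \<le> M ^ m * \<omega> |z n|\<close>.\<close>

lemma angular_limit_if_compact_operator:
  assumes \<phi>: "\<phi> holomorphic_on ball 0 1" "\<phi> ` ball 0 1 \<subseteq> ball 0 1"
    and comp: "compact_operator (A2 \<sigma>) (A2_norm \<sigma>) (comp_op \<phi>)"
  shows "filterlim (\<lambda>z. (1 - cmod (\<phi> z)) / (1 - cmod z)) at_top (filtercomap cmod (at_left 1))"
  unfolding filterlim_boundary_iff
proof (rule ccontr)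
  assume "\<not> (\<forall>M. \<exists>\<rho><1. \<forall>z. \<rho> < cmod z \<longrightarrow> cmod z < 1 \<longrightarrow> M \<le> (1 - cmod (\<phi> z)) / (1 - cmod z))"
  then obtain M0 where M0: "\<And>\<rho>. \<rho> < 1 \<Longrightarrow> \<exists>z. \<rho> < cmod z \<and> cmod z < 1 \<and> (1 - cmod (\<phi> z)) / (1 - cmod z) < M0"
    by (metis not_le)
  \<comment> \<open>Raising the bound to at least 1 serves the case where \<open>u n\<close> is
    closer to the circle than \<open>z n\<close>.\<close>
  define M where "M = max 1 M0"
  have M: "1 \<le> M" by (simp add: M_def)
  have "\<exists>z. 1 - inverse (real (Suc n)) < cmod z \<and> cmod z < 1 \<and> (1 - cmod (\<phi> z)) / (1 - cmod z) < M0" for n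
    by (rule M0) simp
  then obtain z where z: "\<And>n. 1 - inverse (real (Suc n)) < cmod (z n)" "\<And>n. cmod (z n) < 1"
      "\<And>n. (1 - cmod (\<phi> (z n))) / (1 - cmod (z n)) < M0" by metis
  have z3: "1 - cmod (\<phi> (z n)) \<le> M * (1 - cmod (z n))" for n
  proof -
    have "(1 - cmod (\<phi> (z n))) / (1 - cmod (z n)) \<le> M" using z(3)[of n] by (simp add: M_def)
    then show ?thesis using z(2)[of n] by (simp add: divide_le_eq)
  qed
  define u where "u n = \<phi> (z n)" for n
  have u: "cmod (u n) < 1" for n unfolding u_def by (rule self_map_cmod_less[OF \<phi>(2) z(2)])
  have "(\<lambda>n. M * (1 - cmod (z n))) \<longlonglongrightarrow> M * 0"
    by (intro tendsto_mult tendsto_const one_minus_cmod_tendsto_0[OF z(1,2)])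
  then have lim0: "(\<lambda>n. M * (1 - cmod (z n))) \<longlonglongrightarrow> 0" by simp
  have bound: "norm (1 - cmod (u n)) \<le> M * (1 - cmod (z n))" for n
    using z3[of n] u[of n] by (simp add: u_def)
  have h0: "(\<lambda>n. 1 - cmod (u n)) \<longlonglongrightarrow> 0"
    by (rule Lim_null_comparison[OF _ lim0], intro always_eventually allI bound)
  define B where "B = enn2real mass / \<omega> 0 + 24 * (real m)\<^sup>2"
  have "\<exists>r :: nat \<Rightarrow> nat. strict_mono r \<and> (\<lambda>k. A2_norm \<sigma> (comp_op \<phi> (peak (u (r k))))) \<longlonglongrightarrow> 0"
  proof (rule compact_operator_null_sequence[OF comp \<phi>(2) A2_diff])
    show "peak (u n) \<in> A2 \<sigma>" for n by (rule peak_in_A2(1)[OF u])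
    show "A2_norm \<sigma> (peak (u n)) \<le> sqrt B" for n
      using peak_in_A2(2)[OF u[of n], folded B_def] by (rule real_le_rsqrt)
    show "A2_norm \<sigma> f = A2_norm \<sigma> g" if "\<And>z. cmod z < 1 \<Longrightarrow> f z = g z" for f g
      using N2_cong[OF that] by (simp add: A2_norm_def bergman_norm2_eq)
    fix v :: complex assume v: "cmod v < 1"
    have wv: "0 < \<omega> (cmod v)" using v by (intro pos_\<omega>) auto
    have "cmod (f v) \<le> sqrt (2 ^ m / \<omega> (cmod v)) * A2_norm \<sigma> f" if "f \<in> A2 \<sigma>" for f
    proof -
      have "(cmod (f v))\<^sup>2 \<le> 2 ^ m / \<omega> (cmod v) * (A2_norm \<sigma> f)\<^sup>2"
        using point_bound[OF that v] wv by (simp add: field_simps)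
      then have "cmod (f v) \<le> sqrt (2 ^ m / \<omega> (cmod v) * (A2_norm \<sigma> f)\<^sup>2)" by (rule real_le_rsqrt)
      also have "\<dots> = sqrt (2 ^ m / \<omega> (cmod v)) * A2_norm \<sigma> f"
        by (subst real_sqrt_mult) (simp add: A2_norm_def)
      finally show ?thesis .
    qed
    then show "\<exists>c. \<forall>f\<in>A2 \<sigma>. cmod (f v) \<le> c * A2_norm \<sigma> f" by blast
    have w0: "0 < \<omega> 0" by (intro pos_\<omega>) auto
    have le: "(cmod (peak (u n) v))\<^sup>2 \<le> (1 - cmod (u n)) / \<omega> 0 / (1 - cmod v) ^ (2*m)" for n
      unfolding cmod_peak[OF u]
      by (rule frac_le[OF _ height_le _ power_mono[OF cmod_one_minus_ge(2)[OF u v]]])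
         (use u[of n] v w0 in auto)
    have "(\<lambda>n. (1 - cmod (u n)) / \<omega> 0 / (1 - cmod v) ^ (2*m)) \<longlonglongrightarrow> 0 / \<omega> 0 / (1 - cmod v) ^ (2*m)"
      by (intro tendsto_intros h0) (use v w0 in auto)
    then have "(\<lambda>n. (1 - cmod (u n)) / \<omega> 0 / (1 - cmod v) ^ (2*m)) \<longlonglongrightarrow> 0" by simp
    then have "(\<lambda>n. (cmod (peak (u n) v))\<^sup>2) \<longlonglongrightarrow> 0"
      by (rule Lim_null_comparison[rotated]) (use le in \<open>auto intro!: always_eventually\<close>)
    then have "(\<lambda>n. sqrt ((cmod (peak (u n) v))\<^sup>2)) \<longlonglongrightarrow> sqrt 0" by (rule tendsto_real_sqrt)
    then show "(\<lambda>n. peak (u n) v) \<longlonglongrightarrow> 0" by (simp add: tendsto_norm_zero_iff)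
  qed
  then obtain r where r: "(\<lambda>k. A2_norm \<sigma> (comp_op \<phi> (peak (u (r k))))) \<longlonglongrightarrow> 0" by blast
  have lower: "1 / (4 * M) ^ m \<le> 2 ^ m * (A2_norm \<sigma> (comp_op \<phi> (peak (u n))))\<^sup>2" for n
  proof -
    define h where "h = 1 - cmod (u n)"
    have h: "0 < h" using u[of n] by (simp add: h_def)
    have w: "0 < \<omega> (cmod (u n))" "0 < \<omega> (cmod (z n))" using u[of n] z(2)[of n] by (auto intro: pos_\<omega>)
    have mem: "comp_op \<phi> (peak (u n)) \<in> A2 \<sigma>"
      using comp peak_in_A2(1)[OF u] unfolding compact_operator_def by blast
    have "\<omega> (cmod (u n)) \<le> M ^ m * \<omega> (cmod (z n))"
    proof (cases "cmod (u n) \<le> cmod (z n)")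
      case True
      have "\<omega> (cmod (u n)) * (1 - cmod (z n)) ^ m \<le> \<omega> (cmod (z n)) * h ^ m"
        using doubling[OF _ True z(2)] by (simp add: h_def)
      also have "\<dots> \<le> \<omega> (cmod (z n)) * (M * (1 - cmod (z n))) ^ m"
        using z3[of n] h w by (intro mult_left_mono power_mono) (auto simp: h_def u_def)
      finally have "\<omega> (cmod (u n)) * (1 - cmod (z n)) ^ m \<le> (M ^ m * \<omega> (cmod (z n))) * (1 - cmod (z n)) ^ m"
        by (simp add: power_mult_distrib mult_ac)
      then show ?thesis using z(2)[of n] by simp
    next
      case False
      then have "\<omega> (cmod (u n)) \<le> 1 * \<omega> (cmod (z n))" using \<omega>_antimono[of "cmod (z n)" "cmod (u n)"] u[of n] by simp
      also have "\<dots> \<le> M ^ m * \<omega> (cmod (z n))" using M w by (intro mult_right_mono) (auto simp: one_le_power)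
      finally show ?thesis .
    qed
    then have ratio: "1 / M ^ m \<le> \<omega> (cmod (z n)) / \<omega> (cmod (u n))" using M w by (simp add: field_simps)
    \<comment> \<open>\<open>1 - |u n|^2\<close> is at most \<open>2 * h\<close>; its power
      \<open>2*m\<close> costs \<open>4 ^ m\<close>.\<close>
    have sq: "1 / 4 ^ m \<le> h ^ (2*m) / cmod (1 - cnj (u n) * u n) ^ (2*m)"
    proof -
      have "1 - cnj (u n) * u n = of_real (1 - (cmod (u n))\<^sup>2)"
        by (simp add: complex_norm_square mult.commute del: of_real_power)
      then have "cmod (1 - cnj (u n) * u n) = 1 - (cmod (u n))\<^sup>2"
        using u[of n] by (metis abs_of_nonneg diff_ge_0_iff_ge norm_of_real less_imp_le norm_ge_zero power_le_one)
      also have "\<dots> = h * (1 + cmod (u n))" by (simp add: h_def algebra_simps power2_eq_square)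
      also have "\<dots> \<le> h * 2" using h u[of n] by (intro mult_left_mono) auto
      finally have d: "cmod (1 - cnj (u n) * u n) \<le> 2 * h" by simp
      have d0: "0 < cmod (1 - cnj (u n) * u n)" unfolding zero_less_norm_iff by (rule cmod_one_minus_ge(3)[OF u u])
      have "1 / 4 ^ m = h ^ (2*m) / (2 * h) ^ (2*m)" using h by (simp add: power_mult_distrib power_mult)
      also have "\<dots> \<le> h ^ (2*m) / cmod (1 - cnj (u n) * u n) ^ (2*m)"
        by (intro divide_left_mono power_mono mult_pos_pos zero_less_power d d0) (use h in simp_all)
      finally show ?thesis .
    qed
    have "1 / (4 * M) ^ m = (1 / M ^ m) * (1 / 4 ^ m)" by (simp add: power_mult_distrib)
    also have "\<dots> \<le> (\<omega> (cmod (z n)) / \<omega> (cmod (u n))) * (h ^ (2*m) / cmod (1 - cnj (u n) * u n) ^ (2*m))"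
      using ratio sq w M by (intro mult_mono) auto
    also have "\<dots> = \<omega> (cmod (z n)) * (cmod (comp_op \<phi> (peak (u n)) (z n)))\<^sup>2"
    proof -
      have "comp_op \<phi> (peak (u n)) (z n) = peak (u n) (u n)" by (simp add: comp_op_def u_def)
      then show ?thesis by (simp add: cmod_peak[OF u] h_def)
    qed
    also have "\<dots> \<le> 2 ^ m * (A2_norm \<sigma> (comp_op \<phi> (peak (u n))))\<^sup>2" by (rule point_bound[OF mem z(2)])
    finally show ?thesis .
  qed
  have "(\<lambda>k. 2 ^ m * (A2_norm \<sigma> (comp_op \<phi> (peak (u (r k)))))\<^sup>2) \<longlonglongrightarrow> 2 ^ m * 0\<^sup>2"
    by (intro tendsto_intros r)
  then have "1 / (4 * M) ^ m \<le> 2 ^ m * 0\<^sup>2" by (rule LIMSEQ_le_const) (use lower in auto)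
  moreover have "0 < 1 / (4 * M) ^ m" using M by simp
  ultimately show False by simp
qed

end

section \<open>The unweighted Bergman space\<close>

lemma weight_one: "weight (\<lambda>_. 1) (\<lambda>r. (1 - r)\<^sup>2 / 2) 2"
proof
  fix r :: real assume r: "0 \<le> r" "r < 1"
  have "(\<integral>\<^sup>+t\<in>{r..<1}. ennreal ((t - r) * 1) \<partial>lborel) = (\<integral>\<^sup>+t\<in>{r..1}. ennreal (t - r) \<partial>lborel)"
    using AE_lborel_singleton[of "1::real"]
    by (intro nn_integral_cong_AE) (auto elim!: eventually_mono split: split_indicator)
  also have "\<dots> = ennreal ((1 - r)\<^sup>2 / 2 - (r - r)\<^sup>2 / 2)"
    by (rule nn_integral_FTC_Icc[where F = "\<lambda>t. (t - r)\<^sup>2 / 2"])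
       (use r in \<open>auto intro!: derivative_eq_intros\<close>)
  finally show "(\<integral>\<^sup>+t\<in>{r..<1}. ennreal ((t - r) * 1) \<partial>lborel) = ennreal ((1 - r)\<^sup>2 / 2)" by simp
next
  have "(\<integral>\<^sup>+t\<in>{0..<1::real}. ennreal 1 \<partial>lborel) = emeasure lborel {0..<1::real}" by simp
  then show "(\<integral>\<^sup>+t\<in>{0..<1::real}. ennreal 1 \<partial>lborel) < \<infinity>" by simp
qed (auto intro!: continuous_intros simp: mult.commute)

text \<open>Here the Hardy windows are merely bounded by a constant times \<open>h ^ 3\<close>, with
  \<open>h = 1 - |u|\<close>. The smallness comes from one factor of \<open>(1 - |z|)^2\<close>: on
  the preimage of the window the angular limit gives
  \<open>1 - |z| \<le> 3/2 * h / M\<close>.\<close>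

lemma compact_operator_bergman_if_angular_limit:
  assumes \<phi>: "\<phi> holomorphic_on ball 0 1" "\<phi> ` ball 0 1 \<subseteq> ball 0 1"
    and lim: "filterlim (\<lambda>z. (1 - cmod (\<phi> z)) / (1 - cmod z)) at_top (filtercomap cmod (at_left 1))"
  shows "compact_operator (A2 (\<lambda>_. 1)) (A2_norm (\<lambda>_. 1)) (comp_op \<phi>)"
proof -
  interpret weight "\<lambda>_. 1" "\<lambda>r. (1 - r)\<^sup>2 / 2" 2 by (rule weight_one)
  show ?thesis
  proof (rule compact_operator_if_window_vanishing[OF \<phi>], intro allI impI)
    fix \<epsilon> :: real assume \<epsilon>: "0 < \<epsilon>"
    define P where "P = 1 - cmod (\<phi> 0)"
    have P: "0 < P" "P \<le> 1" using self_map_cmod_less[OF \<phi>(2), of 0] by (auto simp: P_def)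
    \<comment> \<open>Makes \<open>3/4 * 1000 * 2 / (M * P)\<close> equal to
      \<open>\<epsilon> / 2\<close>, the half belonging to the weight
      \<open>(1 - r)^2 / 2\<close>.\<close>
    define M where "M = 3000 / (\<epsilon> * P)"
    have M: "0 < M" using \<epsilon> P by (simp add: M_def)
    obtain \<rho>1 where \<rho>1: "\<rho>1 < 1" "\<And>z. \<rho>1 < cmod z \<Longrightarrow> cmod z < 1 \<Longrightarrow> M \<le> (1 - cmod (\<phi> z)) / (1 - cmod z)"
      using lim unfolding filterlim_boundary_iff by blast
    \<comment> \<open>Beyond this radius the preimage of the window lies in
      \<open>|z| > \<rho>1\<close>, because \<open>1 - |z| \<le> 12 / P * h\<close> there.\<close>
    define \<rho> where "\<rho> = max (1/2) (1 - (1 - \<rho>1) * P / 12)"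
    have "window \<phi> u \<le> ennreal (\<epsilon> * ((1 - cmod u)\<^sup>2 * ((1 - cmod u)\<^sup>2 / 2)))" if u: "\<rho> < cmod u" "cmod u < 1" for u
    proof -
      define h where "h = 1 - cmod u"
      have h: "0 < h" "12 / P * h < 1 - \<rho>1" using u P by (auto simp: h_def \<rho>_def field_simps)
      have "window \<phi> u \<le> ennreal (3/4 * h / M) * hardy_window \<phi> u"
      proof (rule window_le_hardy_window[OF \<phi>(1)])
        fix z assume z: "cmod z < 1" and v: "\<phi> z \<in> ball u ((1 - cmod u) / 2)"
        note d = preimage_window_boundary_distance[OF \<phi> z v, folded h_def P_def]
        have "\<rho>1 < cmod z" using d(2) h by linarith
        from \<rho>1(2)[OF this z] have "M * (1 - cmod z) \<le> 3/2 * h" using d(1) z by (simp add: le_divide_eq)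
        then have "1 - cmod z \<le> 3/2 * h / M" using M by (simp add: field_simps)
        then have "(1 - cmod z) * (1 - cmod z) \<le> 3/2 * h / M * (1 - cmod z)" using z by (intro mult_right_mono) auto
        then show "(1 - cmod z)\<^sup>2 / 2 \<le> 3/4 * h / M * (1 - cmod z)" by (simp add: power2_eq_square)
      qed (use h M in simp)
      also have "\<dots> \<le> ennreal (3/4 * h / M) * (ennreal (1000 * h ^ 3) * ennreal (2 / P))"
      proof (rule mult_left_mono)
        have "hardy_window \<phi> u \<le> ennreal (1000 * h ^ 3) * hardy_norm2 (kern u \<circ> \<phi>)"
          unfolding h_def by (rule hardy_window_le[OF \<phi>]) (use u in \<open>auto simp: \<rho>_def\<close>)
        also have "\<dots> \<le> ennreal (1000 * h ^ 3) * ennreal (2 / P)"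
          unfolding P_def by (intro mult_left_mono hardy_norm2_kern_compose_le \<phi> u) auto
        finally show "hardy_window \<phi> u \<le> ennreal (1000 * h ^ 3) * ennreal (2 / P)" .
      qed simp
      also have "\<dots> = ennreal (3/4 * h / M * (1000 * h ^ 3 * (2 / P)))"
        using h M by (subst ennreal_mult'[symmetric], simp, subst ennreal_mult'[symmetric]) auto
      also have "3/4 * h / M * (1000 * h ^ 3 * (2 / P)) = \<epsilon> * (h\<^sup>2 * (h\<^sup>2 / 2))"
        using \<epsilon> P by (simp add: M_def field_simps eval_nat_numeral)
      finally show ?thesis by (simp add: h_def)
    qed
    moreover have "\<rho> < 1" using \<rho>1 P by (simp add: \<rho>_def)
    ultimately show "\<exists>\<rho><1. \<forall>u. \<rho> < cmod u \<longrightarrow> cmod u < 1 \<longrightarrow> window \<phi> u \<le> ennreal (\<epsilon> * ((1 - cmod u)\<^sup>2 * ((1 - cmod u)\<^sup>2 / 2)))"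
      by blast
  qed
qed

text \<open>Translates gauge integrals and the real exponent of (W2) into the nonnegative integrals
  and the natural exponent of the locale.\<close>

lemma weight_if_admissible_I:
  assumes cont: "continuous_on {0..<1} \<sigma>" and pos: "\<forall>t\<in>{0..<1}. \<sigma> t > 0"
    and int: "\<sigma> integrable_on {0..<1}" and adm: "admissible_I (omega_sigma \<sigma>)"
  shows "\<exists>m. weight \<sigma> (omega_sigma \<sigma>) m"
proof -
  define \<omega> where "\<omega> = omega_sigma \<sigma>"
  have pos_\<omega>: "\<And>r. 0 \<le> r \<Longrightarrow> r < 1 \<Longrightarrow> 0 < \<omega> r" using adm by (auto simp: admissible_I_def \<omega>_def)
  obtain \<delta> where \<delta>: "0 < \<delta>" "\<And>r s. 0 \<le> r \<Longrightarrow> r \<le> s \<Longrightarrow> s < 1 \<Longrightarrow> \<omega> r / (1 - r) powr (1 + \<delta>) \<le> \<omega> s / (1 - s) powr (1 + \<delta>)"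
    using adm unfolding admissible_I_def \<omega>_def by blast
  \<comment> \<open>The exponent may be enlarged because
    \<open>(1 - r) / (1 - s) \<ge> 1\<close>.\<close>
  define m where "m = nat \<lceil>1 + \<delta>\<rceil>"
  have m: "1 + \<delta> \<le> real m" using \<delta> by (simp add: m_def)
  have "C2_on_01 \<omega>" using adm by (simp add: admissible_I_def \<omega>_def)
  then obtain \<omega>1 where \<omega>1: "\<forall>r\<in>{0..<1}. (\<omega> has_real_derivative \<omega>1 r) (at r within {0..<1})"
    unfolding C2_on_01_def by (elim exE conjE)
  have "weight \<sigma> \<omega> m"
  proof
    show "continuous_on {0..<1} \<sigma>" by (rule cont)
    show "0 < \<sigma> t" if "0 \<le> t" "t < 1" for t using pos that by auto
    show "0 < \<omega> r" if "0 \<le> r" "r < 1" for r using pos_\<omega> that by auto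
    have "(\<integral>\<^sup>+t\<in>{0..<1}. ennreal (\<sigma> t) \<partial>lborel) = ennreal (integral {0..<1} \<sigma>)"
      by (rule nn_integral_has_integral_lebesgue') (use pos int in \<open>auto intro: less_imp_le integrable_integral\<close>)
    then show "(\<integral>\<^sup>+t\<in>{0..<1}. ennreal (\<sigma> t) \<partial>lborel) < \<infinity>" by simp
    show "continuous_on {0..<1} \<omega>"
      unfolding continuous_on_eq_continuous_within using \<omega>1 DERIV_continuous by blast
    show "0 < m" using m \<delta> by (cases m) auto
    show "(\<integral>\<^sup>+t\<in>{r..<1}. ennreal ((t - r) * \<sigma> t) \<partial>lborel) = ennreal (\<omega> r)" if r: "0 \<le> r" "r < 1" for r
    proof (rule nn_integral_has_integral_lebesgue')
      show "0 \<le> (t - r) * \<sigma> t" if "t \<in> {r..<1}" for t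
      proof -
        have "0 < \<sigma> t" using that r pos by auto
        then show ?thesis using that by simp
      qed
      have "(\<lambda>t. (t - r) * \<sigma> t) integrable_on {r..1}"
      proof (rule ccontr)
        \<comment> \<open>\<open>integral\<close> has the default value 0 on non-integrable
          functions, so positivity of \<open>\<omega> r\<close> forces integrability.\<close>
        assume "\<not> ?thesis"
        then have "\<omega> r = 0" unfolding \<omega>_def omega_sigma_def by (rule not_integrable_integral)
        then show False using pos_\<omega>[OF r] by simp
      qed
      then have "((\<lambda>t. (t - r) * \<sigma> t) has_integral \<omega> r) {r..1}"
        unfolding \<omega>_def omega_sigma_def by (rule integrable_integral)
      \<comment> \<open>The endpoint 1, where \<open>\<sigma>\<close> is unconstrained, is a null
        set.\<close>
      then show "((\<lambda>t. (t - r) * \<sigma> t) has_integral \<omega> r) {r..<1}"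
        by (subst has_integral_spike_set_eq[of _ "{r..1}"]) (auto intro: negligible_subset[of "{1}"])
    qed
    show "\<omega> r * (1 - s) ^ m \<le> \<omega> s * (1 - r) ^ m" if rs: "0 \<le> r" "r \<le> s" "s < 1" for r s
    proof -
      define a b where "a = 1 - r" and "b = 1 - s"
      have ab: "0 < b" "b \<le> a" using rs by (auto simp: a_def b_def)
      have ws: "0 < \<omega> s" using rs by (intro pos_\<omega>) auto
      have "\<omega> r / a powr (1 + \<delta>) \<le> \<omega> s / b powr (1 + \<delta>)" using \<delta>(2)[OF rs] by (simp add: a_def b_def)
      then have "\<omega> r \<le> \<omega> s * (a / b) powr (1 + \<delta>)" using ab by (simp add: powr_divide field_simps)
      also have "\<dots> \<le> \<omega> s * (a / b) powr (real m)"
        using ab ws m by (intro mult_left_mono powr_mono) auto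
      also have "\<dots> = \<omega> s * (a ^ m / b ^ m)" using ab by (simp add: powr_realpow power_divide)
      finally show ?thesis using ab by (simp add: a_def[symmetric] b_def[symmetric] field_simps)
    qed
  qed
  then show ?thesis unfolding \<omega>_def by blast
qed

theorem theorem3p2:
  fixes \<phi> :: "complex \<Rightarrow> complex" and \<sigma> :: "real \<Rightarrow> real"
  assumes "\<phi> holomorphic_on ball 0 1" and "\<phi> ` ball 0 1 \<subseteq> ball 0 1"
    and "continuous_on {0..<1} \<sigma>" and "\<forall>t\<in>{0..<1}. \<sigma> t > 0"
    and "\<sigma> integrable_on {0..<1}"
    and "admissible_I (omega_sigma \<sigma>)"
  shows "(compact_operator H2 H2_norm (comp_op \<phi>) \<longrightarrow>
            compact_operator (A2 \<sigma>) (A2_norm \<sigma>) (comp_op \<phi>))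
       \<and> (compact_operator (A2 \<sigma>) (A2_norm \<sigma>) (comp_op \<phi>) \<longrightarrow>
            compact_operator (A2 (\<lambda>_. 1)) (A2_norm (\<lambda>_. 1)) (comp_op \<phi>) \<and>
            filterlim (\<lambda>z. (1 - cmod (\<phi> z)) / (1 - cmod z)) at_top
              (filtercomap cmod (at_left 1)))"
proof -
  obtain m where "weight \<sigma> (omega_sigma \<sigma>) m"
    using weight_if_admissible_I[OF assms(3-6)] by blast
  then interpret weight \<sigma> "omega_sigma \<sigma>" m .
  \<comment> \<open>In part (ii) the angular limit comes first, and compactness on the unweighted
    space is deduced from it.\<close>
  show ?thesis
    using compact_operator_if_hardy_compact[OF assms(1,2)] angular_limit_if_compact_operator[OF assms(1,2)]
      compact_operator_bergman_if_angular_limit[OF assms(1,2)] by blast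
qed

end
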